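(* There exist absolute constants $c>0$, $C>0$ and $c'>0$ such that the following holds for every $n$. Let $\mathcal{A}$ be any randomized algorithm which, given membership-oracle access to a convex body $K\subseteq\mathbb{R}^n$ satisfying $B_n\subseteq K\subseteq C n^{8}B_n$, outputs a number $V$ such that \[(1-c)\operatorname{vol}(K)\le V\le (1+c)\operatorname{vol}(K)\] holds with probability at least $1-1/n$, for every such $K$. Then $\mathcal{A}$ has complexity at least $c'\,n^2/\log n$, i.e. $\Omega(n^2/\log n)$.
   Context: $B_n$ denotes the Euclidean unit ball in $\mathbb{R}^n$ centered at the origin. A membership oracle for $K$ answers, for any query point $x\in\mathbb{R}^n$, whether $x\in K$. A randomized algorithm is a probability distribution over deterministic (adaptive) query algorithms; its complexity is the maximum number of oracle queries it makes (over inputs and randomness). Throughout, $n>12$. *)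

theory Defs
  imports "HOL-Probability.Probability"
begin

text \<open>
  The constants of the theorem do not depend on the dimension, so the dimension is a number
  rather than a type: a point of \<open>n\<close>-space is an element of the extensional function
  space \<open>{..<n} \<rightarrow>\<^sub>E UNIV\<close>, which underlies both the finite product topology and the
  finite product of Lebesgue-Borel measures.
\<close>

type_synonym point = "nat \<Rightarrow> real"

definition Rn :: "nat \<Rightarrow> point topology" where
  "Rn n = product_topology (\<lambda>_. euclideanreal) {..<n}"

definition lebn :: "nat \<Rightarrow> point measure" where
  "lebn n = (\<Pi>\<^sub>M i\<in>{..<n}. lborel)"

definition vol :: "nat \<Rightarrow> point set \<Rightarrow> real" where
  "vol n K = measure (lebn n) K"

definition eball :: "nat \<Rightarrow> real \<Rightarrow> point set" where
  "eball n r = {x \<in> {..<n} \<rightarrow>\<^sub>E UNIV. L2_set x {..<n} \<le> r}"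

definition convex_body :: "nat \<Rightarrow> point set \<Rightarrow> bool" where
  "convex_body n K \<longleftrightarrow>
     compactin (Rn n) K \<and> Rn n interior_of K \<noteq> {} \<and>
     (\<forall>x\<in>K. \<forall>y\<in>K. \<forall>t\<in>{0..1}. (\<lambda>i\<in>{..<n}. (1 - t) * x i + t * y i) \<in> K)"

definition inputs :: "real \<Rightarrow> nat \<Rightarrow> point set set" where
  "inputs C n = {K. convex_body n K \<and> eball n 1 \<subseteq> K \<and> K \<subseteq> eball n (C * real n ^ 8)}"

text \<open>
  A deterministic adaptive algorithm chooses its next action from the list of oracle answers
  received so far (its earlier queries are determined by that list). Nothing forces it to halt.
\<close>

datatype action = Query point | Output real

type_synonym algorithm = "bool list \<Rightarrow> action"

primrec answers :: "algorithm \<Rightarrow> point set \<Rightarrow> nat \<Rightarrow> bool list" where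
  "answers a K 0 = []"
| "answers a K (Suc k) =
     (case a (answers a K k) of
        Query x \<Rightarrow> answers a K k @ [x \<in> K]
      | Output v \<Rightarrow> answers a K k)"

definition outputs :: "algorithm \<Rightarrow> point set \<Rightarrow> real \<Rightarrow> bool" where
  "outputs a K v \<longleftrightarrow> (\<exists>k. a (answers a K k) = Output v)"

text \<open>This is \<open>\<infinity>\<close> exactly when the run on \<open>K\<close> does not halt.\<close>

definition num_queries :: "algorithm \<Rightarrow> point set \<Rightarrow> enat" where
  "num_queries a K = (SUP k. enat (length (answers a K k)))"

text \<open>
  Actions carry the disjoint-union sigma-algebra of the query points and the output values;
  algorithms carry the product sigma-algebra over all answer lists.
\<close>

definition action_space :: "nat \<Rightarrow> action measure" where
  "action_space n =
     sigma (Query ` space (lebn n) \<union> range Output)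
       ({Query ` A | A. A \<in> sets (lebn n)} \<union> {Output ` B | B. B \<in> sets borel})"

definition algorithm_space :: "nat \<Rightarrow> algorithm measure" where
  "algorithm_space n = (\<Pi>\<^sub>M h\<in>UNIV. action_space n)"

text \<open>
  The distribution may live on a subset \<open>space M\<close> of all algorithms, and on a finer
  sigma-algebra; \<open>space M\<close> is the set of algorithms the random choice can produce, so the
  maximum over the randomness in \<open>complexity\<close> ranges over it.
\<close>

definition randomized_algorithm :: "nat \<Rightarrow> algorithm measure \<Rightarrow> bool" where
  "randomized_algorithm n M \<longleftrightarrow> prob_space M \<and> (\<lambda>a. a) \<in> M \<rightarrow>\<^sub>M algorithm_space n"

definition complexity :: "real \<Rightarrow> nat \<Rightarrow> algorithm measure \<Rightarrow> enat" where
  "complexity C n M = (SUP a\<in>space M. SUP K\<in>inputs C n. num_queries a K)"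

end

theory Submission
  imports Defs
begin

text \<open>
  The inputs are products of \<open>Bl \<approx> n / ln n\<close> blocks of dimension about \<open>ln n\<close>. Each block is a ball from
  which a random collection of halfspaces with Gaussian normals cuts off caps: the directions are
  fixed once and for all, and every halfspace is present independently with probability \<open>p\<close>.

  Raising \<open>p = 1/4\<close> to \<open>(1 + \<theta>) / 4\<close> shrinks the expected volume of every block by a factor
  \<open>1 - const * \<theta>\<close>, so with \<open>\<theta>\<close> of order \<open>1 / Bl\<close> the total volume drops by a constant factor. A second
  moment computation shows that the volume is concentrated up to relative variance \<open>O(1/n)\<close>, so an
  accurate algorithm tells the two values of \<open>p\<close> apart with error probability \<open>O(1/n)\<close>.

  On the other hand a query only uncovers independent coins until the first present halfspace that
  separates the query point, which lowers the Bhattacharyya affinity of the two laws by a factor of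
  at least \<open>1 - \<theta>\<^sup>2\<close>. Hence \<open>k\<close> queries require \<open>(1 - \<theta>\<^sup>2) ^ k \<le> O(1 / sqrt n)\<close>, that is
  \<open>k \<ge> const * ln n / \<theta>\<^sup>2\<close>, which is of order \<open>n\<^sup>2 / ln n\<close>.
\<close>

subsection \<open>Independent random subsets and decision trees\<close>

text \<open>Blocks amplify: the relative losses of \<open>Bl\<close> independent factors multiply,
  so \<open>\<theta>\<close> of order \<open>1 / Bl\<close> already halves the total volume, whereas
  a single ball would need a constant \<open>\<theta>\<close> and give only a bound of order
  \<open>ln n\<close>. Concentration limits the number of blocks. The volume of a block fluctuates
  because one halfspace can cut off two points at once; that is rare unless their inner product is a
  fixed fraction of the squared radius, and such pairs are rare only in high dimension. To get
  relative variance of order \<open>1 / n ^ 2\<close> per block, both the dimension and the squared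
  threshold \<open>z\<^sup>2\<close> are taken of order \<open>ln n\<close>.

  A query point can violate a huge number of halfspaces, so charging a loss of affinity to every
  coin would be useless. Since uncovering stops at the first present coin and \<open>p\<close> is a
  constant, only a bounded number of coins matters on average, and the loss per query does not
  depend on the number of halfspaces. That number is about the inverse of a Gaussian tail,
  polynomial in \<open>n\<close>. It dictates the size of the bodies: the offset \<open>h\<close> of
  the halfspaces must be at least the length of every normal for the unit ball to survive.\<close>

definition bern :: "real \<Rightarrow> 'a set \<Rightarrow> ('a set \<Rightarrow> real) \<Rightarrow> real" where
  "bern r J F = (\<Sum>T\<in>Pow J. r ^ card T * (1 - r) ^ card (J - T) * F T)"

lemma bern_cong: "(\<And>T. T \<subseteq> J \<Longrightarrow> F T = G T) \<Longrightarrow> bern r J F = bern r J G"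
  unfolding bern_def by (intro sum.cong) auto

lemma bern_mono:
  assumes "0 \<le> r" "r \<le> 1" "\<And>T. T \<subseteq> J \<Longrightarrow> F T \<le> G T"
  shows "bern r J F \<le> bern r J G"
  unfolding bern_def using assms by (intro sum_mono mult_left_mono) auto

lemma bern_nonneg:
  assumes "0 \<le> r" "r \<le> 1" "\<And>T. T \<subseteq> J \<Longrightarrow> 0 \<le> F T"
  shows "0 \<le> bern r J F"
  unfolding bern_def using assms by (intro sum_nonneg mult_nonneg_nonneg) auto

lemma bern_add: "bern r J (\<lambda>T. F T + G T) = bern r J F + bern r J G"
  unfolding bern_def by (simp add: algebra_simps sum.distrib)

lemma bern_cmult: "bern r J (\<lambda>T. c * F T) = c * bern r J F"
  unfolding bern_def by (simp add: algebra_simps sum_distrib_left)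

text \<open>\<open>bern r J\<close> is the expectation over a random subset containing each element
  of \<open>J\<close> independently with probability \<open>r\<close>. Expanding the product over
  \<open>J\<close> gives one term per subset. Later this turns the chance of surviving all present
  halfspaces into a product over halfspaces.\<close>

lemma bern_prod:
  assumes "finite J"
  shows "bern r J (\<lambda>T. \<Prod>j\<in>T. g j) = (\<Prod>j\<in>J. r * g j + (1 - r))"
proof -
  have "r ^ card T * (1 - r) ^ card (J - T) * (\<Prod>j\<in>T. g j) = (\<Prod>j\<in>T. r * g j) * (\<Prod>j\<in>J-T. 1 - r)"
    for T by (simp only: prod.distrib prod_constant mult_ac)
  then show ?thesis
    unfolding bern_def prod_add[OF assms] by (simp only:)
qed

lemma bern_const: "finite J \<Longrightarrow> bern r J (\<lambda>T. c) = c"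
  using bern_prod[of J r "\<lambda>_. 1"] bern_cmult[of r J c "\<lambda>_. 1"] by simp

text \<open>Conditioning on whether \<open>j\<close> is chosen.\<close>

lemma bern_insert:
  assumes "finite J" "j \<notin> J"
  shows "bern r (insert j J) F = r * bern r J (\<lambda>T. F (insert j T)) + (1 - r) * bern r J F"
proof -
  have disj: "Pow J \<inter> insert j ` Pow J = {}" using assms by auto
  have inj: "inj_on (insert j) (Pow J)" using assms by (auto simp: inj_on_def)
  have 1: "card (insert j T) = Suc (card T)" "insert j J - insert j T = J - T"
    "card (insert j J - T) = Suc (card (J - T))" if "T \<subseteq> J" for T
  proof -
    have T: "finite T" "j \<notin> T" using that assms finite_subset by auto
    then show "card (insert j T) = Suc (card T)" by simp
    show "insert j J - insert j T = J - T" using assms by auto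
    have "insert j J - T = insert j (J - T)" using T by auto
    then show "card (insert j J - T) = Suc (card (J - T))" using assms by simp
  qed
  show ?thesis
    unfolding bern_def Pow_insert
    by (subst sum.union_disjoint)
      (use assms disj in \<open>auto simp: sum.reindex[OF inj] sum_distrib_left 1 mult_ac intro!: sum.cong\<close>)
qed

text \<open>The Bhattacharyya affinity of the two laws of the truth value of \<open>E\<close>.\<close>

definition affinity :: "real \<Rightarrow> real \<Rightarrow> 'a set \<Rightarrow> ('a set \<Rightarrow> bool) \<Rightarrow> real" where
  "affinity p q J E =
     sqrt (bern p J (\<lambda>T. of_bool (E T)) * bern q J (\<lambda>T. of_bool (E T))) +
     sqrt (bern p J (\<lambda>T. of_bool (\<not> E T)) * bern q J (\<lambda>T. of_bool (\<not> E T)))"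

lemma affinity_cong:
  assumes "\<And>T. T \<subseteq> J \<Longrightarrow> E T = F T"
  shows "affinity p q J E = affinity p q J F"
proof -
  have "bern r J (\<lambda>T. of_bool (E T)) = bern r J (\<lambda>T. of_bool (F T))"
    "bern r J (\<lambda>T. of_bool (\<not> E T)) = bern r J (\<lambda>T. of_bool (\<not> F T))" for r
    using assms by (auto intro!: bern_cong)
  then show ?thesis unfolding affinity_def by simp
qed

lemma affinity_const: "finite J \<Longrightarrow> affinity p q J (\<lambda>_. c) = 1"
  unfolding affinity_def by (cases c) (simp_all add: bern_const)

text \<open>Cauchy-Schwarz in the plane for the vectors \<open>(sqrt a, sqrt b)\<close> and
  \<open>(sqrt c, sqrt d)\<close>.\<close>

lemma sqrt_mult_add_ge:
  fixes a b c d :: real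
  assumes "0 \<le> a" "0 \<le> b" "0 \<le> c" "0 \<le> d"
  shows "sqrt (a * c) + sqrt (b * d) \<le> sqrt ((a + b) * (c + d))"
proof -
  have "2 * (sqrt (a * d) * sqrt (b * c)) \<le> (sqrt (a * d))\<^sup>2 + (sqrt (b * c))\<^sup>2"
    using sum_squares_bound[of "sqrt (a*d)" "sqrt (b*c)"] by simp
  then have "2 * (sqrt (a * c) * sqrt (b * d)) \<le> a * d + b * c"
    using assms by (simp add: real_sqrt_mult power_mult_distrib mult_ac)
  then have "(sqrt (a * c) + sqrt (b * d))\<^sup>2 \<le> (a + b) * (c + d)"
    using assms by (simp add: power2_sum algebra_simps)
  then show ?thesis by (rule real_le_rsqrt)
qed

text \<open>The lower bound is the affinity of the joint laws of the coin of \<open>j\<close> and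
  the truth value of \<open>E\<close>; forgetting the coin can only raise the affinity.\<close>

lemma affinity_insert:
  assumes J: "finite J" "j \<notin> J" and p: "0 \<le> p" "p \<le> 1" and q: "0 \<le> q" "q \<le> 1"
  shows "affinity p q (insert j J) E \<ge>
    sqrt (p * q) * affinity p q J (\<lambda>T. E (insert j T)) + sqrt ((1 - p) * (1 - q)) * affinity p q J E"
proof -
  have *: "sqrt (p * q) * sqrt (bern p J (\<lambda>T. F (insert j T)) * bern q J (\<lambda>T. F (insert j T))) +
      sqrt ((1 - p) * (1 - q)) * sqrt (bern p J F * bern q J F)
      \<le> sqrt (bern p (insert j J) F * bern q (insert j J) F)" if "\<And>T. 0 \<le> F T" for F
  proof -
    have "sqrt ((p * bern p J (\<lambda>T. F (insert j T))) * (q * bern q J (\<lambda>T. F (insert j T)))) +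
      sqrt (((1 - p) * bern p J F) * ((1 - q) * bern q J F))
      \<le> sqrt (bern p (insert j J) F * bern q (insert j J) F)"
      unfolding bern_insert[OF J]
      by (rule sqrt_mult_add_ge) (use p q that in \<open>auto intro!: mult_nonneg_nonneg bern_nonneg\<close>)
    then show ?thesis by (simp add: real_sqrt_mult mult_ac)
  qed
  show ?thesis
    using *[of "\<lambda>T. of_bool (E T)"] *[of "\<lambda>T. of_bool (\<not> E T)"]
    unfolding affinity_def by (simp add: algebra_simps)
qed

text \<open>Unlike \<open>answers\<close>, this recursion peels off the first query and resumes from
  an arbitrary history, as the induction in \<open>affinity_run_ge\<close> requires.\<close>

primrec run :: "algorithm \<Rightarrow> point set \<Rightarrow> nat \<Rightarrow> bool list \<Rightarrow> bool list" where
  "run a K 0 l = l"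
| "run a K (Suc k) l = (case a l of Query x \<Rightarrow> run a K k (l @ [x \<in> K]) | Output v \<Rightarrow> l)"

lemma answers_stable: "a (answers a K j) = Output v \<Longrightarrow> answers a K (j + k) = answers a K j"
  by (induction k) auto

lemma answers_add: "answers a K (j + k) = run a K k (answers a K j)"
proof (induction k arbitrary: j)
  case (Suc k)
  show ?case
  proof (cases "a (answers a K j)")
    case (Query x)
    then show ?thesis using Suc.IH[of "Suc j"] by simp
  next
    case (Output v)
    then show ?thesis using answers_stable[of a K j v "Suc k"] by simp
  qed
qed simp

lemma answers_eq_run: "answers a K k = run a K k []"
  using answers_add[of a K 0 k] by simp

text \<open>Only the set \<open>V x\<close> of constraints violated at \<open>x\<close> enters,
  which keeps the decision tree argument free of geometry.\<close>

definition cut_body :: "point set \<Rightarrow> (point \<Rightarrow> 'j set) \<Rightarrow> 'j set \<Rightarrow> point set" where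
  "cut_body B V T = {x \<in> B. T \<inter> V x = {}}"

text \<open>
  A query at \<open>x\<close> is answered by uncovering the elements of \<open>V x\<close> one at a time until one lies in
  the random set; each uncovered element keeps the remaining ones independent.
\<close>

lemma affinity_run_ge:
  assumes p: "0 \<le> p" "p \<le> 1" and q: "0 \<le> q" "q \<le> 1" and rho: "0 \<le> \<rho>" "\<rho> \<le> 1"
    and step: "\<rho> * (1 - sqrt ((1 - p) * (1 - q))) \<le> sqrt (p * q)"
  shows "finite U \<Longrightarrow> \<rho> ^ k \<le> affinity p q U (\<lambda>T. run a (cut_body B V (S \<union> T)) k l \<in> E)"
proof (induction k arbitrary: l U S)
  case 0
  then show ?case by (simp add: affinity_const)
next
  case (Suc k)
  show ?case
  proof (cases "a l")
    case (Output v)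
    then show ?thesis using rho Suc.prems by (simp add: affinity_const power_le_one mult_le_one)
  next
    case (Query x)
    \<comment> \<open>\<open>S\<close> holds the elements known to be present, \<open>U\<close> the
      undecided ones. The induction over the undecided violated elements \<open>W\<close> stays
      inside a single query, so the exponent remains \<open>Suc k\<close> throughout.\<close>
    have reveal: "\<rho> ^ Suc k \<le> affinity p q U
        (\<lambda>T. run a (cut_body B V (S \<union> T)) k (l @ [T \<inter> W = {}]) \<in> E)"
      if "finite W" "finite U" "W \<subseteq> U" for W U
      using that
    proof (induction W arbitrary: U rule: finite_induct)
      case empty
      have "\<rho> ^ Suc k \<le> \<rho> ^ k" using rho by (simp add: mult_left_le_one_le)
      also have "\<dots> \<le> affinity p q U (\<lambda>T. run a (cut_body B V (S \<union> T)) k (l @ [True]) \<in> E)"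
        using Suc.IH empty by blast
      finally show ?case by simp
    next
      case (insert j W)
      define U' where "U' = U - {j}"
      have U: "U = insert j U'" "j \<notin> U'" "finite U'" "W \<subseteq> U'"
        using insert by (auto simp: U'_def)
      let ?E = "\<lambda>T. run a (cut_body B V (S \<union> T)) k (l @ [T \<inter> insert j W = {}]) \<in> E"
      \<comment> \<open>If \<open>j\<close> is present, the query is settled with answer
        \<open>False\<close>: \<open>j\<close> moves to \<open>S\<close>, and only \<open>k\<close>
        queries remain.\<close>
      have 1: "\<rho> ^ k \<le> affinity p q U' (\<lambda>T. ?E (insert j T))"
        using Suc.IH[OF U(3), of "insert j S" "l @ [False]"] by simp
      have "affinity p q U' ?E =
          affinity p q U' (\<lambda>T. run a (cut_body B V (S \<union> T)) k (l @ [T \<inter> W = {}]) \<in> E)"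
        using U(2) by (intro affinity_cong) (metis Int_insert_right_if0 subset_iff)
      then have 2: "\<rho> ^ Suc k \<le> affinity p q U' ?E"
        using insert.IH[OF U(3,4)] by simp
      \<comment> \<open>Write \<open>s = sqrt ((1 - p) * (1 - q))\<close>. For \<open>s < 1\<close>
        the hypothesis \<open>step\<close> bounds \<open>\<rho>\<close> by the geometric series
        \<open>sqrt (p * q) * (1 + s + s ^ 2 + ...)\<close>, the affinity of the position of the
        first present coin. Hence one factor \<open>\<rho>\<close> pays for any number of uncovered
        coins.\<close>
      have "\<rho> ^ Suc k = \<rho> * (1 - sqrt ((1 - p) * (1 - q))) * \<rho> ^ k + sqrt ((1 - p) * (1 - q)) * \<rho> ^ Suc k"
        by (simp add: algebra_simps)
      also have "\<dots> \<le> sqrt (p * q) * affinity p q U' (\<lambda>T. ?E (insert j T)) +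
          sqrt ((1 - p) * (1 - q)) * affinity p q U' ?E"
        using 1 2 step p q rho by (intro add_mono mult_mono) auto
      also have "\<dots> \<le> affinity p q U ?E"
        unfolding U(1) by (rule affinity_insert) (use U p q in auto)
      finally show ?case .
    qed
    show ?thesis
    proof (cases "x \<in> B \<and> S \<inter> V x = {}")
      case True
      have "affinity p q U (\<lambda>T. run a (cut_body B V (S \<union> T)) (Suc k) l \<in> E) =
          affinity p q U (\<lambda>T. run a (cut_body B V (S \<union> T)) k (l @ [T \<inter> (V x \<inter> U) = {}]) \<in> E)"
      proof (rule affinity_cong)
        fix T assume "T \<subseteq> U"
        then have "(x \<in> cut_body B V (S \<union> T)) = (T \<inter> (V x \<inter> U) = {})"
          using True by (auto simp: cut_body_def)
        then show "(run a (cut_body B V (S \<union> T)) (Suc k) l \<in> E) =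
          (run a (cut_body B V (S \<union> T)) k (l @ [T \<inter> (V x \<inter> U) = {}]) \<in> E)"
          using Query by simp
      qed
      then show ?thesis using reveal[of "V x \<inter> U" U] Suc.prems by simp
    next
      case False
      then have "x \<notin> cut_body B V (S \<union> T)" for T by (auto simp: cut_body_def)
      then have "affinity p q U (\<lambda>T. run a (cut_body B V (S \<union> T)) (Suc k) l \<in> E) =
          affinity p q U (\<lambda>T. run a (cut_body B V (S \<union> T)) k (l @ [False]) \<in> E)"
        using Query by simp
      moreover have "\<rho> ^ Suc k \<le> \<rho> ^ k" using rho by (simp add: mult_left_le_one_le)
      ultimately show ?thesis using Suc.IH[OF Suc.prems, of S "l @ [False]"] by simp
    qed
  qed
qed

text \<open>An event that tells the two laws apart with error \<open>e\<close> makes the affinity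
  small: under each square root one factor is at most \<open>e\<close> and the other at most
  1.\<close>

lemma affinity_le:
  assumes "finite J" and p: "0 \<le> p" "p \<le> 1" and q: "0 \<le> q" "q \<le> 1"
    and "bern p J (\<lambda>T. of_bool (\<not> E T)) \<le> e" "bern q J (\<lambda>T. of_bool (E T)) \<le> e"
  shows "affinity p q J E \<le> 2 * sqrt e"
proof -
  have le1: "bern r J (\<lambda>T. of_bool (F T)) \<le> 1" if "0 \<le> r" "r \<le> 1" for r F
    using bern_mono[OF that, of J "\<lambda>T. of_bool (F T)" "\<lambda>_. 1"] bern_const[OF \<open>finite J\<close>, of r 1] by simp
  have nn: "0 \<le> bern r J (\<lambda>T. of_bool (F T))" if "0 \<le> r" "r \<le> 1" for r F
    by (rule bern_nonneg) (use that in auto)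
  have "bern p J (\<lambda>T. of_bool (E T)) * bern q J (\<lambda>T. of_bool (E T)) \<le> 1 * e"
    by (intro mult_mono le1 nn assms) auto
  moreover have "bern p J (\<lambda>T. of_bool (\<not> E T)) * bern q J (\<lambda>T. of_bool (\<not> E T)) \<le> e * 1"
    by (intro mult_mono le1 nn assms order_trans[OF nn assms(6)]) 
  ultimately show ?thesis
    unfolding affinity_def by (smt (verit) mult_1 mult.right_neutral real_sqrt_le_iff)
qed

subsection \<open>Gaussian tails\<close>

abbreviation gauss :: "real measure" where "gauss \<equiv> density lborel std_normal_density"

definition gtail :: "real \<Rightarrow> real" where "gtail z = measure gauss {z<..}"

lemma prob_space_gauss: "prob_space gauss"
  by (rule prob_space_normal_density) simp

lemma integrable_indicator_std_normal [simp]: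
  "A \<in> sets borel \<Longrightarrow> integrable lborel (\<lambda>t. indicator A t * std_normal_density t :: real)"
  using integrable_mult_indicator[of A lborel std_normal_density] by simp

lemma measure_gauss:
  assumes [measurable]: "A \<in> sets borel"
  shows "measure gauss A = (\<integral>t. indicator A t * std_normal_density t \<partial>lborel)"
proof -
  have "emeasure gauss A = (\<integral>\<^sup>+t. ennreal (indicator A t * std_normal_density t) \<partial>lborel)"
    by (subst emeasure_density) (auto intro!: nn_integral_cong simp: indicator_def)
  also have "\<dots> = ennreal (\<integral>t. indicator A t * std_normal_density t \<partial>lborel)"
    by (rule nn_integral_eq_integral) auto
  finally show ?thesis
    by (simp add: measure_def integral_nonneg_AE)
qed

lemma gtail_eq: "gtail z = (\<integral>t. indicator {z<..} t * std_normal_density t \<partial>lborel)"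
  unfolding gtail_def by (rule measure_gauss) simp

lemma gtail_nonneg: "0 \<le> gtail z" and gtail_le_1: "gtail z \<le> 1"
  unfolding gtail_def using prob_space.prob_le_1[OF prob_space_gauss] by auto

lemma gtail_antimono: "z \<le> w \<Longrightarrow> gtail w \<le> gtail z"
  unfolding gtail_def
  by (intro finite_measure.finite_measure_mono prob_space.finite_measure prob_space_gauss) auto

text \<open>Substituting \<open>a * t\<close> writes the tail at \<open>a * z\<close> as an integral
  over the same half-line as \<open>gtail z\<close>, with a weight that decreases in
  \<open>t\<close> when \<open>a \<ge> 1\<close>. The two comparisons below only have to bound this
  weight.\<close>

lemma gtail_scale:
  assumes "a > 0"
  shows "gtail (a * z) =
    a * (\<integral>t. indicator {z<..} t * (exp (- ((a\<^sup>2 - 1) * t\<^sup>2 / 2)) * std_normal_density t) \<partial>lborel)"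
proof -
  have "gtail (a * z) = a * (\<integral>t. indicator {a * z<..} (a * t) * std_normal_density (a * t) \<partial>lborel)"
    unfolding gtail_eq
    by (subst lborel_integral_real_affine[where c=a and t=0]) (use assms in auto)
  also have "(\<lambda>t. indicator {a * z<..} (a * t) * std_normal_density (a * t)) =
      (\<lambda>t. indicator {z<..} t * (exp (- ((a\<^sup>2 - 1) * t\<^sup>2 / 2)) * std_normal_density t))"
    using assms
    by (auto simp: fun_eq_iff indicator_def std_normal_density_def mult_exp_exp field_simps)
  finally show ?thesis .
qed

lemma integrable_std_normal_weight:
  assumes "a \<ge> 1"
  shows "integrable lborel (\<lambda>t. indicator {z<..} t * (exp (- ((a\<^sup>2 - 1) * t\<^sup>2 / 2)) * std_normal_density t))"
proof (rule Bochner_Integration.integrable_bound[OF integrable_normal_density[of 1 0]])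
  have "exp (- ((a\<^sup>2 - 1) * t\<^sup>2 / 2)) * std_normal_density t \<le> 1 * std_normal_density t" for t
    using assms by (intro mult_right_mono) auto
  then show "AE t in lborel. norm (indicator {z<..} t * (exp (- ((a\<^sup>2 - 1) * t\<^sup>2 / 2)) * std_normal_density t))
    \<le> norm (std_normal_density t)"
    by (auto simp: indicator_def)
qed (auto simp: normal_density_def[abs_def])

text \<open>On the half-line the weight is largest at the left end \<open>z\<close>.\<close>

lemma gtail_scale_le:
  assumes "a \<ge> 1" "z \<ge> 0"
  shows "gtail (a * z) \<le> a * exp (- ((a\<^sup>2 - 1) * z\<^sup>2 / 2)) * gtail z"
proof -
  have le: "(\<integral>t. indicator {z<..} t * (exp (- ((a\<^sup>2 - 1) * t\<^sup>2 / 2)) * std_normal_density t) \<partial>lborel)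
      \<le> (\<integral>t. exp (- ((a\<^sup>2 - 1) * z\<^sup>2 / 2)) * (indicator {z<..} t * std_normal_density t) \<partial>lborel)"
  proof (rule integral_mono[OF integrable_std_normal_weight])
    fix t
    show "indicator {z<..} t * (exp (- ((a\<^sup>2 - 1) * t\<^sup>2 / 2)) * std_normal_density t)
      \<le> exp (- ((a\<^sup>2 - 1) * z\<^sup>2 / 2)) * (indicator {z<..} t * std_normal_density t)"
      using assms by (auto simp: indicator_def intro!: mult_right_mono mult_left_mono power_mono)
  qed (use assms in auto)
  then show ?thesis
    using assms mult_left_mono[OF le, of a] gtail_scale[of a z]
    by (simp add: gtail_eq[of z] mult.assoc)
qed

text \<open>Only the part between \<open>z\<close> and \<open>2 * z\<close> is kept; there the
  weight is at least its value at \<open>2 * z\<close>.\<close>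

lemma gtail_scale_ge:
  assumes "a \<ge> 1" "z \<ge> 0"
  shows "exp (- ((a\<^sup>2 - 1) * (2 * z)\<^sup>2 / 2)) * (gtail z - gtail (2 * z)) \<le> gtail (a * z)"
proof -
  have "exp (- ((a\<^sup>2 - 1) * (2 * z)\<^sup>2 / 2)) * (gtail z - gtail (2 * z)) =
      (\<integral>t. exp (- ((a\<^sup>2 - 1) * (2 * z)\<^sup>2 / 2)) *
        (indicator {z<..} t * std_normal_density t - indicator {2 * z<..} t * std_normal_density t) \<partial>lborel)"
    unfolding gtail_eq by simp
  also have "\<dots> \<le> (\<integral>t. indicator {z<..} t * (exp (- ((a\<^sup>2 - 1) * t\<^sup>2 / 2)) * std_normal_density t) \<partial>lborel)"
  proof (rule integral_mono[OF _ integrable_std_normal_weight])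
    fix t
    show "exp (- ((a\<^sup>2 - 1) * (2 * z)\<^sup>2 / 2)) *
        (indicator {z<..} t * std_normal_density t - indicator {2 * z<..} t * std_normal_density t)
      \<le> indicator {z<..} t * (exp (- ((a\<^sup>2 - 1) * t\<^sup>2 / 2)) * std_normal_density t)"
    proof (cases "z < t \<and> t \<le> 2 * z")
      case True
      have "t\<^sup>2 \<le> (2 * z)\<^sup>2" using True assms by (intro power_mono) auto
      then have "(a\<^sup>2 - 1) * t\<^sup>2 \<le> (a\<^sup>2 - 1) * (2 * z)\<^sup>2"
        using assms by (intro mult_left_mono) auto
      then have "exp (- ((a\<^sup>2 - 1) * (2 * z)\<^sup>2 / 2)) \<le> exp (- ((a\<^sup>2 - 1) * t\<^sup>2 / 2))"
        unfolding exp_le_cancel_iff by linarith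
      from mult_right_mono[OF this, of "std_normal_density t"] show ?thesis
        using True by (simp add: indicator_def)
    qed (use assms in \<open>auto simp: indicator_def\<close>)
  qed (use assms in auto)
  also have "\<dots> \<le> gtail (a * z)"
  proof -
    have nn: "0 \<le> (\<integral>t. indicator {z<..} t * (exp (- ((a\<^sup>2 - 1) * t\<^sup>2 / 2)) * std_normal_density t) \<partial>lborel)"
      by (intro Bochner_Integration.integral_nonneg) auto
    show ?thesis
      using assms gtail_scale[of a z] mult_right_mono[OF assms(1) nn] by simp
  qed
  finally show ?thesis .
qed

text \<open>The density is integrated over \<open>{z<..z + 1}\<close> only, where it is at least its
  value at the right end; \<open>1 / 3\<close> is a lower bound for
  \<open>1 / sqrt (2 * pi)\<close>.\<close>

lemma gtail_ge:
  assumes "z \<ge> 0"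
  shows "exp (- ((z + 1)\<^sup>2 / 2)) / 3 \<le> gtail z"
proof -
  have "sqrt (2 * pi) \<le> 3"
    by (rule real_le_lsqrt) (use pi_less_4 in auto)
  then have "1 / 3 \<le> 1 / sqrt (2 * pi)" by (simp add: field_simps)
  then have *: "exp (- ((z + 1)\<^sup>2 / 2)) / 3 \<le> 1 / sqrt (2 * pi) * exp (- ((z + 1)\<^sup>2 / 2))"
    using mult_right_mono[of "1/3" "1 / sqrt (2 * pi)" "exp (- ((z + 1)\<^sup>2 / 2))"] by simp
  have "exp (- ((z + 1)\<^sup>2 / 2)) / 3 = (\<integral>t. indicator {z<..z + 1} t * (exp (- ((z + 1)\<^sup>2 / 2)) / 3) \<partial>lborel)"
    by simp
  also have "\<dots> \<le> gtail z"
    unfolding gtail_eq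
  proof (rule integral_mono)
    fix t
    show "indicator {z<..z + 1} t * (exp (- ((z + 1)\<^sup>2 / 2)) / 3) \<le> indicator {z<..} t * std_normal_density t"
    proof (cases "t \<in> {z<..z + 1}")
      case True
      then have "t\<^sup>2 \<le> (z + 1)\<^sup>2" using assms by (intro power_mono) auto
      then have "1 / sqrt (2 * pi) * exp (- ((z + 1)\<^sup>2 / 2)) \<le> std_normal_density t"
        unfolding std_normal_density_def by (intro mult_left_mono) auto
      with * have "exp (- ((z + 1)\<^sup>2 / 2)) / 3 \<le> std_normal_density t" by linarith
      with True show ?thesis by (simp add: indicator_def)
    qed (auto simp: indicator_def)
  qed auto
  finally show ?thesis .
qed

lemma gtail_pos: "z \<ge> 0 \<Longrightarrow> 0 < gtail z"
  using gtail_ge[of z] by (smt (verit) divide_pos_pos exp_gt_zero)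

text \<open>The case distinction is needed because \<open>h / 0 = 0\<close> would give \<open>gtail 0 = 1/2\<close>.\<close>

definition cutprob :: "real \<Rightarrow> real \<Rightarrow> real" where
  "cutprob h s = (if s = 0 then 0 else gtail (h / s))"

lemma cutprob_nonneg: "0 \<le> cutprob h s" and cutprob_le_1: "cutprob h s \<le> 1"
  unfolding cutprob_def using gtail_nonneg gtail_le_1 by auto

lemma cutprob_mono: "0 \<le> h \<Longrightarrow> 0 \<le> s \<Longrightarrow> s \<le> t \<Longrightarrow> cutprob h s \<le> cutprob h t"
  unfolding cutprob_def by (auto intro!: gtail_antimono divide_left_mono gtail_nonneg)

section \<open>Linear forms of a Gaussian vector\<close>

lemma indep_vars_PiM_gauss:
  fixes A :: "nat set"
  assumes "finite A" "I \<subseteq> A" "I \<noteq> {}"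
  shows "prob_space.indep_vars (PiM A (\<lambda>_. gauss)) (\<lambda>_. borel) (\<lambda>k v. v k) I"
proof -
  interpret G: prob_space gauss by (rule prob_space_gauss)
  interpret product_prob_space "\<lambda>_. gauss" A by unfold_locales
  interpret P: prob_space "PiM A (\<lambda>_. gauss)" by (rule prob_space_PiM) (rule prob_space_gauss)
  have comp: "distr (PiM A (\<lambda>_. gauss)) borel (\<lambda>v. v k) = gauss" if "k \<in> I" for k
    using distr_PiM_component[of A "\<lambda>_. gauss" k] prob_space_gauss that assms
    by (metis (mono_tags, lifting) distr_cong sets_density sets_lborel subsetD)
  have "PiM I (\<lambda>k. distr (PiM A (\<lambda>_. gauss)) borel (\<lambda>v. v k)) = PiM I (\<lambda>_. gauss)"
    by (rule PiM_cong) (use comp in auto)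
  also have "\<dots> = distr (PiM A (\<lambda>_. gauss)) (PiM I (\<lambda>_. gauss)) (\<lambda>v. restrict v I)"
    using distr_PiM_restrict_finite[of I] assms finite_subset by metis
  also have "\<dots> = distr (PiM A (\<lambda>_. gauss)) (PiM I (\<lambda>_. borel)) (\<lambda>v. \<lambda>k\<in>I. v k)"
    by (rule distr_cong) (auto intro!: sets_PiM_cong)
  finally show ?thesis
    using assms by (subst P.indep_vars_iff_distr_eq_PiM') auto
qed

lemma distributed_PiM_gauss:
  fixes A :: "nat set"
  assumes "finite A" "k \<in> A"
  shows "distributed (PiM A (\<lambda>_. gauss)) lborel (\<lambda>v. v k) std_normal_density"
proof -
  have "distr (PiM A (\<lambda>_. gauss)) lborel (\<lambda>v. v k) = distr (PiM A (\<lambda>_. gauss)) gauss (\<lambda>v. v k)"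
    by (rule distr_cong) auto
  then show ?thesis
    unfolding distributed_def using distr_PiM_component[of A "\<lambda>_. gauss" k] prob_space_gauss assms
    by auto
qed

text \<open>The linear form is a sum of independent centred normal variables, hence normal with
  standard deviation \<open>L2_set x I\<close>.\<close>

lemma measure_PiM_gauss_halfspace:
  fixes A :: "nat set" and x :: point
  assumes A: "finite A" "I \<subseteq> A" and h: "h \<ge> 0"
  shows "measure (PiM A (\<lambda>_. gauss)) {v \<in> space (PiM A (\<lambda>_. gauss)). h < (\<Sum>k\<in>I. v k * x k)} =
    cutprob h (L2_set x I)"
proof -
  let ?M = "PiM A (\<lambda>_. gauss)"
  interpret P: prob_space ?M by (rule prob_space_PiM) (rule prob_space_gauss)
  \<comment> \<open>Vanishing coefficients are dropped, since they would contribute degenerate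
    normal laws of deviation 0.\<close>
  define I' where "I' = {k \<in> I. x k \<noteq> 0}"
  have fin: "finite I" using A finite_subset by auto
  have I': "I' \<subseteq> A" "finite I'" using A fin by (auto simp: I'_def)
  have sum_eq: "(\<Sum>k\<in>I. v k * x k) = (\<Sum>k\<in>I'. v k * x k)" for v
    using fin by (intro sum.mono_neutral_right) (auto simp: I'_def)
  have "(\<Sum>k\<in>I. (x k)\<^sup>2) = (\<Sum>k\<in>I'. (x k)\<^sup>2)"
    using fin by (intro sum.mono_neutral_right) (auto simp: I'_def)
  then have L2_eq: "L2_set x I = L2_set x I'" by (simp add: L2_set_def)
  show ?thesis
  proof (cases "I' = {}")
    case True
    then show ?thesis using h by (simp add: sum_eq L2_eq cutprob_def)
  next
    case False
    define s where "s = L2_set x I'"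
    have s: "s > 0"
      unfolding s_def L2_set_def using False I' by (auto simp: I'_def intro!: sum_pos)
    have "distributed ?M lborel (\<lambda>v. 0 + x k * v k) (normal_density (0 + x k * 0) (\<bar>x k\<bar> * 1))" if "k \<in> I'" for k
      by (rule P.normal_density_affine) (use that I' A in \<open>auto simp: I'_def intro!: distributed_PiM_gauss\<close>)
    then have D: "distributed ?M lborel (\<lambda>v. v k * x k) (normal_density 0 \<bar>x k\<bar>)" if "k \<in> I'" for k
      using that by (simp add: mult.commute)
    have ind: "P.indep_vars (\<lambda>_. borel) (\<lambda>k v. v k * x k) I'"
      using P.indep_vars_compose2[OF indep_vars_PiM_gauss[OF A(1) I'(1) False], of "\<lambda>k t. t * x k" "\<lambda>_. borel"]
      by simp
    have "distributed ?M lborel (\<lambda>v. \<Sum>k\<in>I'. v k * x k)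
        (normal_density (\<Sum>k\<in>I'. 0) (sqrt (\<Sum>k\<in>I'. \<bar>x k\<bar>\<^sup>2)))"
      by (rule P.sum_indep_normal) (use I' False ind D in \<open>auto simp: I'_def\<close>)
    then have "distributed ?M lborel (\<lambda>v. \<Sum>k\<in>I'. v k * x k) (normal_density 0 s)"
      by (simp add: s_def L2_set_def)
    then have S: "distributed ?M lborel (\<lambda>v. ((\<Sum>k\<in>I'. v k * x k) - 0) / s) std_normal_density"
      by (rule P.normal_standard_normal_convert[OF s, THEN iffD1])
    have "measure ?M {v \<in> space ?M. h < (\<Sum>k\<in>I. v k * x k)} =
        measure ?M ((\<lambda>v. ((\<Sum>k\<in>I'. v k * x k) - 0) / s) -` {h / s<..} \<inter> space ?M)"
      using s by (intro arg_cong[where f="measure ?M"]) (auto simp: sum_eq field_simps)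
    also have "\<dots> = measure (distr ?M lborel (\<lambda>v. ((\<Sum>k\<in>I'. v k * x k) - 0) / s)) {h / s<..}"
      using distributed_measurable[OF S] by (subst measure_distr) auto
    also have "\<dots> = gtail (h / s)"
      using S by (simp add: gtail_def distributed_distr_eq_density)
    finally show ?thesis using s by (simp add: cutprob_def L2_eq s_def)
  qed
qed

text \<open>Second moments bound the lengths of the normals in
  \<open>exists_directions\<close>.\<close>

lemma nn_integral_PiM_gauss_square:
  fixes A :: "nat set"
  assumes "finite A" "k \<in> A"
  shows "(\<integral>\<^sup>+v. ennreal ((v k)\<^sup>2) \<partial>PiM A (\<lambda>_. gauss)) = 1"
proof -
  have "(\<integral>\<^sup>+v. ennreal ((v k)\<^sup>2) \<partial>PiM A (\<lambda>_. gauss)) =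
      (\<integral>\<^sup>+t. ennreal (std_normal_density t) * ennreal (t\<^sup>2) \<partial>lborel)"
    by (rule distributed_nn_integral[OF distributed_PiM_gauss[OF assms], symmetric]) simp
  also have "\<dots> = (\<integral>\<^sup>+t. ennreal (std_normal_density t * t ^ (2 * 1)) \<partial>lborel)"
    by (intro nn_integral_cong) (simp add: ennreal_mult)
  also have "\<dots> = ennreal (fact (2 * 1) / (2 ^ 1 * fact 1))"
    using std_normal_moment_even[of 1] unfolding has_bochner_integral_iff
    by (subst nn_integral_eq_integral) auto
  finally show ?thesis by simp
qed

subsection \<open>Volumes of balls and caps\<close>

abbreviation leb :: "nat set \<Rightarrow> point measure" where "leb I \<equiv> PiM I (\<lambda>_. lborel)"

definition L2_ball :: "nat set \<Rightarrow> real \<Rightarrow> point set" where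
  "L2_ball I r = {x \<in> I \<rightarrow>\<^sub>E UNIV. L2_set x I \<le> r}"

definition ball_vol :: "nat set \<Rightarrow> real \<Rightarrow> real" where
  "ball_vol I r = unit_ball_vol (card I) * r ^ card I"

lemma ball_vol_pos: "r > 0 \<Longrightarrow> ball_vol I r > 0"
  by (simp add: ball_vol_def)

interpretation leb: product_sigma_finite "\<lambda>_::nat. lborel :: real measure"
  by unfold_locales

lemma sets_L2_ball [measurable]: "finite I \<Longrightarrow> L2_ball I r \<in> sets (leb I)"
proof -
  have "L2_ball I r = {x \<in> space (leb I). L2_set x I \<le> r}"
    by (auto simp: L2_ball_def space_PiM)
  then show ?thesis by (simp add: L2_set_def)
qed

lemma emeasure_L2_ball:
  assumes "finite I" "r > 0"
  shows "emeasure (leb I) (L2_ball I r) = ennreal (ball_vol I r)"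
proof -
  have "L2_ball I r = {f. sqrt (\<Sum>i\<in>I. (f i)\<^sup>2) \<le> r} \<inter> space (leb I)"
    by (auto simp: L2_ball_def L2_set_def space_PiM)
  then show ?thesis using emeasure_cball_aux[OF assms] by (simp add: ball_vol_def)
qed

lemma measure_L2_ball:
  assumes "finite I" "r > 0"
  shows "measure (leb I) (L2_ball I r) = ball_vol I r"
  using emeasure_L2_ball[OF assms] ball_vol_pos[OF assms(2), of I] by (simp add: measure_def)

lemma leb_translate:
  assumes "finite I"
  shows "distr (leb I) (leb I) (\<lambda>x. \<lambda>i\<in>I. c i + x i) = leb I"
proof (rule leb.PiM_eqI)
  fix A :: "nat \<Rightarrow> real set" assume A: "\<And>i. i \<in> I \<Longrightarrow> A i \<in> sets lborel"
  have B: "(+) (c i) -` A i \<in> sets lborel" if "i \<in> I" for i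
    using measurable_sets[of "(+) (c i)" borel borel "A i"] A[OF that] by simp
  have "emeasure (distr (leb I) (leb I) (\<lambda>x. \<lambda>i\<in>I. c i + x i)) (Pi\<^sub>E I A) =
      emeasure (leb I) ((\<lambda>x. \<lambda>i\<in>I. c i + x i) -` Pi\<^sub>E I A \<inter> space (leb I))"
    using A assms by (intro emeasure_distr) (auto intro!: sets_PiM_I_finite)
  also have "(\<lambda>x. \<lambda>i\<in>I. c i + x i) -` Pi\<^sub>E I A \<inter> space (leb I) = Pi\<^sub>E I (\<lambda>i. (+) (c i) -` A i)"
    by (auto simp: space_PiM PiE_iff)
  also have "emeasure (leb I) \<dots> = (\<Prod>i\<in>I. emeasure lborel ((+) (c i) -` A i))"
    using assms B by (intro leb.emeasure_PiM) auto
  also have "\<dots> = (\<Prod>i\<in>I. emeasure lborel (A i))"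
  proof (rule prod.cong)
    fix i assume "i \<in> I"
    then have "emeasure (distr lborel borel ((+) (c i))) (A i) = emeasure lborel ((+) (c i) -` A i \<inter> space lborel)"
      using A by (intro emeasure_distr) auto
    then show "emeasure lborel ((+) (c i) -` A i) = emeasure lborel (A i)"
      by (simp add: lborel_distr_plus)
  qed simp
  finally show "emeasure (distr (leb I) (leb I) (\<lambda>x. \<lambda>i\<in>I. c i + x i)) (Pi\<^sub>E I A) =
    (\<Prod>i\<in>I. emeasure lborel (A i))" .
qed (use assms in auto)

text \<open>The cap lies in the ball of radius \<open>r * sqrt (1 - e\<^sup>2)\<close> centred at \<open>e * y\<close>.\<close>

lemma emeasure_cap_le:
  assumes I: "finite I" and r: "r > 0" and e: "0 \<le> e" "e < 1" and y: "L2_set y I \<le> r"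
  shows "emeasure (leb I) {x \<in> L2_ball I r. e * r\<^sup>2 < (\<Sum>i\<in>I. x i * y i)}
    \<le> ennreal (ball_vol I r * sqrt (1 - e\<^sup>2) ^ card I)"
proof -
  let ?s = "r * sqrt (1 - e\<^sup>2)" and ?t = "\<lambda>x. \<lambda>i\<in>I. - (e * y i) + x i"
  have "e\<^sup>2 < 1" using e by (simp add: abs_square_less_1)
  then have s: "?s > 0" using r by simp
  have t: "?t \<in> measurable (leb I) (leb I)" by simp
  have sub: "{x \<in> L2_ball I r. e * r\<^sup>2 < (\<Sum>i\<in>I. x i * y i)} \<subseteq> ?t -` L2_ball I ?s \<inter> space (leb I)"
  proof clarify
    fix x assume x: "x \<in> L2_ball I r" and gt: "e * r\<^sup>2 < (\<Sum>i\<in>I. x i * y i)"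
    have sq: "(\<Sum>i\<in>I. (w i)\<^sup>2) \<le> r\<^sup>2" if "L2_set w I \<le> r" for w
      using that by (simp add: L2_set_def sqrt_le_D)
    have "(\<Sum>i\<in>I. (- (e * y i) + x i)\<^sup>2) = (\<Sum>i\<in>I. (x i)\<^sup>2) - 2 * e * (\<Sum>i\<in>I. x i * y i) + e\<^sup>2 * (\<Sum>i\<in>I. (y i)\<^sup>2)"
      by (simp add: power2_eq_square algebra_simps sum.distrib sum_subtractf sum_distrib_left)
    also have "\<dots> \<le> r\<^sup>2 - 2 * e * (e * r\<^sup>2) + e\<^sup>2 * r\<^sup>2"
      using x y e gt by (intro add_mono diff_mono mult_left_mono sq) (auto simp: L2_ball_def)
    also have "\<dots> = ?s\<^sup>2"
      using \<open>e\<^sup>2 < 1\<close> by (simp add: power_mult_distrib algebra_simps) (simp add: power2_eq_square)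
    finally have "L2_set (?t x) I \<le> ?s"
      unfolding L2_set_def using s by (intro real_le_lsqrt) (auto intro: sum_nonneg)
    then show "x \<in> ?t -` L2_ball I ?s \<inter> space (leb I)"
      using x by (auto simp: L2_ball_def space_PiM)
  qed
  have "emeasure (leb I) {x \<in> L2_ball I r. e * r\<^sup>2 < (\<Sum>i\<in>I. x i * y i)} \<le>
      emeasure (leb I) (?t -` L2_ball I ?s \<inter> space (leb I))"
    using sub I by (intro emeasure_mono measurable_sets[OF t]) auto
  also have "\<dots> = emeasure (distr (leb I) (leb I) ?t) (L2_ball I ?s)"
    using I by (intro emeasure_distr[symmetric] t) auto
  also have "\<dots> = ennreal (ball_vol I ?s)"
    unfolding leb_translate[OF I] by (rule emeasure_L2_ball[OF I s])
  finally show ?thesis by (simp add: ball_vol_def power_mult_distrib mult_ac)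
qed

subsection \<open>One block of coordinates\<close>

lemma gtail_measurable [measurable]: "gtail \<in> borel_measurable borel"
proof -
  have "mono (\<lambda>z. - gtail z)" by (auto intro!: monoI gtail_antimono)
  then have "(\<lambda>z. - (- gtail z)) \<in> borel_measurable borel"
    by (intro borel_measurable_uminus borel_measurable_mono)
  then show ?thesis by simp
qed

lemma cutprob_measurable [measurable]: "cutprob h \<in> borel_measurable borel"
  unfolding cutprob_def[abs_def] by measurable

lemma coordinate_measurable: "k \<in> A \<Longrightarrow> (\<lambda>x. x k) \<in> borel_measurable (leb A)"
  using measurable_component_singleton[of k A "\<lambda>_. lborel"] by simp

lemma L2_set_measurable:
  assumes "finite I" "I \<subseteq> A"
  shows "(\<lambda>x. L2_set x I) \<in> borel_measurable (leb A)"
proof -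
  have [measurable]: "(\<lambda>x. x k) \<in> borel_measurable (leb A)" if "k \<in> I" for k
    using coordinate_measurable assms that by auto
  show ?thesis unfolding L2_set_def by measurable
qed

text \<open>The normal lives on all coordinates \<open>A\<close>, but only its entries in the block
  \<open>I\<close> enter; thus the normals of all blocks can share one space.\<close>

definition cutboth :: "real \<Rightarrow> nat set \<Rightarrow> nat set \<Rightarrow> point \<Rightarrow> point \<Rightarrow> real" where
  "cutboth h A I x y = measure (PiM A (\<lambda>_. gauss))
     {v \<in> space (PiM A (\<lambda>_. gauss)). h < (\<Sum>k\<in>I. v k * x k) \<and> h < (\<Sum>k\<in>I. v k * y k)}"

definition cuteither :: "real \<Rightarrow> nat set \<Rightarrow> nat set \<Rightarrow> point \<Rightarrow> point \<Rightarrow> real" where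
  "cuteither h A I x y = measure (PiM A (\<lambda>_. gauss))
     {v \<in> space (PiM A (\<lambda>_. gauss)). h < (\<Sum>k\<in>I. v k * x k) \<or> h < (\<Sum>k\<in>I. v k * y k)}"

lemma cut_sets:
  fixes A :: "nat set"
  assumes "finite A" "I \<subseteq> A"
  shows "{v \<in> space (PiM A (\<lambda>_. gauss)). h < (\<Sum>k\<in>I. v k * x k)} \<in> sets (PiM A (\<lambda>_. gauss))"
proof -
  have [measurable]: "(\<lambda>v. \<Sum>k\<in>I. v k * x k) \<in> borel_measurable (PiM A (\<lambda>_. gauss))"
  proof (intro borel_measurable_sum borel_measurable_times borel_measurable_const)
    fix k assume "k \<in> I"
    then have "(\<lambda>v. v k) \<in> measurable (PiM A (\<lambda>_. gauss)) gauss"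
      using assms by (intro measurable_component_singleton) auto
    then show "(\<lambda>v. v k) \<in> borel_measurable (PiM A (\<lambda>_. gauss))" by simp
  qed
  show ?thesis by measurable
qed

lemma cuteither_bounds: "0 \<le> cuteither h A I x y" "cuteither h A I x y \<le> 1"
proof -
  interpret P: prob_space "PiM A (\<lambda>_. gauss)" by (rule prob_space_PiM) (rule prob_space_gauss)
  show "0 \<le> cuteither h A I x y" "cuteither h A I x y \<le> 1" by (auto simp: cuteither_def)
qed

lemma cuteither_eq:
  assumes A: "finite A" "I \<subseteq> A" and h: "h \<ge> 0"
  shows "cuteither h A I x y = cutprob h (L2_set x I) + cutprob h (L2_set y I) - cutboth h A I x y"
proof -
  interpret P: prob_space "PiM A (\<lambda>_. gauss)" by (rule prob_space_PiM) (rule prob_space_gauss)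
  let ?S = "\<lambda>x. {v \<in> space (PiM A (\<lambda>_. gauss)). h < (\<Sum>k\<in>I. v k * x k)}"
  have "cuteither h A I x y = P.prob (?S x \<union> ?S y)" "cutboth h A I x y = P.prob (?S x \<inter> ?S y)"
    unfolding cuteither_def cutboth_def by (auto intro!: arg_cong[where f="measure _"])
  then show ?thesis
    using measure_Un3[of "?S x" "PiM A (\<lambda>_. gauss)" "?S y"] cut_sets[OF A, of h]
      measure_PiM_gauss_halfspace[OF A h] by (simp add: P.fmeasurable_eq_sets)
qed

text \<open>The second bound adds the two inequalities. It is the useful one when
  \<open>x + y\<close> is clearly shorter than twice the radius.\<close>

lemma cutboth_le:
  assumes A: "finite A" "I \<subseteq> A" and h: "h \<ge> 0"
  shows "cutboth h A I x y \<le> cutprob h (L2_set x I)"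
    and "cutboth h A I x y \<le> cutprob (2 * h) (L2_set (\<lambda>k. x k + y k) I)"
proof -
  interpret P: prob_space "PiM A (\<lambda>_. gauss)" by (rule prob_space_PiM) (rule prob_space_gauss)
  show "cutboth h A I x y \<le> cutprob h (L2_set x I)"
    unfolding measure_PiM_gauss_halfspace[OF A h, symmetric] cutboth_def
    using cut_sets[OF A, of h] by (intro P.finite_measure_mono) auto
  have "0 \<le> 2 * h" using h by simp
  show "cutboth h A I x y \<le> cutprob (2 * h) (L2_set (\<lambda>k. x k + y k) I)"
    unfolding measure_PiM_gauss_halfspace[OF A \<open>0 \<le> 2 * h\<close>, symmetric] cutboth_def
    using cut_sets[OF A, of "2 * h" "\<lambda>k. x k + y k"]
    by (intro P.finite_measure_mono) (auto simp: distrib_left sum.distrib)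
qed

section \<open>Elementary bounds for the exponential function\<close>

lemma one_minus_ge_exp:
  fixes a :: real
  assumes "0 \<le> a" "a \<le> 1/2"
  shows "exp (- (2 * a)) \<le> 1 - a"
proof -
  have "- a - 2 * a\<^sup>2 \<le> ln (1 - a)" using assms by (intro ln_one_minus_pos_lower_bound) auto
  moreover have "2 * a\<^sup>2 \<le> a" using assms mult_left_mono[of "2 * a" 1 a] by (simp add: power2_eq_square)
  ultimately have "- (2 * a) \<le> ln (1 - a)" by simp
  then have "exp (- (2 * a)) \<le> exp (ln (1 - a))" by (simp only: exp_le_cancel_iff)
  then show ?thesis using assms by simp
qed

lemma exp_minus_le_half:
  fixes t :: real
  assumes "0 \<le> t" "t \<le> 1"
  shows "exp (- t) \<le> 1 - t / 2"
  using one_minus_ge_exp[of "t / 2"] assms by simp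

lemma exp_le_linear:
  fixes t c :: real
  assumes "0 \<le> t" "t \<le> c"
  shows "exp t \<le> 1 + t * exp c"
proof -
  have "1 - t \<le> exp (- t)" using exp_ge_add_one_self[of "- t"] by simp
  then have "exp t * (1 - t) \<le> exp t * exp (- t)" by (intro mult_left_mono) auto
  then have "exp t \<le> 1 + t * exp t" by (simp add: algebra_simps flip: exp_add)
  also have "t * exp t \<le> t * exp c" using assms by (intro mult_left_mono) auto
  finally show ?thesis by simp
qed

text \<open>A ball of radius \<open>r\<close> with \<open>N\<close> potential halfspaces at offset
  \<open>h\<close>. Relative to \<open>r\<close> the offset is \<open>z\<close>, so a boundary point
  is cut off by one random normal with probability \<open>Q\<close>, and on average by
  \<open>N * Q\<close> of them, a number between 1 and 2. By \<open>shell\<close>, a point at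
  relative depth \<open>1 / card I\<close> still has a constant fraction of this
  probability.\<close>

locale block =
  fixes I A :: "nat set" and r z h Q :: real and N :: nat
  assumes A: "finite A" and IA: "I \<subseteq> A" and I_ge_2: "2 \<le> card I"
    and r_pos: "0 < r" and z_pos: "0 < z" and h_eq: "h = z * r"
    and Q_eq: "Q = gtail z" and NQ: "1 \<le> real N * Q" "real N * Q \<le> 2"
    and shell: "Q / 4 \<le> gtail (z * (real (card I) / (real (card I) - 1)))"
begin

lemma finI: "finite I" using A IA finite_subset by auto

lemma h_pos: "0 < h" using h_eq r_pos z_pos by simp

lemma Q_nonneg: "0 \<le> Q"
  using gtail_nonneg Q_eq by auto

abbreviation F :: "point \<Rightarrow> real" where "F x \<equiv> cutprob h (L2_set x I)"

text \<open>The expected volume of the block when every halfspace is present with probability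
  \<open>p\<close>: a point survives each of the \<open>N\<close> independent halfspaces with
  probability \<open>1 - p * F x\<close>.\<close>

definition W :: "real \<Rightarrow> real" where
  "W p = (\<integral>x. indicator (L2_ball I r) x * (1 - p * F x) ^ N \<partial>leb I)"

lemma F_le_Q: "L2_set x I \<le> r \<Longrightarrow> F x \<le> Q"
proof -
  assume "L2_set x I \<le> r"
  then have "F x \<le> cutprob h r" using h_pos by (intro cutprob_mono) auto
  then show ?thesis using r_pos by (simp add: cutprob_def h_eq Q_eq)
qed

lemma F_measurable [measurable]: "F \<in> borel_measurable (leb I)"
  using measurable_compose[OF L2_set_measurable[OF finI order_refl] cutprob_measurable] by simp

text \<open>On average at most \<open>1/2 * (N * Q) \<le> 1\<close> present halfspaces cut off a
  given point, so its survival probability is bounded below by a constant.\<close>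

lemma factor_bounds:
  assumes "0 \<le> p" "p \<le> 1/2" "x \<in> L2_ball I r"
  shows "exp (-2) \<le> (1 - p * F x) ^ N" "(1 - p * F x) ^ N \<le> 1" "0 \<le> p * F x" "p * F x \<le> 1/2"
proof -
  have FQ: "F x \<le> Q" using assms F_le_Q by (simp add: L2_ball_def)
  show 1: "0 \<le> p * F x" using assms cutprob_nonneg by simp
  have "p * F x \<le> 1/2 * 1" using assms cutprob_nonneg cutprob_le_1 by (intro mult_mono) auto
  then show 2: "p * F x \<le> 1/2" by simp
  show "(1 - p * F x) ^ N \<le> 1" using 1 2 by (intro power_le_one) auto
  have "p * F x * N \<le> 1/2 * (Q * N)"
    unfolding mult.assoc using assms FQ cutprob_nonneg Q_nonneg by (intro mult_mono mult_right_mono) auto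
  then have "exp (-2) \<le> exp (- (2 * (p * F x))) ^ N"
    using NQ by (simp add: mult.commute flip: exp_of_nat_mult)
  also have "\<dots> \<le> (1 - p * F x) ^ N" using 1 2 by (intro power_mono one_minus_ge_exp) auto
  finally show "exp (-2) \<le> (1 - p * F x) ^ N" .
qed

lemma integrable_ball:
  assumes [measurable]: "f \<in> borel_measurable (leb I)"
    and "\<And>x. x \<in> L2_ball I r \<Longrightarrow> \<bar>f x\<bar> \<le> c"
  shows "integrable (leb I) (\<lambda>x. indicator (L2_ball I r) x * f x :: real)"
proof (rule Bochner_Integration.integrable_bound)
  show "integrable (leb I) (\<lambda>x. c * indicator (L2_ball I r) x :: real)"
    using emeasure_L2_ball[OF finI r_pos] finI by simp
  show "(\<lambda>x. indicator (L2_ball I r) x * f x) \<in> borel_measurable (leb I)"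
    using finI by measurable
  show "AE x in leb I. norm (indicator (L2_ball I r) x * f x) \<le> norm (c * indicator (L2_ball I r) x)"
  proof (rule AE_I2)
    fix x
    show "norm (indicator (L2_ball I r) x * f x) \<le> norm (c * indicator (L2_ball I r) x)"
      using assms(2)[of x] by (cases "x \<in> L2_ball I r") (auto simp: indicator_def)
  qed
qed

lemma integrable_factor:
  assumes "0 \<le> p" "p \<le> 1/2"
  shows "integrable (leb I) (\<lambda>x. indicator (L2_ball I r) x * (1 - p * F x) ^ N)"
proof (rule integrable_ball)
  show "\<bar>(1 - p * F x) ^ N\<bar> \<le> 1" if "x \<in> L2_ball I r" for x
    using factor_bounds[OF assms that] by (smt (verit) exp_gt_zero)
qed measurable

lemma W_ge:
  assumes "0 \<le> p" "p \<le> 1/2"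
  shows "exp (-2) * ball_vol I r \<le> W p"
proof -
  have "exp (-2) * ball_vol I r = (\<integral>x. indicator (L2_ball I r) x * exp (-2) \<partial>leb I)"
    using measure_L2_ball[OF finI r_pos] emeasure_L2_ball[OF finI r_pos] finI by simp
  also have "\<dots> \<le> W p"
    unfolding W_def
    by (intro integral_mono integrable_factor integrable_ball[where c="exp(-2)"] assms)
      (use factor_bounds[OF assms] in \<open>auto simp: indicator_def\<close>)
  finally show ?thesis .
qed

lemma W_pos: "0 \<le> p \<Longrightarrow> p \<le> 1/2 \<Longrightarrow> 0 < W p"
  using W_ge[of p] ball_vol_pos[OF r_pos, of I] by (smt (verit) exp_gt_zero mult_pos_pos)

lemma W_le:
  assumes "0 \<le> p" "p \<le> 1/2"
  shows "W p \<le> ball_vol I r"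
proof -
  have "W p \<le> (\<integral>x. indicator (L2_ball I r) x * 1 \<partial>leb I)"
    unfolding W_def
    by (intro integral_mono integrable_factor integrable_ball[where c=1] assms)
      (use factor_bounds[OF assms] in \<open>auto simp: indicator_def\<close>)
  also have "\<dots> = ball_vol I r"
    using measure_L2_ball[OF finI r_pos] emeasure_L2_ball[OF finI r_pos] finI by simp
  finally show ?thesis .
qed

lemma nn_W:
  assumes "0 \<le> p" "p \<le> 1/2"
  shows "(\<integral>\<^sup>+x. ennreal (indicator (L2_ball I r) x * (1 - p * F x) ^ N) \<partial>leb I) = ennreal (W p)"
  unfolding W_def
proof (rule nn_integral_eq_integral[OF integrable_factor[OF assms]], rule AE_I2)
  show "0 \<le> indicator (L2_ball I r) x * (1 - p * F x) ^ N" for x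
    using factor_bounds(1)[OF assms, of x] by (auto simp: indicator_def intro: order_trans[OF exp_ge_zero])
qed

text \<open>
  The halfspaces meet the ball mostly in the shell of relative width \<open>1 / card I\<close>, which
  carries a constant fraction of its volume; there raising the density \<open>p\<close> has a visible effect.
\<close>

lemma W_decrease:
  assumes th: "0 \<le> \<theta>" "\<theta> \<le> 1"
  shows "W ((1 + \<theta>) / 4) \<le> (1 - \<theta> / 512) * W (1 / 4)"
proof -
  define m where "m = real (card I)"
  define s where "s = r * (1 - 1 / m)"
  have m: "2 \<le> m" using I_ge_2 by (simp add: m_def)
  have s: "0 < s" "s \<le> r" using m r_pos by (auto simp: s_def field_simps)
  let ?B = "L2_ball I r" and ?S = "L2_ball I r - L2_ball I s"
  have sub: "L2_ball I s \<subseteq> ?B" using s by (auto simp: L2_ball_def)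
  have volS: "ball_vol I r / 2 \<le> measure (leb I) ?S"
  proof -
    \<comment> \<open>Shrinking the radius by \<open>1 - 1 / m\<close> in dimension \<open>m\<close>
      leaves at most \<open>exp (-1) \<le> 1 / 2\<close> of the volume, so the shell carries at
      least half of it.\<close>
    have "(1 - 1 / m) ^ card I \<le> exp (- (1 / m)) ^ card I"
      using m exp_ge_add_one_self[of "- (1 / m)"] by (intro power_mono) auto
    also have "\<dots> = exp (-1)" using m by (simp add: m_def flip: exp_of_nat_mult)
    also have "exp (-1) \<le> (1 / 2 :: real)" using exp_minus_le_half[of 1] by simp
    finally have "ball_vol I s \<le> ball_vol I r / 2"
      using mult_left_mono[of "(1 - 1 / m) ^ card I" "1/2" "ball_vol I r"] ball_vol_pos[OF r_pos, of I]
      by (simp add: ball_vol_def s_def power_mult_distrib mult_ac)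
    moreover have "measure (leb I) ?S = ball_vol I r - ball_vol I s"
      using sub finI emeasure_L2_ball[OF finI r_pos]
      by (subst measure_Diff) (auto simp: measure_L2_ball r_pos s)
    ultimately show ?thesis by simp
  qed
  have Fs: "Q / 4 \<le> F x" if "x \<in> ?S" for x
  proof -
    have "s < L2_set x I" using that by (auto simp: L2_ball_def)
    then have "cutprob h s \<le> F x" using s h_pos by (intro cutprob_mono) auto
    moreover have "h / s = z * (m / (m - 1))"
      using m r_pos by (simp add: h_eq s_def field_simps)
    ultimately show ?thesis using shell s by (simp add: cutprob_def m_def)
  qed
  have p1: "0 \<le> (1::real) / 4" "(1::real) / 4 \<le> 1 / 2" by auto
  have p2: "0 \<le> (1 + \<theta>) / 4" "(1 + \<theta>) / 4 \<le> 1 / 2" using th by auto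
  let ?G = "\<lambda>p x. (1 - p * F x) ^ N"
  have pt: "?G ((1 + \<theta>) / 4) x \<le> ?G (1 / 4) x - \<theta> / 32 * (exp (-2) * indicator ?S x)" if x: "x \<in> ?B" for x
  proof -
    define a where "a = 1 / 4 * F x"
    have a: "0 \<le> a" "a \<le> 1/2" and G: "exp (-2) \<le> ?G (1/4) x"
      using factor_bounds[OF p1 x] by (auto simp: a_def)
    have a': "(1 + \<theta>) * a \<le> 1/2" using factor_bounds(4)[OF p2 x] by (simp add: a_def field_simps)
    \<comment> \<open>The two sides differ by \<open>\<theta> * a\<^sup>2\<close>; the effect of the
      extra density is split off as a factor of its own.\<close>
    have "(1 - (1 + \<theta>) * a) \<le> (1 - a) * (1 - \<theta> * a)"
      using a th by (simp add: algebra_simps)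
    also have "\<dots> \<le> (1 - a) * exp (- (\<theta> * a))"
      using a exp_ge_add_one_self[of "- (\<theta> * a)"] by (intro mult_left_mono) auto
    finally have "(1 - (1 + \<theta>) * a) ^ N \<le> ((1 - a) * exp (- (\<theta> * a))) ^ N"
      using a' by (intro power_mono) auto
    then have 1: "?G ((1 + \<theta>) / 4) x \<le> ?G (1/4) x * exp (- (\<theta> * (N * a)))"
      by (simp add: a_def power_mult_distrib mult_ac flip: exp_of_nat_mult)
    show ?thesis
    proof (cases "x \<in> ?S")
      case True
      \<comment> \<open>The product of the density \<open>1 / 4\<close>, the lower bound
        \<open>Q / 4\<close> on the shell, and \<open>N * Q \<ge> 1\<close>.\<close>
      have "1 / 16 \<le> N * a" using Fs[OF True] NQ mult_left_mono[of "Q / 4" "F x" "real N"]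
        by (simp add: a_def)
      then have "\<theta> / 16 \<le> \<theta> * (N * a)" using th mult_left_mono[of "1/16" "N * a" \<theta>] by simp
      then have "exp (- (\<theta> * (N * a))) \<le> exp (- (\<theta> / 16))" by simp
      also have "\<dots> \<le> 1 - \<theta> / 16 / 2" using th by (intro exp_minus_le_half) auto
      finally have "?G (1/4) x * exp (- (\<theta> * (N * a))) \<le> ?G (1/4) x * (1 - \<theta> / 16 / 2)"
        using a by (intro mult_left_mono) (auto simp: a_def)
      moreover have "\<theta> / 32 * exp (-2) \<le> \<theta> / 32 * ?G (1/4) x"
        using G th by (intro mult_left_mono) auto
      ultimately show ?thesis using 1 True by (simp add: algebra_simps)
    next
      case False
      have "?G (1/4) x * exp (- (\<theta> * (N * a))) \<le> ?G (1/4) x * 1"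
        using a th by (intro mult_left_mono) (auto simp: a_def)
      then show ?thesis using 1 False by simp
    qed
  qed
  have intS: "integrable (leb I) (\<lambda>x. indicator ?B x * (\<theta> / 32 * (exp (-2) * indicator ?S x)))"
    by (rule integrable_ball[where c="\<theta> / 32 * exp (-2)"]) (use finI th in \<open>auto simp: indicator_def\<close>)
  have "W ((1 + \<theta>) / 4) \<le> (\<integral>x. indicator ?B x * ?G (1/4) x - indicator ?B x * (\<theta> / 32 * (exp (-2) * indicator ?S x)) \<partial>leb I)"
    unfolding W_def
  proof (rule integral_mono[OF integrable_factor[OF p2]])
    show "integrable (leb I) (\<lambda>x. indicator ?B x * ?G (1/4) x - indicator ?B x * (\<theta> / 32 * (exp (-2) * indicator ?S x)))"
      by (intro Bochner_Integration.integrable_diff integrable_factor[OF p1] intS)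
    show "indicator ?B x * ?G ((1 + \<theta>) / 4) x \<le>
        indicator ?B x * ?G (1/4) x - indicator ?B x * (\<theta> / 32 * (exp (-2) * indicator ?S x))" for x
      using pt[of x] by (cases "x \<in> ?B") auto
  qed
  also have "\<dots> = W (1/4) - (\<integral>x. indicator ?B x * (\<theta> / 32 * (exp (-2) * indicator ?S x)) \<partial>leb I)"
    unfolding W_def by (intro Bochner_Integration.integral_diff integrable_factor[OF p1] intS)
  also have "(\<integral>x. indicator ?B x * (\<theta> / 32 * (exp (-2) * indicator ?S x)) \<partial>leb I) =
      (\<integral>x. \<theta> / 32 * exp (-2) * indicator ?S x \<partial>leb I)"
    by (intro Bochner_Integration.integral_cong) (auto simp: indicator_def)
  also have "\<dots> = \<theta> / 32 * exp (-2) * measure (leb I) ?S"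
    using finI emeasure_L2_ball[OF finI r_pos]
    by (subst integral_mult_right_zero) (auto simp: Int_absorb2 sets.sets_into_space)
  finally have le: "W ((1 + \<theta>) / 4) \<le> W (1/4) - \<theta> / 32 * exp (-2) * measure (leb I) ?S" .
  \<comment> \<open>Here \<open>512 = 32 * 16\<close> arises: \<open>exp (-2) \<ge> 1 / 8\<close>,
    the shell has half of the volume of the ball, and \<open>W\<close> is at most that
    volume.\<close>
  have "\<theta> / 32 * (1 / 16) * W (1/4) \<le> \<theta> / 32 * exp (-2) * measure (leb I) ?S"
  proof -
    have "exp 1 \<le> (2.8 :: real)" using e_less_272 by simp
    then have "exp 1 * exp 1 \<le> (2.8 * 2.8 :: real)" by (intro mult_mono) auto
    then have "exp 2 \<le> (8 :: real)" by (simp flip: exp_add)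
    then have "1 / 8 \<le> exp (-2 :: real)" by (simp add: exp_minus field_simps)
    then have "(1 / 8) * (W (1/4) / 2) \<le> exp (-2) * measure (leb I) ?S"
      using volS W_le[OF p1] W_pos[OF p1] by (intro mult_mono) auto
    from mult_left_mono[OF this, of "\<theta> / 32"] show ?thesis using th by simp
  qed
  with le show ?thesis by (simp add: algebra_simps)
qed

text \<open>The threshold \<open>1 / 8\<close> is chosen so that an inner product below it gives
  \<open>x + y\<close> squared length at most
  \<open>(2 + 1 / 4) * r\<^sup>2 = (3 / 2 * r)\<^sup>2\<close>; the offset \<open>2 * h\<close> then
  amounts to \<open>4 / 3 * z\<close> deviations, a tail far smaller than \<open>Q\<close>.\<close>

lemma cutboth_bound:
  assumes "x \<in> L2_ball I r" "y \<in> L2_ball I r"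
  shows "cutboth h A I x y \<le> (if 1 / 8 * r\<^sup>2 < (\<Sum>k\<in>I. x k * y k) then Q else gtail (4 / 3 * z))"
proof (cases "1 / 8 * r\<^sup>2 < (\<Sum>k\<in>I. x k * y k)")
  case True
  then show ?thesis using cutboth_le(1)[OF A IA, of h x y] h_pos F_le_Q[of x] assms
    by (auto simp: L2_ball_def)
next
  case False
  have sq: "(\<Sum>k\<in>I. (w k)\<^sup>2) \<le> r\<^sup>2" if "w \<in> L2_ball I r" for w
    using that by (simp add: L2_ball_def L2_set_def sqrt_le_D)
  have "(\<Sum>k\<in>I. (x k + y k)\<^sup>2) = (\<Sum>k\<in>I. (x k)\<^sup>2) + (\<Sum>k\<in>I. (y k)\<^sup>2) + 2 * (\<Sum>k\<in>I. x k * y k)"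
    by (simp add: power2_sum sum.distrib sum_distrib_left mult.assoc)
  also have "\<dots> \<le> r\<^sup>2 + r\<^sup>2 + 2 * (1 / 8 * r\<^sup>2)"
    using False sq[OF assms(1)] sq[OF assms(2)] by (intro add_mono mult_left_mono) auto
  also have "\<dots> = (3 / 2 * r)\<^sup>2" by (simp add: power2_eq_square)
  finally have "L2_set (\<lambda>k. x k + y k) I \<le> 3 / 2 * r"
    unfolding L2_set_def using r_pos by (intro real_le_lsqrt) (auto intro: sum_nonneg)
  then have "cutprob (2 * h) (L2_set (\<lambda>k. x k + y k) I) \<le> cutprob (2 * h) (3 / 2 * r)"
    using h_pos by (intro cutprob_mono) auto
  also have "\<dots> = gtail (4 / 3 * z)" using r_pos by (simp add: cutprob_def h_eq)
  finally show ?thesis using False cutboth_le(2)[OF A IA, of h x y] h_pos by auto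
qed

lemma gtail_43: "gtail (4 / 3 * z) \<le> Q"
  unfolding Q_eq using z_pos by (intro gtail_antimono) auto

text \<open>If being cut off were independent for \<open>x\<close> and \<open>y\<close>, joint
  survival would have the product as its probability. The excess per halfspace comes from normals
  cutting off both points; over \<open>N\<close> halfspaces it is a factor
  \<open>exp (4 * N * (p * g))\<close>, linearised by means of \<open>N * Q \<le> 2\<close>.\<close>

lemma pair_factor_le:
  assumes p: "0 \<le> p" "p \<le> 1/2" and x: "x \<in> L2_ball I r" and y: "y \<in> L2_ball I r"
  shows "(1 - p * cuteither h A I x y) ^ N \<le> (1 - p * F x) ^ N * (1 - p * F y) ^ N +
    2 * exp 4 * N * (if 1 / 8 * r\<^sup>2 < (\<Sum>k\<in>I. x k * y k) then Q else gtail (4 / 3 * z))"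
proof -
  define g where "g = (if 1 / 8 * r\<^sup>2 < (\<Sum>k\<in>I. x k * y k) then Q else gtail (4 / 3 * z))"
  have g: "0 \<le> g" "g \<le> Q" using Q_nonneg gtail_43 gtail_nonneg by (auto simp: g_def)
  define a where "a = p * F x"
  define b where "b = p * F y"
  have ab: "0 \<le> a" "a \<le> 1/2" "0 \<le> b" "b \<le> 1/2"
    and Gx: "(1 - a) ^ N \<le> 1" and Gy: "(1 - b) ^ N \<le> 1"
    using factor_bounds[OF p x] factor_bounds[OF p y] by (auto simp: a_def b_def)
  have "F x + F y - g \<le> cuteither h A I x y"
    using cutboth_bound[OF x y] cuteither_eq[OF A IA, of h x y] h_pos by (auto simp: g_def)
  from mult_left_mono[OF this p(1)]
  have "1 - p * cuteither h A I x y \<le> 1 - a - b + p * g"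
    by (simp add: a_def b_def algebra_simps)
  \<comment> \<open>The constant \<open>1/2 * 1/2\<close> is a lower bound for
    \<open>(1 - a) * (1 - b)\<close>; it makes the correction multiplicative, so that the
    \<open>N\<close>-th power can be taken.\<close>
  also have "\<dots> \<le> (1 - a) * (1 - b) + 1/2 * 1/2 * (4 * (p * g))"
    using ab by (simp add: algebra_simps)
  also have "\<dots> \<le> (1 - a) * (1 - b) + (1 - a) * (1 - b) * (4 * (p * g))"
    using ab p g mult_mono[of "1/2" "1 - a" "1/2" "1 - b"]
    by (intro add_left_mono mult_right_mono) auto
  also have "\<dots> = (1 - a) * (1 - b) * (1 + 4 * (p * g))" by (simp add: algebra_simps)
  also have "\<dots> \<le> (1 - a) * (1 - b) * exp (4 * (p * g))"
    using ab by (intro mult_left_mono) auto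
  finally have *: "1 - p * cuteither h A I x y \<le> (1 - a) * (1 - b) * exp (4 * (p * g))" .
  have "p * cuteither h A I x y \<le> 1 * 1"
    using p cuteither_bounds by (intro mult_mono) auto
  then have "(1 - p * cuteither h A I x y) ^ N \<le> ((1 - a) * (1 - b) * exp (4 * (p * g))) ^ N"
    using * by (intro power_mono) auto
  also have "\<dots> = (1 - a) ^ N * (1 - b) ^ N * exp (4 * N * (p * g))"
    by (simp add: power_mult_distrib mult_ac flip: exp_of_nat_mult)
  also have "\<dots> \<le> (1 - a) ^ N * (1 - b) ^ N * (1 + 2 * exp 4 * N * g)"
  proof (intro mult_left_mono)
    have pg: "p * g \<le> 1/2 * g" using p g by (intro mult_right_mono) auto
    have "real N * g \<le> real N * Q" using g by (intro mult_left_mono) auto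
    then have "2 * (N * g) \<le> 4" using NQ by linarith
    then have le: "2 * N * g \<le> 4" by (simp only: mult.assoc)
    have "4 * N * (p * g) \<le> 4 * N * (1/2 * g)" using pg by (intro mult_left_mono) auto
    then have "exp (4 * N * (p * g)) \<le> exp (2 * N * g)" by simp
    also have "\<dots> \<le> 1 + 2 * N * g * exp 4" using g le by (intro exp_le_linear) auto
    finally show "exp (4 * N * (p * g)) \<le> 1 + 2 * exp 4 * N * g" by (simp add: mult_ac)
  qed (use ab in auto)
  also have "\<dots> \<le> (1 - a) ^ N * (1 - b) ^ N + 1 * (2 * exp 4 * N * g)"
  proof -
    have "(1 - a) ^ N * (1 - b) ^ N \<le> 1 * 1" using Gx Gy ab by (intro mult_mono) auto
    then have "(1 - a) ^ N * (1 - b) ^ N * (2 * exp 4 * N * g) \<le> 1 * (2 * exp 4 * N * g)"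
      using g by (intro mult_right_mono) auto
    then show ?thesis by (simp add: distrib_left)
  qed
  finally show ?thesis by (simp add: a_def b_def g_def)
qed

text \<open>The second moment of the volume of the block: \<open>x\<close> and \<open>y\<close> both
  survive one halfspace with probability \<open>1 - p * cuteither h A I x y\<close>.\<close>

definition pairW :: "real \<Rightarrow> ennreal" where
  "pairW p = (\<integral>\<^sup>+y. \<integral>\<^sup>+x. ennreal (indicator (L2_ball I r) x * indicator (L2_ball I r) y *
     (1 - p * cuteither h A I x y) ^ N) \<partial>leb I \<partial>leb I)"

text \<open>A bound for the relative variance of the block volume. The first summand comes from
  pairs below the threshold of \<open>cutboth_bound\<close>, with
  \<open>7 / 18 = ((4 / 3)\<^sup>2 - 1) / 2\<close> from \<open>gtail_scale_le\<close>; the second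
  from the cap above it, with \<open>63 / 64 = 1 - (1 / 8)\<^sup>2\<close>. In \<open>exp 8\<close>,
  one \<open>exp 4\<close> stems from \<open>pair_factor_le\<close> and one from replacing the
  squared ball volume by \<open>(W p)\<^sup>2\<close>.\<close>

definition err :: real where
  "err = 4 * exp 8 * (4 / 3 * exp (- (7 / 18 * z\<^sup>2)) + sqrt (63 / 64) ^ card I)"

text \<open>For fixed \<open>y\<close> the points \<open>x\<close> are split into the cap of large
  inner product, whose volume is tiny, and the rest, where a common cut is improbable.\<close>

lemma pairW_le:
  assumes p: "0 \<le> p" "p \<le> 1/2"
  shows "pairW p \<le> ennreal ((1 + err) * (W p)\<^sup>2)"
proof -
  let ?B = "L2_ball I r" and ?V = "ball_vol I r"
  define c where "c = 2 * exp 4 * real N"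
  have c: "0 \<le> c" by (simp add: c_def)
  define d where "d = c * (gtail (4 / 3 * z) * ?V + Q * (?V * sqrt (63 / 64) ^ card I))"
  have V: "0 < ?V" by (rule ball_vol_pos[OF r_pos])
  have d: "0 \<le> d" using c V Q_nonneg gtail_nonneg by (auto simp: d_def)
  have inner: "(\<integral>\<^sup>+x. ennreal (indicator ?B x * indicator ?B y * (1 - p * cuteither h A I x y) ^ N) \<partial>leb I)
      \<le> ennreal (indicator ?B y * (1 - p * F y) ^ N * W p + d * indicator ?B y)" for y
  proof (cases "y \<in> ?B")
    case True
    let ?C = "{x \<in> ?B. 1 / 8 * r\<^sup>2 < (\<Sum>k\<in>I. x k * y k)}"
    have C: "?C \<in> sets (leb I)"
    proof -
      have "?C = ?B \<inter> {x \<in> space (leb I). 1 / 8 * r\<^sup>2 < (\<Sum>k\<in>I. x k * y k)}"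
        by (auto simp: L2_ball_def space_PiM)
      also have "\<dots> \<in> sets (leb I)"
        using finI by (intro sets.Int) (auto intro!: borel_measurable_less borel_measurable_sum)
      finally show ?thesis .
    qed
    have "emeasure (leb I) ?C \<le> ennreal (?V * sqrt (1 - (1 / 8)\<^sup>2) ^ card I)"
      using True by (intro emeasure_cap_le finI r_pos) (auto simp: L2_ball_def)
    then have emC: "emeasure (leb I) ?C \<le> ennreal (?V * sqrt (63 / 64) ^ card I)"
      by (simp add: power2_eq_square)
    let ?g = "gtail (4 / 3 * z)"
    have Gy: "0 \<le> (1 - p * F y) ^ N" using factor_bounds(1)[OF p True] by (smt (verit) exp_gt_zero)
    have "(\<integral>\<^sup>+x. ennreal (indicator ?B x * indicator ?B y * (1 - p * cuteither h A I x y) ^ N) \<partial>leb I)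
      \<le> (\<integral>\<^sup>+x. ennreal ((1 - p * F y) ^ N) * ennreal (indicator ?B x * (1 - p * F x) ^ N) +
          (ennreal (c * ?g) * indicator ?B x + ennreal (c * Q) * indicator ?C x) \<partial>leb I)"
    proof (rule nn_integral_mono)
      fix x
      show "ennreal (indicator ?B x * indicator ?B y * (1 - p * cuteither h A I x y) ^ N)
        \<le> ennreal ((1 - p * F y) ^ N) * ennreal (indicator ?B x * (1 - p * F x) ^ N) +
          (ennreal (c * ?g) * indicator ?B x + ennreal (c * Q) * indicator ?C x)"
      proof (cases "x \<in> ?B")
        case x: True
        have Gx: "0 \<le> (1 - p * F x) ^ N" using factor_bounds(1)[OF p x] by (smt (verit) exp_gt_zero)
        have "(1 - p * cuteither h A I x y) ^ N \<le>
          (1 - p * F y) ^ N * (1 - p * F x) ^ N + (c * ?g + c * Q * indicator ?C x)"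
          using pair_factor_le[OF p x True] mult_nonneg_nonneg[OF c gtail_nonneg[of "4/3*z"]] x
          by (auto simp: c_def mult_ac indicator_def split: if_splits)
        then have "ennreal ((1 - p * cuteither h A I x y) ^ N) \<le>
          ennreal ((1 - p * F y) ^ N * (1 - p * F x) ^ N + (c * ?g + c * Q * indicator ?C x))"
          by (rule ennreal_leI)
        also have "\<dots> = ennreal ((1 - p * F y) ^ N) * ennreal ((1 - p * F x) ^ N) +
          (ennreal (c * ?g) + ennreal (c * Q * indicator ?C x))"
          using Gx Gy c gtail_nonneg[of "4/3*z"] Q_nonneg by (simp add: ennreal_plus ennreal_mult)
        also have "ennreal (c * Q * indicator ?C x) = ennreal (c * Q) * indicator ?C x"
          by (auto simp: indicator_def)
        finally show ?thesis using x True by simp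
      qed simp
    qed
    also have "\<dots> = ennreal ((1 - p * F y) ^ N) * ennreal (W p) +
        (ennreal (c * ?g) * emeasure (leb I) ?B + ennreal (c * Q) * emeasure (leb I) ?C)"
      using C finI by (simp add: nn_integral_add nn_integral_cmult nn_W[OF p])
    also have "\<dots> \<le> ennreal ((1 - p * F y) ^ N) * ennreal (W p) +
        (ennreal (c * ?g) * ennreal ?V + ennreal (c * Q) * ennreal (?V * sqrt (63 / 64) ^ card I))"
      using emC by (intro add_mono mult_left_mono) (auto simp: emeasure_L2_ball[OF finI r_pos])
    also have "\<dots> = ennreal ((1 - p * F y) ^ N * W p + d)"
      using Gy W_pos[OF p] V c Q_nonneg gtail_nonneg[of "4/3*z"]
      by (simp add: d_def algebra_simps flip: ennreal_mult ennreal_plus)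
    finally show ?thesis using True by simp
  qed simp
  have "pairW p \<le> (\<integral>\<^sup>+y. ennreal (indicator ?B y * (1 - p * F y) ^ N * W p + d * indicator ?B y) \<partial>leb I)"
    unfolding pairW_def by (intro nn_integral_mono inner)
  also have "\<dots> = (\<integral>\<^sup>+y. ennreal (W p) * ennreal (indicator ?B y * (1 - p * F y) ^ N) + ennreal d * indicator ?B y \<partial>leb I)"
  proof (rule nn_integral_cong)
    fix y
    show "ennreal (indicator ?B y * (1 - p * F y) ^ N * W p + d * indicator ?B y) =
      ennreal (W p) * ennreal (indicator ?B y * (1 - p * F y) ^ N) + ennreal d * indicator ?B y"
    proof (cases "y \<in> ?B")
      case True
      then have "0 \<le> (1 - p * F y) ^ N" using factor_bounds(1)[OF p True] by (smt (verit) exp_gt_zero)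
      then show ?thesis using True W_pos[OF p] d by (simp add: ennreal_plus ennreal_mult mult.commute)
    qed simp
  qed
  also have "\<dots> = ennreal (W p) * ennreal (W p) + ennreal d * ennreal ?V"
    using finI by (simp add: nn_integral_add nn_integral_cmult nn_W[OF p] emeasure_L2_ball[OF finI r_pos])
  also have "\<dots> = ennreal ((W p)\<^sup>2 + d * ?V)"
    using W_pos[OF p] d V by (simp add: power2_eq_square flip: ennreal_mult ennreal_plus)
  also have "d * ?V \<le> err * (W p)\<^sup>2"
  proof -
    let ?e = "4 / 3 * exp (- (7 / 18 * z\<^sup>2)) + sqrt (63 / 64) ^ card I"
    have "gtail (4 / 3 * z) \<le> 4 / 3 * exp (- (((4 / 3)\<^sup>2 - 1) * z\<^sup>2 / 2)) * Q"
      unfolding Q_eq using z_pos by (intro gtail_scale_le) auto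
    also have "((4 / 3)\<^sup>2 - 1) * z\<^sup>2 / 2 = 7 / 18 * z\<^sup>2" by (simp add: power2_eq_square)
    finally have "d * ?V \<le> c * ((4 / 3 * exp (- (7 / 18 * z\<^sup>2)) * Q) * ?V + Q * (?V * sqrt (63 / 64) ^ card I)) * ?V"
      unfolding d_def using V c by (intro mult_left_mono mult_right_mono add_right_mono) auto
    also have "\<dots> = 2 * exp 4 * (N * Q) * ?e * ?V\<^sup>2"
      by (simp add: c_def power2_eq_square algebra_simps)
    also have "\<dots> \<le> 2 * exp 4 * 2 * ?e * ?V\<^sup>2"
      using NQ by (intro mult_left_mono mult_right_mono) (auto intro!: add_nonneg_nonneg)
    also have "\<dots> \<le> 2 * exp 4 * 2 * ?e * (exp 2 * W p)\<^sup>2"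
    proof (intro mult_left_mono power_mono)
      have "exp 2 * (exp (-2) * ?V) \<le> exp 2 * W p" using W_ge[OF p] by (intro mult_left_mono) auto
      then show "?V \<le> exp 2 * W p" by (simp flip: exp_add mult.assoc)
    qed (use V in \<open>auto intro!: add_nonneg_nonneg\<close>)
    also have "\<dots> = 4 * (exp 4 * (exp 2)\<^sup>2) * ?e * (W p)\<^sup>2"
      by (simp add: power_mult_distrib mult_ac)
    also have "exp 4 * (exp 2)\<^sup>2 = (exp 8 :: real)"
      by (simp add: power2_eq_square flip: exp_add)
    finally show ?thesis by (simp add: err_def)
  qed
  finally show ?thesis
    using W_pos[OF p] by (simp add: algebra_simps ennreal_leI)
qed

end

subsection \<open>Products of blocks\<close>

text \<open>Fubini for disjoint blocks of coordinates, splitting off one block per induction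
  step.\<close>

lemma nn_integral_leb_blocks:
  assumes "finite S" "\<And>b. b \<in> S \<Longrightarrow> finite (I b)" "disjoint_family_on I S"
    and "\<And>b. b \<in> S \<Longrightarrow> g b \<in> borel_measurable (leb (I b))"
  shows "(\<integral>\<^sup>+x. (\<Prod>b\<in>S. g b (restrict x (I b))) \<partial>leb (\<Union>b\<in>S. I b)) = (\<Prod>b\<in>S. \<integral>\<^sup>+x. g b x \<partial>leb (I b))"
  using assms
proof (induction S rule: finite_induct)
  case empty
  then show ?case using leb.nn_integral_empty[of "\<lambda>_. 1"] by simp
next
  case (insert c S)
  let ?U = "\<Union>b\<in>S. I b"
  have fin: "finite (I c)" "finite ?U" using insert by auto
  have disj: "I c \<inter> ?U = {}"
    using insert by (auto simp: disjoint_family_on_def)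
  have disjS: "disjoint_family_on I S" using insert by (auto simp: disjoint_family_on_def)
  have gm: "g c \<in> borel_measurable (leb (I c))" using insert by auto
  have m: "(\<lambda>x. g b (restrict x (I b))) \<in> borel_measurable (leb A)" if "b \<in> insert c S" "I b \<subseteq> A" for b A
    using measurable_compose[OF measurable_restrict_subset[OF that(2), where M="\<lambda>_. lborel"], of "g b" borel]
      insert.prems that by auto
  have meas: "(\<lambda>x. \<Prod>b\<in>insert c S. g b (restrict x (I b))) \<in> borel_measurable (leb (I c \<union> ?U))"
    by (intro borel_measurable_prod_ennreal m) auto
  have mS: "(\<lambda>x. \<Prod>b\<in>S. g b (restrict x (I b))) \<in> borel_measurable (leb ?U)"
    by (intro borel_measurable_prod_ennreal m) auto
  have "(\<integral>\<^sup>+x. (\<Prod>b\<in>insert c S. g b (restrict x (I b))) \<partial>leb (\<Union>b\<in>insert c S. I b)) =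
      (\<integral>\<^sup>+x. \<integral>\<^sup>+y. (\<Prod>b\<in>insert c S. g b (restrict (merge (I c) ?U (x, y)) (I b))) \<partial>leb ?U \<partial>leb (I c))"
    using leb.product_nn_integral_fold[OF disj fin meas] by simp
  also have "\<dots> = (\<integral>\<^sup>+x. \<integral>\<^sup>+y. g c x * (\<Prod>b\<in>S. g b (restrict y (I b))) \<partial>leb ?U \<partial>leb (I c))"
  proof (intro nn_integral_cong)
    fix x y assume x: "x \<in> space (leb (I c))"
    have 1: "restrict (merge (I c) ?U (x, y)) (I c) = x"
      using x by (auto simp: merge_def space_PiM PiE_iff extensional_def restrict_def)
    have 2: "restrict (merge (I c) ?U (x, y)) (I b) = restrict y (I b)" if "b \<in> S" for b
      using disj that by (auto simp: merge_def restrict_def fun_eq_iff)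
    show "(\<Prod>b\<in>insert c S. g b (restrict (merge (I c) ?U (x, y)) (I b))) =
        g c x * (\<Prod>b\<in>S. g b (restrict y (I b)))"
      using insert.hyps by (simp add: 1 2)
  qed
  also have "\<dots> = (\<integral>\<^sup>+x. g c x \<partial>leb (I c)) * (\<integral>\<^sup>+y. (\<Prod>b\<in>S. g b (restrict y (I b))) \<partial>leb ?U)"
    using gm mS by (simp add: nn_integral_cmult nn_integral_multc)
  also have "(\<integral>\<^sup>+y. (\<Prod>b\<in>S. g b (restrict y (I b))) \<partial>leb ?U) = (\<Prod>b\<in>S. \<integral>\<^sup>+x. g b x \<partial>leb (I b))"
    using insert disjS by (intro insert.IH) auto
  finally show ?case using insert.hyps by simp
qed

text \<open>The cutting condition is measurable jointly in both points and the normal, and the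
  sections of such a set have measurable probability.\<close>

lemma cuteither_measurable:
  fixes A :: "nat set"
  assumes A: "finite A" "I \<subseteq> A"
  shows "(\<lambda>w. cuteither h A I (fst w) (snd w)) \<in> borel_measurable (leb I \<Otimes>\<^sub>M leb I)"
proof -
  let ?G = "PiM A (\<lambda>_. gauss)" and ?L = "leb I \<Otimes>\<^sub>M leb I"
  interpret P: prob_space ?G by (rule prob_space_PiM) (rule prob_space_gauss)
  have v: "(\<lambda>v. v k) \<in> borel_measurable ?G" if "k \<in> I" for k
    using measurable_component_singleton[of k A "\<lambda>_. gauss"] A that by auto
  have v': "(\<lambda>q. snd q k) \<in> borel_measurable (?L \<Otimes>\<^sub>M ?G)" if "k \<in> I" for k
    by (rule measurable_compose[OF measurable_snd v[OF that]])
  have x': "(\<lambda>q. fst (fst q) k) \<in> borel_measurable (?L \<Otimes>\<^sub>M ?G)" if "k \<in> I" for k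
    using measurable_compose[OF measurable_compose[OF measurable_fst measurable_fst] coordinate_measurable[OF that]] .
  have y': "(\<lambda>q. snd (fst q) k) \<in> borel_measurable (?L \<Otimes>\<^sub>M ?G)" if "k \<in> I" for k
    using measurable_compose[OF measurable_compose[OF measurable_fst measurable_snd] coordinate_measurable[OF that]] .
  have 1[measurable]: "(\<lambda>q. \<Sum>k\<in>I. snd q k * fst (fst q) k) \<in> borel_measurable (?L \<Otimes>\<^sub>M ?G)"
    by (intro borel_measurable_sum borel_measurable_times v' x')
  have 2[measurable]: "(\<lambda>q. \<Sum>k\<in>I. snd q k * snd (fst q) k) \<in> borel_measurable (?L \<Otimes>\<^sub>M ?G)"
    by (intro borel_measurable_sum borel_measurable_times v' y')
  define S where "S = {q \<in> space (?L \<Otimes>\<^sub>M ?G).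
    h < (\<Sum>k\<in>I. snd q k * fst (fst q) k) \<or> h < (\<Sum>k\<in>I. snd q k * snd (fst q) k)}"
  have "S \<in> sets (?L \<Otimes>\<^sub>M ?G)" unfolding S_def by measurable
  then have "(\<lambda>w. measure ?G (Pair w -` S)) \<in> borel_measurable ?L"
    
    unfolding measure_def by (intro borel_measurable_enn2real P.finite_measure_cut_measurable)
  moreover have "cuteither h A I (fst w) (snd w) = measure ?G (Pair w -` S)" if "w \<in> space ?L" for w
    using that unfolding cuteither_def S_def
    by (intro arg_cong[where f="measure ?G"]) (auto simp: space_pair_measure)
  ultimately show ?thesis by (subst measurable_cong)
qed

lemma ennreal_bern:
  assumes "0 \<le> p" "p \<le> 1" "\<And>T. T \<subseteq> J \<Longrightarrow> 0 \<le> F T"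
  shows "ennreal (bern p J F) = (\<Sum>T\<in>Pow J. ennreal (p ^ card T * (1 - p) ^ card (J - T)) * ennreal (F T))"
  unfolding bern_def using assms
  by (subst sum_ennreal[symmetric]) (auto intro!: sum.cong mult_nonneg_nonneg simp: ennreal_mult)

lemma bern_nn_integral:
  assumes p: "0 \<le> p" "p \<le> 1" and J: "finite J"
    and g: "\<And>T. T \<subseteq> J \<Longrightarrow> g T \<in> borel_measurable M" "\<And>T x. T \<subseteq> J \<Longrightarrow> 0 \<le> g T x"
    and F: "\<And>T. T \<subseteq> J \<Longrightarrow> 0 \<le> F T" "\<And>T. T \<subseteq> J \<Longrightarrow> ennreal (F T) = (\<integral>\<^sup>+x. ennreal (g T x) \<partial>M)"
  shows "ennreal (bern p J F) = (\<integral>\<^sup>+x. ennreal (bern p J (\<lambda>T. g T x)) \<partial>M)"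
proof -
  have m: "(\<lambda>x. ennreal (p ^ card T * (1 - p) ^ card (J - T)) * ennreal (g T x)) \<in> borel_measurable M"
    if "T \<in> Pow J" for T using g(1)[of T] that by simp
  have "ennreal (bern p J F) = (\<Sum>T\<in>Pow J. (\<integral>\<^sup>+x. ennreal (p ^ card T * (1 - p) ^ card (J - T)) * ennreal (g T x) \<partial>M))"
    using g by (simp add: ennreal_bern[OF p] F nn_integral_cmult)
  also have "\<dots> = (\<integral>\<^sup>+x. (\<Sum>T\<in>Pow J. ennreal (p ^ card T * (1 - p) ^ card (J - T)) * ennreal (g T x)) \<partial>M)"
    using m by (intro nn_integral_sum[symmetric]) auto
  finally show ?thesis using g by (simp add: ennreal_bern[OF p])
qed

subsection \<open>Random polytopes\<close>

locale polytope =
  fixes n Bl N :: nat and I :: "nat \<Rightarrow> nat set" and r z h Q :: real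
  assumes Union_I: "(\<Union>b<Bl. I b) = {..<n}" and disjoint_I: "disjoint_family_on I {..<Bl}"
    and block: "\<And>b. b < Bl \<Longrightarrow> block (I b) {..<n} r z h Q N"
begin

definition J :: "(nat \<times> nat) set" where "J = {..<Bl} \<times> {..<N}"

definition base :: "point set" where
  "base = {x \<in> {..<n} \<rightarrow>\<^sub>E UNIV. \<forall>b<Bl. L2_set x (I b) \<le> r}"

text \<open>The index \<open>j = (b, i)\<close> stands for halfspace \<open>i\<close> of block
  \<open>b\<close>. Only the coordinates in \<open>I b\<close> of its normal are used, so the cut
  body remains a product over the blocks.\<close>

definition viol :: "(nat \<times> nat \<Rightarrow> point) \<Rightarrow> point \<Rightarrow> (nat \<times> nat) set" where
  "viol u x = {j \<in> J. h < (\<Sum>k\<in>I (fst j). u j k * x k)}"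

abbreviation body :: "(nat \<times> nat \<Rightarrow> point) \<Rightarrow> (nat \<times> nat) set \<Rightarrow> point set" where
  "body u \<equiv> cut_body base (viol u)"

abbreviation G :: "point measure" where "G \<equiv> PiM {..<n} (\<lambda>_. gauss)"

definition U :: "(nat \<times> nat \<Rightarrow> point) measure" where "U = PiM J (\<lambda>_. G)"

text \<open>By \<open>expect_vol\<close> this is the mean volume of the body over directions and
  coins.\<close>

definition Wt :: "real \<Rightarrow> real" where "Wt p = (\<Prod>b<Bl. block.W (I b) r h N p)"

lemma finite_J: "finite J" by (simp add: J_def)

lemma I_sub: "b < Bl \<Longrightarrow> I b \<subseteq> {..<n}" using Union_I by auto

lemma finite_I: "b < Bl \<Longrightarrow> finite (I b)" using I_sub finite_subset by blast

lemma prob_space_G: "prob_space G" by (rule prob_space_PiM) (rule prob_space_gauss)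

lemma prob_space_U: "prob_space U" unfolding U_def by (rule prob_space_PiM) (rule prob_space_G)

lemma base_measurable [measurable]: "base \<in> sets (leb {..<n})"
proof -
  have "base = {x \<in> space (leb {..<n}). \<forall>b\<in>{..<Bl}. L2_set x (I b) \<le> r}"
    by (auto simp: base_def space_PiM)
  also have "\<dots> \<in> sets (leb {..<n})"
    using L2_set_measurable finite_I I_sub by (intro sets.sets_Collect_finite_All) auto
  finally show ?thesis .
qed

lemma u_measurable:
  assumes "j \<in> J" "k < n"
  shows "(\<lambda>u. u j k) \<in> borel_measurable U"
proof -
  have "(\<lambda>u. u j) \<in> measurable U G"
    unfolding U_def using assms by (intro measurable_component_singleton)
  moreover have "(\<lambda>v. v k) \<in> measurable G gauss"
    using assms by (intro measurable_component_singleton) auto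
  then have "(\<lambda>v. v k) \<in> borel_measurable G" by simp
  ultimately show ?thesis by (rule measurable_compose)
qed

lemma sum_measurable:
  assumes "j \<in> J"
  shows "(\<lambda>q. \<Sum>k\<in>I (fst j). fst q j k * snd q k) \<in> borel_measurable (U \<Otimes>\<^sub>M leb {..<n})"
proof (intro borel_measurable_sum borel_measurable_times)
  fix k assume "k \<in> I (fst j)"
  then have k: "k \<in> {..<n}" using assms I_sub by (force simp: J_def)
  show "(\<lambda>q. fst q j k) \<in> borel_measurable (U \<Otimes>\<^sub>M leb {..<n})"
    by (rule measurable_compose[OF measurable_fst u_measurable]) (use assms k in auto)
  show "(\<lambda>q. snd q k) \<in> borel_measurable (U \<Otimes>\<^sub>M leb {..<n})"
    by (rule measurable_compose[OF measurable_snd coordinate_measurable[OF k]])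
qed

lemma viol_measurable:
  assumes "j \<in> J"
  shows "{q \<in> space (U \<Otimes>\<^sub>M leb {..<n}). j \<in> viol (fst q) (snd q)} \<in> sets (U \<Otimes>\<^sub>M leb {..<n})"
  using sum_measurable[OF assms] assms unfolding viol_def by simp

lemma viol_measurable_x:
  assumes "j \<in> J" "u \<in> space U"
  shows "{x \<in> space (leb {..<n}). j \<in> viol u x} \<in> sets (leb {..<n})"
proof -
  have "Pair u \<in> measurable (leb {..<n}) (U \<Otimes>\<^sub>M leb {..<n})" using assms by simp
  from measurable_compose[OF this sum_measurable[OF assms(1)]]
  show ?thesis using assms unfolding viol_def by simp
qed

lemma body_measurable:
  assumes u: "u \<in> space U" and T: "T \<subseteq> J"
  shows "body u T \<in> sets (leb {..<n})"
proof -
  have "body u T = base \<inter> {x \<in> space (leb {..<n}). \<forall>j\<in>T. j \<notin> viol u x}"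
    by (auto simp: cut_body_def base_def space_PiM)
  also have "\<dots> \<in> sets (leb {..<n})"
  proof (intro sets.Int base_measurable sets.sets_Collect_finite_All)
    fix j assume "j \<in> T"
    then have "{x \<in> space (leb {..<n}). j \<in> viol u x} \<in> sets (leb {..<n})"
      using T by (intro viol_measurable_x u) auto
    then show "{x \<in> space (leb {..<n}). j \<notin> viol u x} \<in> sets (leb {..<n})"
      by (rule sets.sets_Collect_neg)
  qed (use T finite_J finite_subset in auto)
  finally show ?thesis .
qed

lemma indicator_base:
  assumes "x \<in> space (leb {..<n})"
  shows "indicator base x = (\<Prod>b<Bl. indicator (L2_ball (I b) r) (restrict x (I b)) :: real)"
proof (cases "x \<in> base")
  case True
  then have "restrict x (I b) \<in> L2_ball (I b) r" if "b < Bl" for b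
    using that by (auto simp: base_def L2_ball_def L2_set_def)
  then show ?thesis using True by simp
next
  case False
  then obtain b where b: "b < Bl" "\<not> L2_set x (I b) \<le> r"
    using assms by (auto simp: base_def space_PiM)
  then have "restrict x (I b) \<notin> L2_ball (I b) r"
    by (auto simp: L2_ball_def L2_set_def)
  then have "(\<Prod>b<Bl. indicator (L2_ball (I b) r) (restrict x (I b)) :: real) = 0"
    using b by (intro prod_zero) (auto intro!: bexI[of _ b])
  then show ?thesis using False by simp
qed

lemma emeasure_base_finite: "emeasure (leb {..<n}) base < \<infinity>"
proof -
  have "emeasure (leb {..<n}) base = (\<integral>\<^sup>+x. ennreal (indicator base x) \<partial>leb {..<n})"
    by (simp add: ennreal_indicator)
  also have "\<dots> = (\<integral>\<^sup>+x. (\<Prod>b<Bl. ennreal (indicator (L2_ball (I b) r) (restrict x (I b)))) \<partial>leb {..<n})"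
    by (intro nn_integral_cong) (simp add: indicator_base prod_ennreal)
  also have "\<dots> = (\<Prod>b<Bl. \<integral>\<^sup>+x. ennreal (indicator (L2_ball (I b) r) x) \<partial>leb (I b))"
    unfolding Union_I[symmetric]
    by (rule nn_integral_leb_blocks) (use finite_I disjoint_I in auto)
  also have "\<dots> = (\<Prod>b<Bl. ennreal (ball_vol (I b) r))"
    using finite_I block.r_pos[OF block] by (intro prod.cong) (auto simp: ennreal_indicator emeasure_L2_ball)
  also have "\<dots> < \<infinity>" by (simp add: ennreal_prod_eq_top less_top[symmetric])
  finally show ?thesis .
qed

lemma emeasure_body:
  assumes "u \<in> space U" "T \<subseteq> J"
  shows "emeasure (leb {..<n}) (body u T) = ennreal (vol n (body u T))"
proof -
  have "emeasure (leb {..<n}) (body u T) \<le> emeasure (leb {..<n}) base"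
    by (intro emeasure_mono) (auto simp: cut_body_def)
  then have "emeasure (leb {..<n}) (body u T) \<noteq> \<infinity>" using emeasure_base_finite by auto
  then show ?thesis by (simp add: vol_def lebn_def emeasure_eq_ennreal_measure)
qed

lemma vol_nonneg: "0 \<le> vol n K" by (simp add: vol_def)

section \<open>Survival of points for fixed directions\<close>

lemma bern_indicator_body:
  assumes "x \<in> base"
  shows "bern p J (\<lambda>T. indicator (body u T) x) = (\<Prod>j\<in>J. 1 - p * of_bool (j \<in> viol u x))"
proof -
  have "bern p J (\<lambda>T. indicator (body u T) x) = bern p J (\<lambda>T. \<Prod>j\<in>T. of_bool (j \<notin> viol u x))"
  proof (rule bern_cong)
    fix T assume "T \<subseteq> J"
    then have "finite T" using finite_J finite_subset by auto
    then show "indicator (body u T) x = (\<Prod>j\<in>T. of_bool (j \<notin> viol u x) :: real)"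
      using assms by (induction T rule: finite_induct) (auto simp: cut_body_def indicator_def)
  qed
  also have "\<dots> = (\<Prod>j\<in>J. 1 - p * of_bool (j \<in> viol u x))"
    unfolding bern_prod[OF finite_J] by (intro prod.cong) auto
  finally show ?thesis .
qed

lemma bern_indicator_body2:
  assumes "x \<in> base" "y \<in> base"
  shows "bern p J (\<lambda>T. indicator (body u T) x * indicator (body u T) y) =
    (\<Prod>j\<in>J. 1 - p * of_bool (j \<in> viol u x \<or> j \<in> viol u y))"
proof -
  have "bern p J (\<lambda>T. indicator (body u T) x * indicator (body u T) y) =
      bern p J (\<lambda>T. \<Prod>j\<in>T. of_bool (\<not> (j \<in> viol u x \<or> j \<in> viol u y)))"
  proof (rule bern_cong)
    fix T assume "T \<subseteq> J"
    then have "finite T" using finite_J finite_subset by auto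
    then show "indicator (body u T) x * indicator (body u T) y =
        (\<Prod>j\<in>T. of_bool (\<not> (j \<in> viol u x \<or> j \<in> viol u y)) :: real)"
      using assms by (induction T rule: finite_induct) (auto simp: cut_body_def indicator_def)
  qed
  also have "\<dots> = (\<Prod>j\<in>J. 1 - p * of_bool (j \<in> viol u x \<or> j \<in> viol u y))"
    unfolding bern_prod[OF finite_J] by (intro prod.cong) auto
  finally show ?thesis .
qed

text \<open>With the directions \<open>u\<close> fixed, the probability over the coins that
  \<open>x\<close> lies in the body; \<open>survive2\<close> is the same for two points at
  once.\<close>

definition survive :: "real \<Rightarrow> (nat \<times> nat \<Rightarrow> point) \<Rightarrow> point \<Rightarrow> real" where
  "survive p u x = indicator base x * (\<Prod>j\<in>J. 1 - p * of_bool (j \<in> viol u x))"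

definition survive2 :: "real \<Rightarrow> (nat \<times> nat \<Rightarrow> point) \<Rightarrow> point \<Rightarrow> point \<Rightarrow> real" where
  "survive2 p u y x = indicator base x * indicator base y *
     (\<Prod>j\<in>J. 1 - p * of_bool (j \<in> viol u x \<or> j \<in> viol u y))"

lemma bern_vol:
  assumes p: "0 \<le> p" "p \<le> 1" and u: "u \<in> space U"
  shows "ennreal (bern p J (\<lambda>T. vol n (body u T))) = (\<integral>\<^sup>+x. ennreal (survive p u x) \<partial>leb {..<n})"
proof -
  have "ennreal (bern p J (\<lambda>T. vol n (body u T))) =
      (\<integral>\<^sup>+x. ennreal (bern p J (\<lambda>T. indicator (body u T) x)) \<partial>leb {..<n})"
    using body_measurable[OF u] emeasure_body[OF u]
    by (intro bern_nn_integral p finite_J) (auto simp: vol_nonneg ennreal_indicator)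
  moreover have "bern p J (\<lambda>T. indicator (body u T) x) = survive p u x" for x
  proof (cases "x \<in> base")
    case False
    then have "bern p J (\<lambda>T. indicator (body u T) x) = bern p J (\<lambda>T. 0)"
      by (intro bern_cong) (auto simp: cut_body_def)
    then show ?thesis using False by (simp add: survive_def bern_const finite_J)
  qed (simp add: survive_def bern_indicator_body)
  ultimately show ?thesis by simp
qed

lemma bern_vol2:
  assumes p: "0 \<le> p" "p \<le> 1" and u: "u \<in> space U"
  shows "ennreal (bern p J (\<lambda>T. (vol n (body u T))\<^sup>2)) =
    (\<integral>\<^sup>+y. \<integral>\<^sup>+x. ennreal (survive2 p u y x) \<partial>leb {..<n} \<partial>leb {..<n})"
proof -
  have "ennreal (bern p J (\<lambda>T. (vol n (body u T))\<^sup>2)) =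
      (\<integral>\<^sup>+y. ennreal (bern p J (\<lambda>T. vol n (body u T) * indicator (body u T) y)) \<partial>leb {..<n})"
  proof (intro bern_nn_integral p finite_J)
    fix T assume T: "T \<subseteq> J"
    note [measurable] = body_measurable[OF u T]
    show "(\<lambda>y. vol n (body u T) * indicator (body u T) y) \<in> borel_measurable (leb {..<n})" by measurable
    show "ennreal ((vol n (body u T))\<^sup>2) = (\<integral>\<^sup>+y. ennreal (vol n (body u T) * indicator (body u T) y) \<partial>leb {..<n})"
      using emeasure_body[OF u T]
      by (simp add: ennreal_mult vol_nonneg ennreal_indicator nn_integral_cmult power2_eq_square)
  qed (auto simp: vol_nonneg)
  also have "\<dots> = (\<integral>\<^sup>+y. \<integral>\<^sup>+x. ennreal (bern p J (\<lambda>T. indicator (body u T) x * indicator (body u T) y)) \<partial>leb {..<n} \<partial>leb {..<n})"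
  proof (intro nn_integral_cong bern_nn_integral p finite_J)
    fix T y assume T: "T \<subseteq> J"
    note [measurable] = body_measurable[OF u T]
    show "(\<lambda>x. indicator (body u T) x * indicator (body u T) y :: real) \<in> borel_measurable (leb {..<n})" by measurable
    show "ennreal (vol n (body u T) * indicator (body u T) y) =
      (\<integral>\<^sup>+x. ennreal (indicator (body u T) x * indicator (body u T) y) \<partial>leb {..<n})"
      using emeasure_body[OF u T]
      by (simp add: ennreal_mult vol_nonneg ennreal_indicator nn_integral_multc)
  qed (auto simp: vol_nonneg)
  finally have "ennreal (bern p J (\<lambda>T. (vol n (body u T))\<^sup>2)) = \<dots>" .
  moreover have "bern p J (\<lambda>T. indicator (body u T) x * indicator (body u T) y) = survive2 p u y x" for x y
  proof (cases "x \<in> base \<and> y \<in> base")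
    case False
    then have "bern p J (\<lambda>T. indicator (body u T) x * indicator (body u T) y) = bern p J (\<lambda>T. 0)"
      by (intro bern_cong) (auto simp: cut_body_def)
    then show ?thesis using False by (auto simp: survive2_def bern_const finite_J)
  qed (simp add: survive2_def bern_indicator_body2)
  ultimately show ?thesis by simp
qed

section \<open>Averaging over the directions\<close>

lemma sigma_finite_leb: "finite A \<Longrightarrow> sigma_finite_measure (leb A)"
  by (rule leb.sigma_finite)

lemma of_bool_measurable:
  "{x \<in> space M. P x} \<in> sets M \<Longrightarrow> (\<lambda>x. of_bool (P x) :: real) \<in> borel_measurable M"
  unfolding of_bool_def by (intro measurable_If) auto

text \<open>The normals are independent, so the mean of the product over halfspaces is the product
  of the means.\<close>

lemma nn_integral_U_prod:
  assumes p: "0 \<le> p" "p \<le> 1" and S: "\<And>j. j \<in> J \<Longrightarrow> S j \<in> sets G"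
  shows "(\<integral>\<^sup>+u. ennreal (\<Prod>j\<in>J. 1 - p * of_bool (u j \<in> S j)) \<partial>U) = ennreal (\<Prod>j\<in>J. 1 - p * measure G (S j))"
proof -
  interpret G: prob_space G by (rule prob_space_G)
  interpret G': product_prob_space "\<lambda>_::nat \<times> nat. G" J by unfold_locales
  have pos: "0 \<le> 1 - p * of_bool b" for b using p by (cases b) auto
  have m: "(\<lambda>v. of_bool (v \<in> S j) :: real) \<in> borel_measurable G" if "j \<in> J" for j
    using S[OF that] by (intro of_bool_measurable) (simp add: Collect_conj_eq Int_absorb1 sets.sets_into_space)
  have int: "integrable G (\<lambda>v. of_bool (v \<in> S j) :: real)" if "j \<in> J" for j
    using m[OF that] by (intro G.integrable_const_bound[where B=1]) auto
  have one: "(\<integral>\<^sup>+v. ennreal (1 - p * of_bool (v \<in> S j)) \<partial>G) = ennreal (1 - p * measure G (S j))" if "j \<in> J" for j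
  proof -
    have "(\<integral>v. of_bool (v \<in> S j) \<partial>G) = (\<integral>v. indicator (S j) v \<partial>G)"
      by (intro Bochner_Integration.integral_cong) (auto simp: indicator_def)
    also have "\<dots> = measure G (S j)"
      using S[OF that] by (simp add: Int_absorb2 sets.sets_into_space)
    finally have "(\<integral>v. 1 - p * of_bool (v \<in> S j) \<partial>G) = 1 - p * measure G (S j)"
      using int[OF that] by (simp add: G.prob_space)
    then show ?thesis
      using int[OF that] pos by (subst nn_integral_eq_integral) auto
  qed
  have "(\<integral>\<^sup>+u. ennreal (\<Prod>j\<in>J. 1 - p * of_bool (u j \<in> S j)) \<partial>U) =
      (\<integral>\<^sup>+u. (\<Prod>j\<in>J. ennreal (1 - p * of_bool (u j \<in> S j))) \<partial>U)"
    using pos by (simp add: prod_ennreal)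
  also have "\<dots> = (\<Prod>j\<in>J. \<integral>\<^sup>+v. ennreal (1 - p * of_bool (v \<in> S j)) \<partial>G)"
    unfolding U_def using m by (intro G'.product_nn_integral_prod finite_J) auto
  also have "\<dots> = (\<Prod>j\<in>J. ennreal (1 - p * measure G (S j)))"
    using one by (intro prod.cong) auto
  also have "\<dots> = ennreal (\<Prod>j\<in>J. 1 - p * measure G (S j))"
    using p G.prob_le_1 by (intro prod_ennreal) (auto intro: mult_le_one)
  finally show ?thesis .
qed

lemma prod_J: "(\<Prod>j\<in>J. c (fst j)) = (\<Prod>b<Bl. c b ^ N)" for c :: "nat \<Rightarrow> real"
  using prod.cartesian_product[of "\<lambda>b _. c b" "{..<N}" "{..<Bl}"] by (simp add: J_def case_prod_beta)

lemma h_nonneg: "0 < Bl \<Longrightarrow> 0 \<le> h" using block.h_pos[OF block, of 0] by simp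

lemma J_block: "j \<in> J \<Longrightarrow> fst j < Bl" by (auto simp: J_def)

lemma expect_survive:
  assumes p: "0 \<le> p" "p \<le> 1"
  shows "(\<integral>\<^sup>+u. ennreal (survive p u x) \<partial>U) =
    ennreal (indicator base x * (\<Prod>b<Bl. (1 - p * cutprob h (L2_set x (I b))) ^ N))"
proof -
  let ?S = "\<lambda>j. {v \<in> space G. h < (\<Sum>k\<in>I (fst j). v k * x k)}"
  have S: "?S j \<in> sets G" if "j \<in> J" for j
    using that I_sub J_block by (intro cut_sets) auto
  have "survive p u x = indicator base x * (\<Prod>j\<in>J. 1 - p * of_bool (u j \<in> ?S j))" if "u \<in> space U" for u
  proof -
    have "u j \<in> space G" if "j \<in> J" for j using \<open>u \<in> space U\<close> that by (auto simp: U_def space_PiM)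
    then show ?thesis unfolding survive_def viol_def by (auto intro!: prod.cong)
  qed
  then have "(\<integral>\<^sup>+u. ennreal (survive p u x) \<partial>U) =
      (\<integral>\<^sup>+u. ennreal (indicator base x * (\<Prod>j\<in>J. 1 - p * of_bool (u j \<in> ?S j))) \<partial>U)"
    by (intro nn_integral_cong) simp
  also have "\<dots> = ennreal (indicator base x * (\<Prod>j\<in>J. 1 - p * measure G (?S j)))"
    using nn_integral_U_prod[OF p S] by (cases "x \<in> base") auto
  also have "(\<Prod>j\<in>J. 1 - p * measure G (?S j)) = (\<Prod>j\<in>J. 1 - p * cutprob h (L2_set x (I (fst j))))"
    using I_sub J_block h_nonneg by (intro prod.cong refl) (subst measure_PiM_gauss_halfspace, force+)
  also have "\<dots> = (\<Prod>b<Bl. (1 - p * cutprob h (L2_set x (I b))) ^ N)"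
    by (rule prod_J[of "\<lambda>b. 1 - p * cutprob h (L2_set x (I b))"])
  finally show ?thesis .
qed

lemma expect_survive2:
  assumes p: "0 \<le> p" "p \<le> 1"
  shows "(\<integral>\<^sup>+u. ennreal (survive2 p u y x) \<partial>U) =
    ennreal (indicator base x * indicator base y * (\<Prod>b<Bl. (1 - p * cuteither h {..<n} (I b) x y) ^ N))"
proof -
  let ?S = "\<lambda>j. {v \<in> space G. h < (\<Sum>k\<in>I (fst j). v k * x k) \<or> h < (\<Sum>k\<in>I (fst j). v k * y k)}"
  have S: "?S j \<in> sets G" if "j \<in> J" for j
  proof -
    have "?S j = {v \<in> space G. h < (\<Sum>k\<in>I (fst j). v k * x k)} \<union> {v \<in> space G. h < (\<Sum>k\<in>I (fst j). v k * y k)}"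
      by auto
    also have "\<dots> \<in> sets G" using that I_sub J_block by (intro sets.Un cut_sets) auto
    finally show ?thesis .
  qed
  have "survive2 p u y x = indicator base x * indicator base y * (\<Prod>j\<in>J. 1 - p * of_bool (u j \<in> ?S j))" if "u \<in> space U" for u
  proof -
    have "u j \<in> space G" if "j \<in> J" for j using \<open>u \<in> space U\<close> that by (auto simp: U_def space_PiM)
    then show ?thesis unfolding survive2_def viol_def by (auto intro!: prod.cong)
  qed
  then have "(\<integral>\<^sup>+u. ennreal (survive2 p u y x) \<partial>U) =
      (\<integral>\<^sup>+u. ennreal (indicator base x * indicator base y * (\<Prod>j\<in>J. 1 - p * of_bool (u j \<in> ?S j))) \<partial>U)"
    by (intro nn_integral_cong) simp
  also have "\<dots> = ennreal (indicator base x * indicator base y * (\<Prod>j\<in>J. 1 - p * measure G (?S j)))"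
    using nn_integral_U_prod[OF p S] by (cases "x \<in> base \<and> y \<in> base") auto
  also have "(\<Prod>j\<in>J. 1 - p * measure G (?S j)) = (\<Prod>j\<in>J. 1 - p * cuteither h {..<n} (I (fst j)) x y)"
    by (simp add: cuteither_def)
  also have "\<dots> = (\<Prod>b<Bl. (1 - p * cuteither h {..<n} (I b) x y) ^ N)"
    by (rule prod_J[of "\<lambda>b. 1 - p * cuteither h {..<n} (I b) x y"])
  finally show ?thesis .
qed

lemma survive_measurable: "(\<lambda>q. ennreal (survive p (fst q) (snd q))) \<in> borel_measurable (U \<Otimes>\<^sub>M leb {..<n})"
proof -
  have [measurable]: "(\<lambda>q. of_bool (j \<in> viol (fst q) (snd q)) :: real) \<in> borel_measurable (U \<Otimes>\<^sub>M leb {..<n})"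
    if "j \<in> J" for j by (rule of_bool_measurable[OF viol_measurable[OF that]])
  show ?thesis unfolding survive_def by measurable
qed

lemma survive2_measurable:
  "(\<lambda>q. ennreal (survive2 p (fst (fst q)) (snd (fst q)) (snd q))) \<in> borel_measurable ((U \<Otimes>\<^sub>M leb {..<n}) \<Otimes>\<^sub>M leb {..<n})"
proof -
  let ?M = "(U \<Otimes>\<^sub>M leb {..<n}) \<Otimes>\<^sub>M leb {..<n}"
  have 1: "(\<lambda>q. (fst (fst q), snd q)) \<in> measurable ?M (U \<Otimes>\<^sub>M leb {..<n})" by measurable
  have [measurable]: "(\<lambda>q. of_bool (j \<in> viol (fst (fst q)) (snd q) \<or> j \<in> viol (fst (fst q)) (snd (fst q))) :: real)
      \<in> borel_measurable ?M" if j: "j \<in> J" for j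
  proof (rule of_bool_measurable)
    have "(\<lambda>q. (fst (fst q), snd q)) -` {q \<in> space (U \<Otimes>\<^sub>M leb {..<n}). j \<in> viol (fst q) (snd q)} \<inter> space ?M \<in> sets ?M"
      by (rule measurable_sets[OF 1 viol_measurable[OF j]])
    moreover have "fst -` {q \<in> space (U \<Otimes>\<^sub>M leb {..<n}). j \<in> viol (fst q) (snd q)} \<inter> space ?M \<in> sets ?M"
      by (rule measurable_sets[OF measurable_fst viol_measurable[OF j]])
    ultimately have "((\<lambda>q. (fst (fst q), snd q)) -` {q \<in> space (U \<Otimes>\<^sub>M leb {..<n}). j \<in> viol (fst q) (snd q)} \<inter> space ?M)
      \<union> (fst -` {q \<in> space (U \<Otimes>\<^sub>M leb {..<n}). j \<in> viol (fst q) (snd q)} \<inter> space ?M) \<in> sets ?M" by (rule sets.Un)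
    moreover have "((\<lambda>q. (fst (fst q), snd q)) -` {q \<in> space (U \<Otimes>\<^sub>M leb {..<n}). j \<in> viol (fst q) (snd q)} \<inter> space ?M)
      \<union> (fst -` {q \<in> space (U \<Otimes>\<^sub>M leb {..<n}). j \<in> viol (fst q) (snd q)} \<inter> space ?M) =
      {q \<in> space ?M. j \<in> viol (fst (fst q)) (snd q) \<or> j \<in> viol (fst (fst q)) (snd (fst q))}"
      by (auto simp: space_pair_measure)
    ultimately show "{q \<in> space ?M. j \<in> viol (fst (fst q)) (snd q) \<or> j \<in> viol (fst (fst q)) (snd (fst q))} \<in> sets ?M"
      by (simp only:)
  qed
  show ?thesis unfolding survive2_def by measurable
qed

lemma pair_sigma_finite_U: "pair_sigma_finite U (leb {..<n})"
  unfolding pair_sigma_finite_def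
  using prob_space_U sigma_finite_leb[of "{..<n}"]
  by (simp add: prob_space_imp_sigma_finite)

lemma nn_integral_blocks:
  assumes "\<And>b. b < Bl \<Longrightarrow> g b \<in> borel_measurable (leb (I b))"
  shows "(\<integral>\<^sup>+x. (\<Prod>b<Bl. g b (restrict x (I b))) \<partial>leb {..<n}) = (\<Prod>b<Bl. \<integral>\<^sup>+x. g b x \<partial>leb (I b))"
  using nn_integral_leb_blocks[of "{..<Bl}" I g] finite_I disjoint_I assms by (simp add: Union_I)

text \<open>After exchanging the integrals the point is fixed and the normals are averaged; the
  survival probability then depends only on the block norms and factors over the blocks.\<close>

lemma expect_vol:
  assumes p: "0 \<le> p" "p \<le> 1/2"
  shows "(\<integral>\<^sup>+u. ennreal (bern p J (\<lambda>T. vol n (body u T))) \<partial>U) = ennreal (Wt p)"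
proof -
  interpret pair_sigma_finite U "leb {..<n}" by (rule pair_sigma_finite_U)
  have p1: "p \<le> 1" using p by simp
  let ?g = "\<lambda>b x. ennreal (indicator (L2_ball (I b) r) x * (1 - p * cutprob h (L2_set x (I b))) ^ N)"
  have pos: "0 \<le> (1 - p * cutprob h s) ^ N" for s
    using p p1 cutprob_nonneg[of h s] cutprob_le_1[of h s] by (auto intro!: zero_le_power mult_le_one)
  have gm: "?g b \<in> borel_measurable (leb (I b))" if "b < Bl" for b
    using finite_I[OF that] block.F_measurable[OF block[OF that]] by measurable
  have "(\<integral>\<^sup>+u. ennreal (bern p J (\<lambda>T. vol n (body u T))) \<partial>U) =
      (\<integral>\<^sup>+u. \<integral>\<^sup>+x. ennreal (survive p u x) \<partial>leb {..<n} \<partial>U)"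
    by (intro nn_integral_cong bern_vol p p1)
  also have "\<dots> = (\<integral>\<^sup>+x. \<integral>\<^sup>+u. ennreal (survive p u x) \<partial>U \<partial>leb {..<n})"
    using survive_measurable[of p] by (intro Fubini'[symmetric]) (simp add: case_prod_beta)
  also have "\<dots> = (\<integral>\<^sup>+x. (\<Prod>b<Bl. ?g b (restrict x (I b))) \<partial>leb {..<n})"
  proof (rule nn_integral_cong)
    fix x assume x: "x \<in> space (leb {..<n})"
    have "L2_set (restrict x (I b)) (I b) = L2_set x (I b)" for b by (simp add: L2_set_def)
    then show "(\<integral>\<^sup>+u. ennreal (survive p u x) \<partial>U) = (\<Prod>b<Bl. ?g b (restrict x (I b)))"
      unfolding expect_survive[OF p(1) p1] indicator_base[OF x]
      using pos by (subst prod_ennreal) (auto simp: prod.distrib)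
  qed
  also have "\<dots> = (\<Prod>b<Bl. \<integral>\<^sup>+x. ?g b x \<partial>leb (I b))"
    by (rule nn_integral_blocks[of ?g, OF gm])
  also have "\<dots> = (\<Prod>b<Bl. ennreal (block.W (I b) r h N p))"
    using block.nn_W[OF block p] by (intro prod.cong) auto
  also have "\<dots> = ennreal (Wt p)"
    unfolding Wt_def using block.W_pos[OF block p] by (intro prod_ennreal) (auto intro: less_imp_le)
  finally show ?thesis .
qed

lemma Wt_pos: "0 \<le> p \<Longrightarrow> p \<le> 1/2 \<Longrightarrow> 0 < Wt p"
  unfolding Wt_def using block.W_pos[OF block] by (intro prod_pos) auto

lemma cuteither_restrict: "cuteither h A K (restrict x K) (restrict y K) = cuteither h A K x y"
  unfolding cuteither_def by simp

text \<open>Joint survival of two points factors over the blocks as well, so the second moment is a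
  product of \<open>pairW\<close> terms and the block errors \<open>1 + \<eta>\<close>
  multiply.\<close>

lemma expect_vol2:
  assumes p: "0 \<le> p" "p \<le> 1/2" and err: "\<And>b. b < Bl \<Longrightarrow> block.err (I b) z \<le> \<eta>"
  shows "(\<integral>\<^sup>+u. ennreal (bern p J (\<lambda>T. (vol n (body u T))\<^sup>2)) \<partial>U) \<le> ennreal ((1 + \<eta>) ^ Bl * (Wt p)\<^sup>2)"
proof -
  interpret pair_sigma_finite U "leb {..<n}" by (rule pair_sigma_finite_U)
  have p1: "p \<le> 1" using p by simp
  let ?g = "\<lambda>b y x. ennreal (indicator (L2_ball (I b) r) x * indicator (L2_ball (I b) r) y *
    (1 - p * cuteither h {..<n} (I b) x y) ^ N)"
  have pos: "0 \<le> (1 - p * cuteither h {..<n} K x y) ^ N" for K x y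
    using p p1 cuteither_bounds[of h "{..<n}" K x y] by (auto intro!: zero_le_power mult_le_one)
  have gm2: "(\<lambda>q. ?g b (fst q) (snd q)) \<in> borel_measurable (leb (I b) \<Otimes>\<^sub>M leb (I b))" if b: "b < Bl" for b
  proof -
    have "(\<lambda>q. (snd q, fst q)) \<in> measurable (leb (I b) \<Otimes>\<^sub>M leb (I b)) (leb (I b) \<Otimes>\<^sub>M leb (I b))" by measurable
    from measurable_compose[OF this cuteither_measurable[OF finite_lessThan I_sub[OF b]]]
    have [measurable]: "(\<lambda>q. cuteither h {..<n} (I b) (snd q) (fst q)) \<in> borel_measurable (leb (I b) \<Otimes>\<^sub>M leb (I b))"
      by simp
    show ?thesis using finite_I[OF b] by measurable
  qed
  have gm1: "?g b y \<in> borel_measurable (leb (I b))" if "b < Bl" "y \<in> space (leb (I b))" for b y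
    using measurable_compose[OF measurable_Pair1'[OF that(2)] gm2[OF that(1)]] by simp
  have gm: "(\<lambda>y. \<integral>\<^sup>+x. ?g b y x \<partial>leb (I b)) \<in> borel_measurable (leb (I b))" if "b < Bl" for b
  proof -
    have "(\<lambda>(y, x). ?g b y x) = (\<lambda>q. ?g b (fst q) (snd q))" by (auto simp: fun_eq_iff)
    then have "(\<lambda>(y, x). ?g b y x) \<in> borel_measurable (leb (I b) \<Otimes>\<^sub>M leb (I b))"
      using gm2[OF that] by metis
    then show ?thesis
      by (intro sigma_finite_measure.borel_measurable_nn_integral sigma_finite_leb finite_I that)
  qed
  have Km: "(\<lambda>(u, y). \<integral>\<^sup>+x. ennreal (survive2 p u y x) \<partial>leb {..<n}) \<in> borel_measurable (U \<Otimes>\<^sub>M leb {..<n})"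
  proof -
    have "(\<lambda>q. \<integral>\<^sup>+x. ennreal (survive2 p (fst q) (snd q) x) \<partial>leb {..<n}) \<in> borel_measurable (U \<Otimes>\<^sub>M leb {..<n})"
      using survive2_measurable[of p]
      by (intro sigma_finite_measure.borel_measurable_nn_integral sigma_finite_leb) (auto simp: case_prod_beta)
    then show ?thesis by (simp add: case_prod_beta)
  qed
  have "(\<integral>\<^sup>+u. ennreal (bern p J (\<lambda>T. (vol n (body u T))\<^sup>2)) \<partial>U) =
      (\<integral>\<^sup>+u. \<integral>\<^sup>+y. \<integral>\<^sup>+x. ennreal (survive2 p u y x) \<partial>leb {..<n} \<partial>leb {..<n} \<partial>U)"
    by (intro nn_integral_cong bern_vol2 p p1)
  also have "\<dots> = (\<integral>\<^sup>+y. \<integral>\<^sup>+u. \<integral>\<^sup>+x. ennreal (survive2 p u y x) \<partial>leb {..<n} \<partial>U \<partial>leb {..<n})"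
    by (intro Fubini'[symmetric] Km)
  also have "\<dots> = (\<integral>\<^sup>+y. \<integral>\<^sup>+x. \<integral>\<^sup>+u. ennreal (survive2 p u y x) \<partial>U \<partial>leb {..<n} \<partial>leb {..<n})"
  proof (rule nn_integral_cong, rule Fubini'[symmetric])
    fix y assume y: "y \<in> space (leb {..<n})"
    have "(\<lambda>q. ((fst q, y), snd q)) \<in> measurable (U \<Otimes>\<^sub>M leb {..<n}) ((U \<Otimes>\<^sub>M leb {..<n}) \<Otimes>\<^sub>M leb {..<n})"
      using y by measurable
    from measurable_compose[OF this survive2_measurable[of p]]
    show "(\<lambda>(u, x). ennreal (survive2 p u y x)) \<in> borel_measurable (U \<Otimes>\<^sub>M leb {..<n})"
      by (simp add: case_prod_beta)
  qed
  also have "\<dots> = (\<integral>\<^sup>+y. \<integral>\<^sup>+x. (\<Prod>b<Bl. ?g b (restrict y (I b)) (restrict x (I b))) \<partial>leb {..<n} \<partial>leb {..<n})"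
  proof (intro nn_integral_cong)
    fix x y assume x: "x \<in> space (leb {..<n})" and y: "y \<in> space (leb {..<n})"
    show "(\<integral>\<^sup>+u. ennreal (survive2 p u y x) \<partial>U) = (\<Prod>b<Bl. ?g b (restrict y (I b)) (restrict x (I b)))"
      unfolding expect_survive2[OF p(1) p1] indicator_base[OF x] indicator_base[OF y] cuteither_restrict
      using pos by (subst prod_ennreal) (auto simp: prod.distrib)
  qed
  also have "\<dots> = (\<integral>\<^sup>+y. (\<Prod>b<Bl. \<integral>\<^sup>+x. ?g b (restrict y (I b)) x \<partial>leb (I b)) \<partial>leb {..<n})"
  proof (rule nn_integral_cong)
    fix y assume y: "y \<in> space (leb {..<n})"
    have "restrict y (I b) \<in> space (leb (I b))" for b by (auto simp: space_PiM)
    then show "(\<integral>\<^sup>+x. (\<Prod>b<Bl. ?g b (restrict y (I b)) (restrict x (I b))) \<partial>leb {..<n}) =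
        (\<Prod>b<Bl. \<integral>\<^sup>+x. ?g b (restrict y (I b)) x \<partial>leb (I b))"
      by (intro nn_integral_blocks[of "\<lambda>b. ?g b (restrict y (I b))"] gm1)
  qed
  also have "\<dots> = (\<Prod>b<Bl. \<integral>\<^sup>+y. \<integral>\<^sup>+x. ?g b y x \<partial>leb (I b) \<partial>leb (I b))"
    by (rule nn_integral_blocks[of "\<lambda>b y. \<integral>\<^sup>+x. ?g b y x \<partial>leb (I b)", OF gm])
  also have "\<dots> = (\<Prod>b<Bl. block.pairW (I b) {..<n} r h N p)"
    by (intro prod.cong refl) (simp add: block.pairW_def[OF block])
  also have "\<dots> \<le> (\<Prod>b<Bl. ennreal ((1 + \<eta>) * (block.W (I b) r h N p)\<^sup>2))"
  proof (rule prod_mono_ennreal)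
    fix b assume "b \<in> {..<Bl}"
    then have b: "b < Bl" by simp
    have "block.pairW (I b) {..<n} r h N p \<le> ennreal ((1 + block.err (I b) z) * (block.W (I b) r h N p)\<^sup>2)"
      by (rule block.pairW_le[OF block[OF b] p])
    also have "\<dots> \<le> ennreal ((1 + \<eta>) * (block.W (I b) r h N p)\<^sup>2)"
      using err[OF b] by (intro ennreal_leI mult_right_mono) auto
    finally show "block.pairW (I b) {..<n} r h N p \<le> ennreal ((1 + \<eta>) * (block.W (I b) r h N p)\<^sup>2)" .
  qed
  also have "\<dots> = ennreal (\<Prod>b<Bl. (1 + \<eta>) * (block.W (I b) r h N p)\<^sup>2)"
  proof (rule prod_ennreal)
    fix b assume "b \<in> {..<Bl}"
    then have "0 \<le> block.err (I b) z"
      by (subst block.err_def[OF block]) (auto intro!: add_nonneg_nonneg)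
    then show "0 \<le> (1 + \<eta>) * (block.W (I b) r h N p)\<^sup>2" using err \<open>b \<in> {..<Bl}\<close> by fastforce
  qed
  also have "(\<Prod>b<Bl. (1 + \<eta>) * (block.W (I b) r h N p)\<^sup>2) = (1 + \<eta>) ^ Bl * (Wt p)\<^sup>2"
    by (simp add: prod.distrib Wt_def prod_power_distrib)
  finally show ?thesis .
qed

section \<open>Deviation of the volume and choice of the directions\<close>

lemma bern_vol_measurable:
  assumes p: "0 \<le> p" "p \<le> 1"
  shows "(\<lambda>u. bern p J (\<lambda>T. vol n (body u T))) \<in> borel_measurable U"
    and "(\<lambda>u. bern p J (\<lambda>T. (vol n (body u T))\<^sup>2)) \<in> borel_measurable U"
proof -
  have "(\<lambda>u. enn2real (\<integral>\<^sup>+x. ennreal (survive p u x) \<partial>leb {..<n})) \<in> borel_measurable U"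
    using survive_measurable[of p]
    by (intro borel_measurable_enn2real sigma_finite_measure.borel_measurable_nn_integral sigma_finite_leb)
      (simp_all add: case_prod_beta')
  moreover have "bern p J (\<lambda>T. vol n (body u T)) = enn2real (\<integral>\<^sup>+x. ennreal (survive p u x) \<partial>leb {..<n})"
    if "u \<in> space U" for u
    using bern_vol[OF p that] bern_nonneg[OF p, of J "\<lambda>T. vol n (body u T)"] vol_nonneg
    by (metis enn2real_ennreal)
  ultimately show "(\<lambda>u. bern p J (\<lambda>T. vol n (body u T))) \<in> borel_measurable U"
    by (subst measurable_cong)
  have "(\<lambda>q. \<integral>\<^sup>+x. ennreal (survive2 p (fst q) (snd q) x) \<partial>leb {..<n}) \<in> borel_measurable (U \<Otimes>\<^sub>M leb {..<n})"
    using survive2_measurable[of p]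
    by (intro sigma_finite_measure.borel_measurable_nn_integral sigma_finite_leb) (auto simp: case_prod_beta')
  then have "(\<lambda>u. enn2real (\<integral>\<^sup>+y. \<integral>\<^sup>+x. ennreal (survive2 p u y x) \<partial>leb {..<n} \<partial>leb {..<n})) \<in> borel_measurable U"
    by (intro borel_measurable_enn2real sigma_finite_measure.borel_measurable_nn_integral sigma_finite_leb)
      (simp_all add: case_prod_beta')
  moreover have "bern p J (\<lambda>T. (vol n (body u T))\<^sup>2) =
      enn2real (\<integral>\<^sup>+y. \<integral>\<^sup>+x. ennreal (survive2 p u y x) \<partial>leb {..<n} \<partial>leb {..<n})" if "u \<in> space U" for u
    using bern_vol2[OF p that] bern_nonneg[OF p, of J "\<lambda>T. (vol n (body u T))\<^sup>2"]
    by (metis enn2real_ennreal zero_le_power2)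
  ultimately show "(\<lambda>u. bern p J (\<lambda>T. (vol n (body u T))\<^sup>2)) \<in> borel_measurable U"
    by (subst measurable_cong)
qed

text \<open>The centre is the overall mean \<open>Wt p\<close> and not the mean for the given
  \<open>u\<close>. A small value therefore says both that the coins cause little fluctuation and
  that the directions are typical.\<close>

definition spread :: "real \<Rightarrow> (nat \<times> nat \<Rightarrow> point) \<Rightarrow> real" where
  "spread p u = bern p J (\<lambda>T. (vol n (body u T) - Wt p)\<^sup>2)"

lemma spread_eq:
  "spread p u + 2 * Wt p * bern p J (\<lambda>T. vol n (body u T)) =
    bern p J (\<lambda>T. (vol n (body u T))\<^sup>2) + (Wt p)\<^sup>2"
proof -
  have "spread p u + 2 * Wt p * bern p J (\<lambda>T. vol n (body u T)) =
      bern p J (\<lambda>T. (vol n (body u T) - Wt p)\<^sup>2 + 2 * Wt p * vol n (body u T))"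
    unfolding spread_def bern_add bern_cmult ..
  also have "\<dots> = bern p J (\<lambda>T. (vol n (body u T))\<^sup>2 + (Wt p)\<^sup>2)"
    by (simp add: power2_diff)
  also have "\<dots> = bern p J (\<lambda>T. (vol n (body u T))\<^sup>2) + (Wt p)\<^sup>2"
    by (simp only: bern_add bern_const[OF finite_J])
  finally show ?thesis .
qed

lemma spread_nonneg: "0 \<le> p \<Longrightarrow> p \<le> 1 \<Longrightarrow> 0 \<le> spread p u"
  unfolding spread_def by (intro bern_nonneg) auto

lemma spread_measurable:
  assumes p: "0 \<le> p" "p \<le> 1"
  shows "spread p \<in> borel_measurable U"
proof -
  note [measurable] = bern_vol_measurable[OF p]
  have "spread p = (\<lambda>u. bern p J (\<lambda>T. (vol n (body u T))\<^sup>2) + (Wt p)\<^sup>2 - 2 * Wt p * bern p J (\<lambda>T. vol n (body u T)))"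
    using spread_eq[of p] by (simp add: fun_eq_iff algebra_simps)
  then show ?thesis by simp
qed

lemma expect_spread:
  assumes p: "0 \<le> p" "p \<le> 1/2" and err: "\<And>b. b < Bl \<Longrightarrow> block.err (I b) z \<le> \<eta>"
    and eps: "(1 + \<eta>) ^ Bl \<le> 1 + \<epsilon>"
  shows "(\<integral>\<^sup>+u. ennreal (spread p u) \<partial>U) \<le> ennreal (\<epsilon> * (Wt p)\<^sup>2)"
proof -
  interpret U: prob_space U by (rule prob_space_U)
  have p1: "p \<le> 1" using p by simp
  note [measurable] = bern_vol_measurable[OF p(1) p1] spread_measurable[OF p(1) p1]
  have W: "0 \<le> Wt p" using Wt_pos[OF p] by simp
  have nn: "0 \<le> bern p J (\<lambda>T. vol n (body u T))" "0 \<le> bern p J (\<lambda>T. (vol n (body u T))\<^sup>2)" for u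
    by (auto intro!: bern_nonneg p p1 vol_nonneg)
  \<comment> \<open>The identity for the variance is used with the cross term added to the left,
    which avoids subtraction in \<open>ennreal\<close>.\<close>
  have "(\<integral>\<^sup>+u. ennreal (spread p u) \<partial>U) + ennreal (2 * (Wt p)\<^sup>2) =
      (\<integral>\<^sup>+u. ennreal (spread p u) \<partial>U) + ennreal (2 * Wt p) * (\<integral>\<^sup>+u. ennreal (bern p J (\<lambda>T. vol n (body u T))) \<partial>U)"
    unfolding expect_vol[OF p] using W by (simp add: power2_eq_square mult.assoc flip: ennreal_mult)
  also have "\<dots> = (\<integral>\<^sup>+u. ennreal (spread p u) + ennreal (2 * Wt p) * ennreal (bern p J (\<lambda>T. vol n (body u T))) \<partial>U)"
    by (simp add: nn_integral_add nn_integral_cmult)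
  also have "\<dots> = (\<integral>\<^sup>+u. ennreal (bern p J (\<lambda>T. (vol n (body u T))\<^sup>2)) + ennreal ((Wt p)\<^sup>2) \<partial>U)"
    using spread_eq[of p] W nn spread_nonneg[OF p(1) p1]
    by (simp flip: ennreal_mult ennreal_plus)
  also have "\<dots> = (\<integral>\<^sup>+u. ennreal (bern p J (\<lambda>T. (vol n (body u T))\<^sup>2)) \<partial>U) + ennreal ((Wt p)\<^sup>2)"
    by (simp add: nn_integral_add U.emeasure_space_1)
  also have "\<dots> \<le> ennreal ((1 + \<eta>) ^ Bl * (Wt p)\<^sup>2) + ennreal ((Wt p)\<^sup>2)"
    by (intro add_right_mono expect_vol2[OF p err])
  also have "\<dots> \<le> ennreal ((1 + \<epsilon>) * (Wt p)\<^sup>2) + ennreal ((Wt p)\<^sup>2)"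
    by (intro add_right_mono ennreal_leI mult_right_mono eps) auto
  finally have le: "(\<integral>\<^sup>+u. ennreal (spread p u) \<partial>U) + ennreal (2 * (Wt p)\<^sup>2) \<le> ennreal ((1 + \<epsilon>) * (Wt p)\<^sup>2) + ennreal ((Wt p)\<^sup>2)" .
  show ?thesis
  proof (cases "\<integral>\<^sup>+u. ennreal (spread p u) \<partial>U")
    case (real s)
    show ?thesis
    proof (cases "0 \<le> 1 + \<epsilon>")
      case True
      then have "s + 2 * (Wt p)\<^sup>2 \<le> (1 + \<epsilon>) * (Wt p)\<^sup>2 + (Wt p)\<^sup>2"
        using le real by (simp flip: ennreal_plus)
      then have "s \<le> \<epsilon> * (Wt p)\<^sup>2" by (simp add: algebra_simps)
      then show ?thesis using real by (simp add: ennreal_leI)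
    next
      \<comment> \<open>A negative \<open>1 + \<epsilon>\<close> is truncated to 0 by
        \<open>ennreal\<close>; the inequality then contradicts \<open>Wt p > 0\<close>.\<close>
      case False
      then have "(1 + \<epsilon>) * (Wt p)\<^sup>2 \<le> 0" by (intro mult_nonpos_nonneg) auto
      then have "ennreal ((1 + \<epsilon>) * (Wt p)\<^sup>2) = 0" by (rule ennreal_neg)
      then have "s + 2 * (Wt p)\<^sup>2 \<le> (Wt p)\<^sup>2" using le real by (simp flip: ennreal_plus)
      then have "(Wt p)\<^sup>2 \<le> 0" using real zero_le_power2[of "Wt p"] by linarith
      then show ?thesis using Wt_pos[OF p] by simp
    qed
  next
    case top
    then show ?thesis using le by (simp add: top_unique flip: ennreal_plus)
  qed
qed

text \<open>Markov's inequality for one weighted sum: each of the two spreads and the total squared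
  length, divided by its bound, has mean at most 1, so the sum has mean at most 3. Violating any one
  requirement would make the sum at least 4.\<close>

lemma exists_directions:
  assumes p: "0 \<le> p" "p \<le> 1/2" and q: "0 \<le> q" "q \<le> 1/2"
    and err: "\<And>b. b < Bl \<Longrightarrow> block.err (I b) z \<le> \<eta>"
    and eps: "(1 + \<eta>) ^ Bl \<le> 1 + \<epsilon>" "0 < \<epsilon>" and pos: "0 < card J * n"
  shows "\<exists>u. u \<in> space U \<and> spread p u \<le> 4 * \<epsilon> * (Wt p)\<^sup>2 \<and> spread q u \<le> 4 * \<epsilon> * (Wt q)\<^sup>2 \<and>
    (\<forall>j\<in>J. L2_set (u j) {..<n} \<le> sqrt (4 * (card J * n)))"
proof (rule ccontr)
  assume contr: "\<not> ?thesis"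
  interpret U: prob_space U by (rule prob_space_U)
  interpret G': product_prob_space "\<lambda>_::nat \<times> nat. G" J
    by (rule product_prob_spaceI) (rule prob_space_G)
  have p1: "p \<le> 1" "q \<le> 1" using p q by auto
  note [measurable] = spread_measurable[OF p(1) p1(1)] spread_measurable[OF q(1) p1(2)]
  define sq where "sq u = (\<Sum>j\<in>J. \<Sum>k<n. (u j k)\<^sup>2)" for u :: "nat \<times> nat \<Rightarrow> point"
  have um: "(\<lambda>u. ennreal ((u j k)\<^sup>2)) \<in> borel_measurable U" if "j \<in> J" "k < n" for j k
    using u_measurable[OF that] by simp
  have one: "(\<integral>\<^sup>+u. ennreal ((u j k)\<^sup>2) \<partial>U) = 1" if "j \<in> J" "k < n" for j k
  proof -
    have "(\<lambda>v. v k) \<in> measurable G gauss" using that by (intro measurable_component_singleton) auto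
    then have vm: "(\<lambda>v. v k) \<in> borel_measurable G" by simp
    have "(\<integral>\<^sup>+u. ennreal ((u j k)\<^sup>2) \<partial>U) = (\<integral>\<^sup>+v. ennreal ((v k)\<^sup>2) \<partial>distr U G (\<lambda>u. u j))"
      using that vm by (subst nn_integral_distr) (auto simp: U_def)
    also have "distr U G (\<lambda>u. u j) = G"
      unfolding U_def by (rule distr_PiM_component) (use that prob_space_G in auto)
    finally show ?thesis using nn_integral_PiM_gauss_square[of "{..<n}" k] that by simp
  qed
  have "(\<integral>\<^sup>+u. ennreal (sq u) \<partial>U) = (\<integral>\<^sup>+u. (\<Sum>j\<in>J. \<Sum>k<n. ennreal ((u j k)\<^sup>2)) \<partial>U)"
    unfolding sq_def by (simp add: sum_nonneg flip: sum_ennreal)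
  also have "\<dots> = (\<Sum>j\<in>J. \<Sum>k<n. \<integral>\<^sup>+u. ennreal ((u j k)\<^sup>2) \<partial>U)"
  proof -
    have "(\<integral>\<^sup>+u. (\<Sum>j\<in>J. \<Sum>k<n. ennreal ((u j k)\<^sup>2)) \<partial>U) = (\<Sum>j\<in>J. \<integral>\<^sup>+u. (\<Sum>k<n. ennreal ((u j k)\<^sup>2)) \<partial>U)"
      by (rule nn_integral_sum, rule borel_measurable_sum) (use um in auto)
    also have "\<dots> = (\<Sum>j\<in>J. \<Sum>k<n. \<integral>\<^sup>+u. ennreal ((u j k)\<^sup>2) \<partial>U)"
      by (rule sum.cong[OF refl], rule nn_integral_sum) (use um in auto)
    finally show ?thesis .
  qed
  also have "\<dots> = (\<Sum>j\<in>J. \<Sum>k<n. 1)" using one by (intro sum.cong) auto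
  also have "\<dots> = ennreal (card J * n)" by (simp add: ennreal_of_nat_eq_real_of_nat ennreal_mult)
  finally have Esq: "(\<integral>\<^sup>+u. ennreal (sq u) \<partial>U) = ennreal (card J * n)" .
  have sqm: "(\<lambda>u. ennreal (sq u)) \<in> borel_measurable U"
    unfolding sq_def using u_measurable
    by (intro measurable_compose[OF _ measurable_ennreal] borel_measurable_sum borel_measurable_power) auto
  define A where "A = 1 / (\<epsilon> * (Wt p)\<^sup>2)"
  define B where "B = 1 / (\<epsilon> * (Wt q)\<^sup>2)"
  define D where "D = 1 / (card J * n)"
  have ABD: "0 < A" "0 < B" "0 < D" using eps Wt_pos[OF p] Wt_pos[OF q] pos by (auto simp: A_def B_def D_def)
  let ?P = "\<lambda>u. ennreal A * ennreal (spread p u) + (ennreal B * ennreal (spread q u) + ennreal D * ennreal (sq u))"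
  have "4 \<le> ?P u" if "u \<in> space U" for u
  proof -
    have nn: "0 \<le> spread p u" "0 \<le> spread q u" "0 \<le> sq u"
      using spread_nonneg p q p1 by (auto simp: sq_def intro!: sum_nonneg)
    have "4 * \<epsilon> * (Wt p)\<^sup>2 < spread p u \<or> 4 * \<epsilon> * (Wt q)\<^sup>2 < spread q u \<or>
        (\<exists>j\<in>J. sqrt (4 * (card J * n)) < L2_set (u j) {..<n})"
      using contr that by (metis not_le)
    then have "4 \<le> A * spread p u + (B * spread q u + D * sq u)"
    proof (elim disjE bexE)
      assume "4 * \<epsilon> * (Wt p)\<^sup>2 < spread p u"
      then have "4 \<le> A * spread p u" using eps Wt_pos[OF p] by (simp add: A_def field_simps)
      moreover have "0 \<le> B * spread q u" "0 \<le> D * sq u" using ABD nn by auto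
      ultimately show ?thesis by linarith
    next
      assume "4 * \<epsilon> * (Wt q)\<^sup>2 < spread q u"
      then have "4 \<le> B * spread q u" using eps Wt_pos[OF q] by (simp add: B_def field_simps)
      moreover have "0 \<le> A * spread p u" "0 \<le> D * sq u" using ABD nn by auto
      ultimately show ?thesis by linarith
    next
      fix j assume j: "j \<in> J" and "sqrt (4 * (card J * n)) < L2_set (u j) {..<n}"
      then have "4 * (card J * n) < (\<Sum>k<n. (u j k)\<^sup>2)"
        by (simp add: L2_set_def)
      also have "\<dots> \<le> sq u"
        unfolding sq_def using j finite_J by (intro member_le_sum) (auto intro: sum_nonneg)
      finally have "4 \<le> D * sq u" using pos by (simp add: D_def field_simps)
      moreover have "0 \<le> A * spread p u" "0 \<le> B * spread q u" using ABD nn by auto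
      ultimately show ?thesis by linarith
    qed
    then have "ennreal 4 \<le> ennreal (A * spread p u + (B * spread q u + D * sq u))" by (rule ennreal_leI)
    also have "\<dots> = ?P u" using ABD nn by (simp add: ennreal_mult)
    finally show ?thesis by simp
  qed
  then have "(\<integral>\<^sup>+u. 4 \<partial>U) \<le> (\<integral>\<^sup>+u. ?P u \<partial>U)" by (intro nn_integral_mono)
  also have "\<dots> = ennreal A * (\<integral>\<^sup>+u. ennreal (spread p u) \<partial>U) +
      (ennreal B * (\<integral>\<^sup>+u. ennreal (spread q u) \<partial>U) + ennreal D * (\<integral>\<^sup>+u. ennreal (sq u) \<partial>U))"
    using sqm by (simp add: nn_integral_add nn_integral_cmult)
  also have "\<dots> \<le> ennreal A * ennreal (\<epsilon> * (Wt p)\<^sup>2) +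
      (ennreal B * ennreal (\<epsilon> * (Wt q)\<^sup>2) + ennreal D * ennreal (card J * n))"
    unfolding Esq
    by (intro add_mono mult_left_mono expect_spread[OF p err eps(1)] expect_spread[OF q err eps(1)]) auto
  also have "\<dots> = ennreal (A * (\<epsilon> * (Wt p)\<^sup>2) + (B * (\<epsilon> * (Wt q)\<^sup>2) + D * (card J * n)))"
    using ABD eps by (simp flip: ennreal_mult)
  also have "A * (\<epsilon> * (Wt p)\<^sup>2) + (B * (\<epsilon> * (Wt q)\<^sup>2) + D * (card J * n)) = 3"
    using eps Wt_pos[OF p] Wt_pos[OF q] pos by (simp add: A_def B_def D_def)
  finally show False by (simp add: U.emeasure_space_1)
qed

end

subsection \<open>Membership in the class of inputs\<close>

lemma closedin_finite_All:
  assumes "\<And>i. i \<in> S \<Longrightarrow> closedin X {x \<in> topspace X. P i x}"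
  shows "closedin X {x \<in> topspace X. \<forall>i\<in>S. P i x}"
proof (cases "S = {}")
  case False
  then have "{x \<in> topspace X. \<forall>i\<in>S. P i x} = (\<Inter>i\<in>S. {x \<in> topspace X. P i x})" by auto
  then show ?thesis using assms False by auto
qed simp

lemma topspace_Rn: "topspace (Rn n) = {..<n} \<rightarrow>\<^sub>E UNIV"
  by (simp add: Rn_def)

lemma closedin_Rn_sum_le:
  assumes "I \<subseteq> {..<n}"
  shows "closedin (Rn n) {x \<in> topspace (Rn n). (\<Sum>k\<in>I. v k * x k) \<le> h}"
    and "closedin (Rn n) {x \<in> topspace (Rn n). L2_set x I \<le> h}"
proof -
  have fin: "finite I" using assms finite_subset by blast
  have proj: "continuous_map (Rn n) euclideanreal (\<lambda>x. x k)" if "k \<in> I" for k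
    unfolding Rn_def using assms that continuous_map_product_projection[of k "{..<n}" "\<lambda>_. euclideanreal"] by auto
  have "continuous_map (Rn n) euclideanreal (\<lambda>x. \<Sum>k\<in>I. v k * x k)"
    using proj fin by (intro continuous_map_sum continuous_map_real_mult) auto
  from closedin_continuous_map_preimage[OF this, of "{..h}"]
  show "closedin (Rn n) {x \<in> topspace (Rn n). (\<Sum>k\<in>I. v k * x k) \<le> h}" by simp
  have "continuous_map (Rn n) euclideanreal (\<lambda>x. \<Sum>k\<in>I. (x k)\<^sup>2)"
    using proj fin by (intro continuous_map_sum continuous_map_real_pow) auto
  moreover have "closed {t. sqrt t \<le> h}"
    by (intro closed_Collect_le continuous_intros)
  ultimately have "closedin (Rn n) {x \<in> topspace (Rn n). (\<Sum>k\<in>I. (x k)\<^sup>2) \<in> {t. sqrt t \<le> h}}"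
    by (intro closedin_continuous_map_preimage) auto
  then show "closedin (Rn n) {x \<in> topspace (Rn n). L2_set x I \<le> h}"
    by (simp add: L2_set_def)
qed

text \<open>Compactness follows from closedness inside a cube, and the interior is nonempty because
  the open cube of half-width \<open>1 / n\<close> lies in the unit ball.\<close>

lemma inputsI:
  assumes n: "0 < n" and closed: "closedin (Rn n) K"
    and convex: "\<And>x y t. x \<in> K \<Longrightarrow> y \<in> K \<Longrightarrow> 0 \<le> t \<Longrightarrow> t \<le> 1 \<Longrightarrow> (\<lambda>i\<in>{..<n}. (1 - t) * x i + t * y i) \<in> K"
    and sub: "eball n 1 \<subseteq> K" "K \<subseteq> eball n (C * real n ^ 8)"
  shows "K \<in> inputs C n"
proof -
  define R where "R = C * real n ^ 8"
  have "K \<subseteq> PiE {..<n} (\<lambda>_. {-R..R})"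
  proof
    fix x assume "x \<in> K"
    then have x: "x \<in> {..<n} \<rightarrow>\<^sub>E UNIV" "L2_set x {..<n} \<le> R" using sub by (auto simp: eball_def R_def)
    have "\<bar>x i\<bar> \<le> R" if "i < n" for i
      using member_le_L2_set[of "{..<n}" i "\<lambda>i. \<bar>x i\<bar>"] that x(2) by (simp add: L2_set_def)
    then have "x i \<in> {-R..R}" if "i < n" for i using that by (simp add: abs_le_iff minus_le_iff)
    then show "x \<in> PiE {..<n} (\<lambda>_. {-R..R})" using x(1) by (simp add: PiE_iff)
  qed
  moreover have "compactin (Rn n) (PiE {..<n} (\<lambda>_. {-R..R}))"
    unfolding Rn_def compactin_PiE by simp
  ultimately have compact: "compactin (Rn n) K" using closed closed_compactin by blast
  let ?O = "PiE {..<n} (\<lambda>_. {-1 / real n<..<1 / real n})"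
  have "openin (Rn n) ?O" unfolding Rn_def by (simp add: openin_PiE)
  moreover have "?O \<subseteq> eball n 1"
  proof
    fix x assume x: "x \<in> ?O"
    have "L2_set x {..<n} \<le> (\<Sum>i<n. \<bar>x i\<bar>)" by (rule L2_set_le_sum_abs)
    also have "\<dots> \<le> (\<Sum>i<n. 1 / real n)"
    proof (rule sum_mono)
      fix i assume "i \<in> {..<n}"
      then have "x i \<in> {-1 / real n<..<1 / real n}" using x by (simp add: PiE_iff)
      then show "\<bar>x i\<bar> \<le> 1 / real n" by (simp add: abs_le_iff minus_le_iff)
    qed
    also have "\<dots> = 1" using n by simp
    finally show "x \<in> eball n 1" using x by (simp add: eball_def PiE_iff)
  qed
  moreover have "?O \<noteq> {}" using n by (simp add: PiE_eq_empty_iff)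
  ultimately have "Rn n interior_of K \<noteq> {}"
    using sub(1) interior_of_maximal[of ?O K "Rn n"] by (metis order_trans subset_empty)
  with compact convex sub show ?thesis by (simp add: inputs_def convex_body_def)
qed

lemma L2_set_convex:
  assumes "I \<subseteq> {..<n}" "0 \<le> t" "t \<le> 1" "L2_set x I \<le> r" "L2_set y I \<le> r"
  shows "L2_set (\<lambda>i\<in>{..<n}. (1 - t) * x i + t * y i) I \<le> r"
proof -
  have "L2_set (\<lambda>i\<in>{..<n}. (1 - t) * x i + t * y i) I = L2_set (\<lambda>i. (1 - t) * x i + t * y i) I"
    using assms by (intro L2_set_cong) (simp_all add: subset_iff)
  also have "\<dots> \<le> L2_set (\<lambda>i. (1 - t) * x i) I + L2_set (\<lambda>i. t * y i) I"
    by (rule L2_set_triangle_ineq)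
  also have "\<dots> = (1 - t) * L2_set x I + t * L2_set y I"
    using assms by (simp add: L2_set_right_distrib)
  also have "\<dots> \<le> (1 - t) * r + t * r"
    using assms by (intro add_mono mult_left_mono) auto
  finally show ?thesis by (simp add: algebra_simps)
qed

lemma eball_in_inputs:
  assumes n: "0 < n" and R: "1 \<le> R" "R \<le> C * real n ^ 8"
  shows "eball n R \<in> inputs C n"
proof (rule inputsI[OF n])
  have eq: "eball n R = {x \<in> topspace (Rn n). L2_set x {..<n} \<le> R}"
    unfolding eball_def topspace_Rn by (rule refl)
  show "closedin (Rn n) (eball n R)" unfolding eq by (rule closedin_Rn_sum_le(2)) (rule order_refl)
  show "(\<lambda>i\<in>{..<n}. (1 - t) * x i + t * y i) \<in> eball n R"
    if x: "x \<in> eball n R" and y: "y \<in> eball n R" and t: "0 \<le> t" "t \<le> 1" for x y t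
  proof -
    have "L2_set (\<lambda>i\<in>{..<n}. (1 - t) * x i + t * y i) {..<n} \<le> R"
      using x y by (intro L2_set_convex t) (simp_all add: eball_def)
    moreover have "(\<lambda>i\<in>{..<n}. (1 - t) * x i + t * y i) \<in> {..<n} \<rightarrow>\<^sub>E UNIV" by (rule restrict_PiE_iff[THEN iffD2]) simp
    ultimately show ?thesis unfolding eball_def by blast
  qed
  show "eball n 1 \<subseteq> eball n R" "eball n R \<subseteq> eball n (C * real n ^ 8)"
    using R unfolding eball_def by (auto intro: order_trans)
qed

lemma vol_eball: "0 < R \<Longrightarrow> vol n (eball n R) = ball_vol {..<n} R"
  using measure_L2_ball[of "{..<n}" R] by (simp add: vol_def lebn_def eball_def L2_ball_def)

context polytope begin

text \<open>By Cauchy-Schwarz, normals of length at most \<open>h\<close> never cut into the unit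
  ball. A product of \<open>Bl\<close> balls of radius \<open>r\<close> lies in the ball of radius
  \<open>sqrt Bl * r\<close>.\<close>

lemma body_in_inputs:
  assumes n: "0 < n" and r: "1 \<le> r" and R: "real Bl * r\<^sup>2 \<le> (C * real n ^ 8)\<^sup>2" "0 \<le> C"
    and u: "\<And>j. j \<in> J \<Longrightarrow> L2_set (u j) {..<n} \<le> h" and T: "T \<subseteq> J"
  shows "body u T \<in> inputs C n"
proof (rule inputsI[OF n])
  have body_eq: "body u T = {x \<in> topspace (Rn n). (\<forall>b\<in>{..<Bl}. L2_set x (I b) \<le> r)} \<inter>
      {x \<in> topspace (Rn n). \<forall>j\<in>T. (\<Sum>k\<in>I (fst j). u j k * x k) \<le> h}"
    using T by (auto simp: cut_body_def base_def viol_def topspace_Rn not_less)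
  have Ij: "I (fst j) \<subseteq> {..<n}" if "j \<in> T" for j using that T J_block I_sub by blast
  show "closedin (Rn n) (body u T)"
    unfolding body_eq
    by (intro closedin_Int closedin_finite_All closedin_Rn_sum_le Ij) (use I_sub in auto)
  show "(\<lambda>i\<in>{..<n}. (1 - t) * x i + t * y i) \<in> body u T"
    if x: "x \<in> body u T" and y: "y \<in> body u T" and t: "0 \<le> t" "t \<le> 1" for x y t
  proof -
    define w where "w = (\<lambda>i\<in>{..<n}. (1 - t) * x i + t * y i)"
    have w: "w \<in> topspace (Rn n)" unfolding w_def topspace_Rn by (rule restrict_PiE_iff[THEN iffD2]) simp
    have "L2_set w (I b) \<le> r" if "b < Bl" for b
      unfolding w_def using x y that t I_sub unfolding body_eq by (intro L2_set_convex) auto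
    moreover have "(\<Sum>k\<in>I (fst j). u j k * w k) \<le> h" if j: "j \<in> T" for j
    proof -
      have "(\<Sum>k\<in>I (fst j). u j k * w k) =
          (\<Sum>k\<in>I (fst j). (1 - t) * (u j k * x k) + t * (u j k * y k))"
        using Ij[OF j] by (intro sum.cong) (auto simp: w_def algebra_simps)
      also have "\<dots> = (1 - t) * (\<Sum>k\<in>I (fst j). u j k * x k) + t * (\<Sum>k\<in>I (fst j). u j k * y k)"
        by (simp add: sum.distrib sum_distrib_left)
      also have "\<dots> \<le> (1 - t) * h + t * h"
        using x y j t unfolding body_eq by (intro add_mono mult_left_mono) auto
      finally show ?thesis by (simp add: algebra_simps)
    qed
    ultimately show ?thesis using w unfolding body_eq w_def[symmetric] by blast
  qed
  have mono: "L2_set x (I b) \<le> L2_set x {..<n}" if "b < Bl" for x b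
    using I_sub[OF that] unfolding L2_set_def by (intro real_sqrt_le_mono sum_mono2) auto
  show "eball n 1 \<subseteq> body u T"
  proof
    fix x assume x: "x \<in> eball n 1"
    have le1: "L2_set x (I b) \<le> 1" if "b < Bl" for b
      using mono[OF that, of x] x by (simp add: eball_def)
    have "(\<Sum>k\<in>I (fst j). u j k * x k) \<le> h" if j: "j \<in> T" for j
    proof -
      have jJ: "j \<in> J" using j T by auto
      have "(\<Sum>k\<in>I (fst j). u j k * x k) \<le> (\<Sum>k\<in>I (fst j). \<bar>u j k\<bar> * \<bar>x k\<bar>)"
        by (intro sum_mono) (simp flip: abs_mult)
      also have "\<dots> \<le> L2_set (u j) (I (fst j)) * L2_set x (I (fst j))" by (rule L2_set_mult_ineq)
      also have "\<dots> \<le> L2_set (u j) {..<n} * 1"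
        by (intro mult_mono mono le1 J_block jJ) (simp_all add: L2_set_nonneg)
      also have "\<dots> \<le> h" using u[OF jJ] by simp
      finally show ?thesis .
    qed
    moreover have "L2_set x (I b) \<le> r" if "b < Bl" for b using le1[OF that] r by simp
    moreover have "x \<in> topspace (Rn n)" using x by (simp add: eball_def topspace_Rn)
    ultimately show "x \<in> body u T" unfolding body_eq by simp
  qed
  show "body u T \<subseteq> eball n (C * real n ^ 8)"
  proof
    fix x assume x: "x \<in> body u T"
    have "(\<Sum>k<n. (x k)\<^sup>2) = (\<Sum>b<Bl. \<Sum>k\<in>I b. (x k)\<^sup>2)"
      unfolding Union_I[symmetric] using finite_I disjoint_I
      by (intro sum.UNION_disjoint) (auto simp: disjoint_family_on_def)
    also have "\<dots> \<le> (\<Sum>b<Bl. r\<^sup>2)"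
    proof (rule sum_mono)
      fix b assume "b \<in> {..<Bl}"
      then have "sqrt (\<Sum>k\<in>I b. (x k)\<^sup>2) \<le> r" using x unfolding body_eq by (auto simp: L2_set_def)
      then show "(\<Sum>k\<in>I b. (x k)\<^sup>2) \<le> r\<^sup>2" by (rule sqrt_le_D)
    qed
    also have "\<dots> \<le> (C * real n ^ 8)\<^sup>2" using R by simp
    finally have "L2_set x {..<n} \<le> C * real n ^ 8"
      unfolding L2_set_def using R by (intro real_le_lsqrt) (auto intro: sum_nonneg)
    then show "x \<in> eball n (C * real n ^ 8)" using x unfolding body_eq by (auto simp: eball_def topspace_Rn)
  qed
qed

end

subsection \<open>Randomized algorithms\<close>

definition success :: "real \<Rightarrow> nat \<Rightarrow> algorithm \<Rightarrow> point set \<Rightarrow> bool" where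
  "success c n a K \<longleftrightarrow> (\<exists>V. outputs a K V \<and> (1 - c) * vol n K \<le> V \<and> V \<le> (1 + c) * vol n K)"

text \<open>The easy half of Yao's principle: averaging the failure probability over the internal
  randomness leaves a deterministic algorithm that is good for both coin laws at once.\<close>

lemma exists_good_algorithm:
  assumes M: "prob_space M" and n: "1 < n" and J: "finite J"
    and p: "0 \<le> p" "p \<le> 1" and q: "0 \<le> q" "q \<le> 1"
    and succ: "\<And>T. T \<subseteq> J \<Longrightarrow> 1 - 1 / real n \<le> measure M {a \<in> space M. success c n a (K T)}"
  shows "\<exists>a\<in>space M. bern p J (\<lambda>T. of_bool (\<not> success c n a (K T))) \<le> 3 / real n \<and>
    bern q J (\<lambda>T. of_bool (\<not> success c n a (K T))) \<le> 3 / real n"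
proof -
  interpret prob_space M by (rule M)
  let ?S = "\<lambda>T. {a \<in> space M. success c n a (K T)}"
  \<comment> \<open>A set outside \<open>sets M\<close> has \<open>measure\<close> 0 by default,
    which the success bound excludes for \<open>n > 1\<close>.\<close>
  have S: "?S T \<in> sets M" if "T \<subseteq> J" for T
  proof (rule ccontr)
    assume "?S T \<notin> sets M"
    then have "measure M (?S T) = 0" by (rule measure_notin_sets)
    then show False using succ[OF that] n by simp
  qed
  have m: "(\<lambda>a. of_bool (\<not> success c n a (K T)) :: real) \<in> borel_measurable M" if "T \<subseteq> J" for T
    unfolding of_bool_def using S[OF that] by (intro measurable_If) (auto intro: sets.sets_Collect_neg)
  have fail: "(\<integral>a. of_bool (\<not> success c n a (K T)) \<partial>M) \<le> 1 / real n"
    "integrable M (\<lambda>a. of_bool (\<not> success c n a (K T)) :: real)" if "T \<subseteq> J" for T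
  proof -
    show int: "integrable M (\<lambda>a. of_bool (\<not> success c n a (K T)) :: real)"
      using m[OF that] by (intro integrable_const_bound[where B=1]) auto
    have "(\<integral>a. of_bool (\<not> success c n a (K T)) \<partial>M) = (\<integral>a. 1 - indicator (?S T) a \<partial>M)"
      by (intro Bochner_Integration.integral_cong) (auto simp: indicator_def)
    also have "\<dots> = 1 - measure M (?S T)"
    proof -
      have "integrable M (indicator (?S T) :: _ \<Rightarrow> real)"
        using S[OF that] by (intro integrable_const_bound[where B=1]) (auto simp: indicator_def)
      moreover have "(\<integral>a. indicator (?S T) a \<partial>M) = measure M (?S T)"
        using S[OF that] by (simp only: Bochner_Integration.integral_indicator Int_absorb2 sets.sets_into_space)
      ultimately show ?thesis by (simp add: prob_space)
    qed
    finally show "(\<integral>a. of_bool (\<not> success c n a (K T)) \<partial>M) \<le> 1 / real n" using succ[OF that] by simp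
  qed
  have E: "(\<integral>a. bern s J (\<lambda>T. of_bool (\<not> success c n a (K T))) \<partial>M) \<le> 1 / real n"
    "integrable M (\<lambda>a. bern s J (\<lambda>T. of_bool (\<not> success c n a (K T))))" if s: "0 \<le> s" "s \<le> 1" for s
  proof -
    show "integrable M (\<lambda>a. bern s J (\<lambda>T. of_bool (\<not> success c n a (K T))))"
      unfolding bern_def using fail by (intro Bochner_Integration.integrable_sum integrable_mult_right) auto
    have "(\<integral>a. bern s J (\<lambda>T. of_bool (\<not> success c n a (K T))) \<partial>M) =
        bern s J (\<lambda>T. \<integral>a. of_bool (\<not> success c n a (K T)) \<partial>M)"
      unfolding bern_def using fail
      by (subst Bochner_Integration.integral_sum) auto
    also have "\<dots> \<le> bern s J (\<lambda>T. 1 / real n)" by (intro bern_mono s fail)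
    also have "\<dots> = 1 / real n" by (rule bern_const[OF J])
    finally show "(\<integral>a. bern s J (\<lambda>T. of_bool (\<not> success c n a (K T))) \<partial>M) \<le> 1 / real n" .
  qed
  let ?F = "\<lambda>a. bern p J (\<lambda>T. of_bool (\<not> success c n a (K T))) + bern q J (\<lambda>T. of_bool (\<not> success c n a (K T)))"
  \<comment> \<open>The mean of \<open>?F\<close> is at most \<open>2 / n\<close>; the larger
    constant 3 lets a weak inequality between integrals yield the contradiction.\<close>
  have "\<exists>a\<in>space M. ?F a \<le> 3 / real n"
  proof (rule ccontr)
    assume "\<not> ?thesis"
    then have "(\<integral>a. 3 / real n \<partial>M) \<le> (\<integral>a. ?F a \<partial>M)"
      using E[OF p] E[OF q] by (intro integral_mono) auto
    also have "\<dots> \<le> 1 / real n + 1 / real n" using E[OF p] E[OF q] by simp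
    finally show False using n by (simp add: prob_space field_simps)
  qed
  then obtain a where a: "a \<in> space M" "?F a \<le> 3 / real n" by blast
  moreover have "0 \<le> bern p J (\<lambda>T. of_bool (\<not> success c n a (K T)))"
    "0 \<le> bern q J (\<lambda>T. of_bool (\<not> success c n a (K T)))" by (auto intro!: bern_nonneg p q)
  ultimately show ?thesis by (intro bexI[of _ a]) auto
qed

section \<open>Halting runs and the number of queries\<close>

lemma length_answers:
  "(\<And>j. j < k \<Longrightarrow> \<not> (\<exists>v. a (answers a K j) = Output v)) \<Longrightarrow> length (answers a K k) = k"
proof (induction k)
  case (Suc k)
  then have "length (answers a K k) = k" "\<not> (\<exists>v. a (answers a K k) = Output v)" by auto
  then show ?case by (cases "a (answers a K k)") auto
qed simp

text \<open>A run that had not halted within its first \<open>k\<close> queries would record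
  \<open>Suc k\<close> answers, so the history after \<open>k\<close> steps is final.\<close>

lemma outputs_run:
  assumes "num_queries a K \<le> enat k" "outputs a K V"
  shows "a (run a K k []) = Output V"
proof -
  have "enat (length (answers a K (Suc k))) \<le> num_queries a K"
    unfolding num_queries_def by (rule SUP_upper) simp
  then have "enat (length (answers a K (Suc k))) \<le> enat k" using assms(1) by (rule order_trans)
  then have "length (answers a K (Suc k)) \<noteq> Suc k" by simp
  then obtain j v where j: "j < Suc k" "a (answers a K j) = Output v"
    using length_answers[of "Suc k" a K] by blast
  obtain i where i: "a (answers a K i) = Output V" using assms(2) by (auto simp: outputs_def)
  have "answers a K (j + i) = answers a K j" using answers_stable[of a K j v i] j by simp
  moreover have "answers a K (i + j) = answers a K i" using answers_stable[of a K i V j] i by simp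
  ultimately have "answers a K i = answers a K j" by (simp add: add.commute)
  moreover have "answers a K k = answers a K j"
    using answers_stable[of a K j v "k - j"] j by simp
  ultimately show ?thesis using i by (simp flip: answers_eq_run)
qed

lemma num_queries_le_complexity:
  "a \<in> space M \<Longrightarrow> K \<in> inputs C n \<Longrightarrow> num_queries a K \<le> complexity C n M"
  unfolding complexity_def by (intro SUP_upper2[of a] SUP_upper) auto

text \<open>This settles the finitely many small dimensions. Without queries the output does not
  depend on the body and cannot fit the balls of radius 1 and 2, whose volumes differ by a factor
  \<open>2 ^ n \<ge> 8\<close>. The two success events are then disjoint, with total probability at
  least \<open>2 - 2 / n > 1\<close>.\<close>

lemma complexity_nonzero:
  assumes M: "prob_space M" and n: "2 < n" and C: "2 \<le> C" and c: "0 \<le> c" "c \<le> 1/2"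
    and succ: "\<And>K. K \<in> inputs C n \<Longrightarrow> 1 - 1 / real n \<le> measure M {a \<in> space M. success c n a K}"
  shows "complexity C n M \<noteq> 0"
proof
  assume zero: "complexity C n M = 0"
  interpret prob_space M by (rule M)
  have "1 ^ 8 \<le> real n ^ 8" using n by (intro power_mono) auto
  then have "2 * 1 \<le> C * real n ^ 8" using C by (intro mult_mono) auto
  then have K: "eball n 1 \<in> inputs C n" "eball n 2 \<in> inputs C n"
    using n by (auto intro!: eball_in_inputs)
  let ?S = "\<lambda>K. {a \<in> space M. success c n a K}"
  have S: "?S K \<in> sets M" if "K \<in> inputs C n" for K
    using succ[OF that] n measure_notin_sets[of "?S K" M] by fastforce
  have "?S (eball n 1) \<inter> ?S (eball n 2) = {}"
  proof (rule ccontr)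
    assume "?S (eball n 1) \<inter> ?S (eball n 2) \<noteq> {}"
    then obtain a where a: "a \<in> space M" "success c n a (eball n 1)" "success c n a (eball n 2)" by auto
    have V: "a [] = Output V" if "outputs a K V" "K \<in> inputs C n" for K V
      using outputs_run[of a K 0 V] num_queries_le_complexity[OF a(1) that(2)] that(1) zero
      by (simp add: zero_enat_def)
    obtain V where V1: "a [] = Output V" "V \<le> (1 + c) * vol n (eball n 1)"
      using a(2) V[OF _ K(1)] by (auto simp: success_def)
    then have V2: "(1 - c) * vol n (eball n 2) \<le> V"
      using a(3) V[OF _ K(2)] by (auto simp: success_def)
    have vp: "0 < ball_vol {..<n} 1" by (rule ball_vol_pos) simp
    have "(2::real) ^ 3 \<le> 2 ^ n" using n by (intro power_increasing) auto
    then have "(1/2) * (8 * ball_vol {..<n} 1) \<le> (1 - c) * (2 ^ n * ball_vol {..<n} 1)"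
      using c vp by (intro mult_mono mult_right_mono) auto
    also have "2 ^ n * ball_vol {..<n} 1 = ball_vol {..<n} 2" by (simp add: ball_vol_def)
    also have "(1 - c) * ball_vol {..<n} 2 \<le> (1 + c) * ball_vol {..<n} 1"
      using V1(2) V2 by (simp add: vol_eball)
    also have "\<dots> \<le> (3/2) * ball_vol {..<n} 1" using c vp by (intro mult_right_mono) auto
    finally show False using vp by simp
  qed
  then have "measure M (?S (eball n 1)) + measure M (?S (eball n 2)) = measure M (?S (eball n 1) \<union> ?S (eball n 2))"
    using S K by (intro finite_measure_Union[symmetric]) auto
  also have "\<dots> \<le> 1" by (rule prob_le_1)
  finally have "1 - 1 / real n + (1 - 1 / real n) \<le> 1" using succ[OF K(1)] succ[OF K(2)] by linarith
  then show False using n by (simp add: field_simps)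
qed

subsection \<open>The lower bound\<close>

text \<open>The hypothesis \<open>step\<close> of \<open>affinity_run_ge\<close> for the two
  densities in use. Both sides agree up to first order, as \<open>1/4 + \<theta> / 8\<close>, and so
  a loss of only \<open>\<theta>\<^sup>2\<close> suffices.\<close>

lemma affinity_step:
  fixes \<theta> :: real
  assumes "0 \<le> \<theta>" "\<theta> \<le> 1/2"
  shows "(1 - \<theta>\<^sup>2) * (1 - sqrt ((1 - 1/4) * (1 - (1 + \<theta>) / 4))) \<le> sqrt (1/4 * ((1 + \<theta>) / 4))"
proof -
  have sq: "\<theta>\<^sup>2 \<le> 1/4" using power_mono[of \<theta> "1/2" 2] assms by (simp add: power2_eq_square)
  have c0: "0 \<le> \<theta> * \<theta>\<^sup>2" "\<theta> * \<theta>\<^sup>2 \<le> 1/2 * \<theta>\<^sup>2"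
    using assms mult_right_mono[of \<theta> "1/2" "\<theta>\<^sup>2"] by auto
  have d0: "0 \<le> \<theta>\<^sup>2 * \<theta>\<^sup>2" "\<theta>\<^sup>2 * \<theta>\<^sup>2 \<le> 1/4 * \<theta>\<^sup>2"
    using mult_right_mono[OF sq, of "\<theta>\<^sup>2"] by auto
  have e0: "\<theta>\<^sup>2 * \<theta>\<^sup>2 \<le> 1/2 * (\<theta> * \<theta>\<^sup>2)"
    using mult_right_mono[of "\<theta>" "1/2" "\<theta> * \<theta>\<^sup>2"] assms c0 by (simp add: power2_eq_square mult_ac)
  \<comment> \<open>The second-order Taylor polynomial of \<open>sqrt (1 + \<theta>)\<close> as a
    lower bound.\<close>
  have "(1 + \<theta> / 2 - \<theta>\<^sup>2 / 8)\<^sup>2 = 1 + \<theta> - (\<theta> * \<theta>\<^sup>2) / 8 + (\<theta>\<^sup>2 * \<theta>\<^sup>2) / 64"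
    by (simp add: power2_eq_square algebra_simps)
  then have "((1 + \<theta> / 2 - \<theta>\<^sup>2 / 8) / 4)\<^sup>2 \<le> 1/4 * ((1 + \<theta>) / 4)"
    using e0 c0 by (simp add: power_divide)
  then have 1: "(1 + \<theta> / 2 - \<theta>\<^sup>2 / 8) / 4 \<le> sqrt (1/4 * ((1 + \<theta>) / 4))" by (rule real_le_rsqrt)
  \<comment> \<open>A lower bound for \<open>sqrt (1 - \<theta> / 3)\<close>; the Taylor coefficient
    \<open>1 / 72\<close> is enlarged to \<open>1 / 18\<close> to leave room for the higher
    terms.\<close>
  have "(1 - \<theta> / 6 - \<theta>\<^sup>2 / 18)\<^sup>2 = 1 - \<theta> / 3 - \<theta>\<^sup>2 / 12 + (\<theta> * \<theta>\<^sup>2) / 54 + (\<theta>\<^sup>2 * \<theta>\<^sup>2) / 324"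
    by (simp add: power2_eq_square algebra_simps)
  then have "9/16 * (1 - \<theta> / 6 - \<theta>\<^sup>2 / 18)\<^sup>2 \<le> 9/16 * (1 - \<theta> / 3)"
    using c0 d0 by (intro mult_left_mono) linarith+
  moreover have "(3/4 * (1 - \<theta> / 6 - \<theta>\<^sup>2 / 18))\<^sup>2 = 9/16 * (1 - \<theta> / 6 - \<theta>\<^sup>2 / 18)\<^sup>2"
    unfolding power_mult_distrib by (simp add: power_divide)
  moreover have "9/16 * (1 - \<theta> / 3) = (1 - 1/4) * (1 - (1 + \<theta>) / 4)" by (simp add: field_simps)
  ultimately have "(3/4 * (1 - \<theta> / 6 - \<theta>\<^sup>2 / 18))\<^sup>2 \<le> (1 - 1/4) * (1 - (1 + \<theta>) / 4)" by linarith
  then have "3/4 * (1 - \<theta> / 6 - \<theta>\<^sup>2 / 18) \<le> sqrt ((1 - 1/4) * (1 - (1 + \<theta>) / 4))" by (rule real_le_rsqrt)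
  then have "1 - sqrt ((1 - 1/4) * (1 - (1 + \<theta>) / 4)) \<le> 1/4 + \<theta> / 8 + \<theta>\<^sup>2 / 24" by simp
  then have "(1 - \<theta>\<^sup>2) * (1 - sqrt ((1 - 1/4) * (1 - (1 + \<theta>) / 4))) \<le> (1 - \<theta>\<^sup>2) * (1/4 + \<theta> / 8 + \<theta>\<^sup>2 / 24)"
    using sq by (intro mult_left_mono) auto
  also have "\<dots> = 1/4 + \<theta> / 8 + \<theta>\<^sup>2 / 24 - \<theta>\<^sup>2 / 4 - \<theta> * \<theta>\<^sup>2 / 8 - \<theta>\<^sup>2 * \<theta>\<^sup>2 / 24"
    by (simp add: power2_eq_square field_simps)
  also have "\<dots> \<le> (1 + \<theta> / 2 - \<theta>\<^sup>2 / 8) / 4" 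
  proof -
    have le: "1/4 + \<theta> / 8 + a / 24 - a / 4 - b / 8 - c / 24 \<le> (1 + \<theta> / 2 - a / 8) / 4"
      if "0 \<le> a" "0 \<le> b" "0 \<le> c" for a b c :: real using that by (simp add: field_simps)
    show ?thesis by (rule le[OF zero_le_power2 c0(1) d0(1)])
  qed
  finally show ?thesis using 1 by simp
qed

context polytope begin

text \<open>Chebyshev's inequality over the coins: deviation \<open>Wt p / 10\<close> turns the
  bound \<open>4 * \<epsilon>\<close> into \<open>100 * 4 * \<epsilon>\<close>.\<close>

lemma bern_far_le:
  assumes p: "0 \<le> p" "p \<le> 1/2" and s: "spread p u \<le> 4 * \<epsilon> * (Wt p)\<^sup>2"
  shows "bern p J (\<lambda>T. of_bool (Wt p / 10 < \<bar>vol n (body u T) - Wt p\<bar>)) \<le> 400 * \<epsilon>"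
proof -
  have W: "0 < Wt p" by (rule Wt_pos[OF p])
  have "bern p J (\<lambda>T. of_bool (Wt p / 10 < \<bar>vol n (body u T) - Wt p\<bar>)) \<le>
      bern p J (\<lambda>T. 100 / (Wt p)\<^sup>2 * (vol n (body u T) - Wt p)\<^sup>2)"
  proof (rule bern_mono)
    fix T
    show "of_bool (Wt p / 10 < \<bar>vol n (body u T) - Wt p\<bar>) \<le> 100 / (Wt p)\<^sup>2 * (vol n (body u T) - Wt p)\<^sup>2"
    proof (cases "Wt p / 10 < \<bar>vol n (body u T) - Wt p\<bar>")
      case True
      then have "(Wt p / 10)\<^sup>2 \<le> \<bar>vol n (body u T) - Wt p\<bar>\<^sup>2" using W by (intro power_mono) auto
      then show ?thesis using True W by (simp add: power_divide field_simps)
    qed simp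
  qed (use p in auto)
  also have "\<dots> = 100 / (Wt p)\<^sup>2 * spread p u" unfolding spread_def by (rule bern_cmult)
  also have "\<dots> \<le> 100 / (Wt p)\<^sup>2 * (4 * \<epsilon> * (Wt p)\<^sup>2)" using s by (intro mult_left_mono) auto
  also have "\<dots> = 400 * \<epsilon>" using W by simp
  finally show ?thesis .
qed

text \<open>First the directions and then the algorithm are fixed, so that only the coins remain
  random. An accurate output separates the two densities, while \<open>k\<close> queries keep the
  affinity of the two laws high.\<close>

lemma affinity_lower_bound:
  assumes M: "prob_space M" and n: "1 < n" and C: "0 \<le> C"
    and th: "0 \<le> \<theta>" "\<theta> \<le> 1/2" and gap: "2 * Wt ((1 + \<theta>) / 4) \<le> Wt (1/4)"
    and err: "\<And>b. b < Bl \<Longrightarrow> block.err (I b) z \<le> \<eta>" and eps: "(1 + \<eta>) ^ Bl \<le> 1 + \<epsilon>" "0 < \<epsilon>"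
    and pos: "0 < card J" and h: "sqrt (4 * (card J * n)) \<le> h"
    and r: "1 \<le> r" "real Bl * r\<^sup>2 \<le> (C * real n ^ 8)\<^sup>2"
    and succ: "\<And>K. K \<in> inputs C n \<Longrightarrow> 1 - 1 / real n \<le> measure M {a \<in> space M. success (1/10) n a K}"
    and k: "complexity C n M \<le> enat k"
  shows "(1 - \<theta>\<^sup>2) ^ k \<le> 2 * sqrt (3 / n + 400 * \<epsilon>)"
proof -
  define p where "p = (1/4 :: real)"
  define q where "q = (1 + \<theta>) / 4"
  have p: "0 \<le> p" "p \<le> 1/2" "p \<le> 1" and q: "0 \<le> q" "q \<le> 1/2" "q \<le> 1" using th by (auto simp: p_def q_def)
  obtain u where u: "u \<in> space U" "spread p u \<le> 4 * \<epsilon> * (Wt p)\<^sup>2" "spread q u \<le> 4 * \<epsilon> * (Wt q)\<^sup>2"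
    "\<And>j. j \<in> J \<Longrightarrow> L2_set (u j) {..<n} \<le> sqrt (4 * (card J * n))"
    using exists_directions[OF p(1,2) q(1,2) err eps] pos n by auto
  have K: "body u T \<in> inputs C n" if "T \<subseteq> J" for T
    using n r C by (intro body_in_inputs that order_trans[OF u(4) h]) auto
  obtain a where a: "a \<in> space M"
    "bern p J (\<lambda>T. of_bool (\<not> success (1/10) n a (body u T))) \<le> 3 / n"
    "bern q J (\<lambda>T. of_bool (\<not> success (1/10) n a (body u T))) \<le> 3 / n"
    using exists_good_algorithm[OF M n finite_J p(1,3) q(1,3), of "1/10" "body u"] succ K by auto
  \<comment> \<open>The threshold \<open>0.7\<close> lies between \<open>0.9 * 0.9 = 0.81\<close>,
    the least accurate output near \<open>Wt p\<close>, and \<open>1.1 * 1.1 / 2 = 0.605\<close>,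
    the largest near \<open>Wt q\<close>, both in units of \<open>Wt p\<close>.\<close>
  define E where "E = {l. \<exists>V. a l = Output V \<and> 0.7 * Wt p \<le> V}"
  have W: "0 < Wt p" "0 < Wt q" "2 * Wt q \<le> Wt p"
    using Wt_pos p q gap by (auto simp: p_def q_def)
  have V: "a (run a (body u T) k []) = Output V" if "outputs a (body u T) V" "T \<subseteq> J" for T V
    using outputs_run[OF order_trans[OF num_queries_le_complexity[OF a(1) K[OF that(2)]] k] that(1)] .
  have "bern p J (\<lambda>T. of_bool (run a (body u T) k [] \<notin> E)) \<le>
      bern p J (\<lambda>T. of_bool (\<not> success (1/10) n a (body u T)) +
        of_bool (Wt p / 10 < \<bar>vol n (body u T) - Wt p\<bar>))"
  proof (rule bern_mono[OF p(1,3)])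
    fix T assume T: "T \<subseteq> J"
    have "run a (body u T) k [] \<in> E"
      if s: "success (1/10) n a (body u T)" and near: "\<not> Wt p / 10 < \<bar>vol n (body u T) - Wt p\<bar>"
    proof -
      obtain v where v: "outputs a (body u T) v" "(1 - 1/10) * vol n (body u T) \<le> v"
        using s by (auto simp: success_def)
      have "0.9 * Wt p \<le> vol n (body u T)" using near by linarith
      then have "0.7 * Wt p \<le> v" using v(2) W by simp
      then show ?thesis using V[OF v(1) T] by (auto simp: E_def)
    qed
    then show "of_bool (run a (body u T) k [] \<notin> E) \<le>
      (of_bool (\<not> success (1/10) n a (body u T)) + of_bool (Wt p / 10 < \<bar>vol n (body u T) - Wt p\<bar>) :: real)"
      by auto
  qed
  also have "\<dots> \<le> 3 / n + 400 * \<epsilon>"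
    unfolding bern_add by (intro add_mono a bern_far_le p u)
  finally have 1: "bern p J (\<lambda>T. of_bool (run a (body u T) k [] \<notin> E)) \<le> 3 / n + 400 * \<epsilon>" .
  have "bern q J (\<lambda>T. of_bool (run a (body u T) k [] \<in> E)) \<le>
      bern q J (\<lambda>T. of_bool (\<not> success (1/10) n a (body u T)) +
        of_bool (Wt q / 10 < \<bar>vol n (body u T) - Wt q\<bar>))"
  proof (rule bern_mono[OF q(1,3)])
    fix T assume T: "T \<subseteq> J"
    have "run a (body u T) k [] \<notin> E"
      if s: "success (1/10) n a (body u T)" and near: "\<not> Wt q / 10 < \<bar>vol n (body u T) - Wt q\<bar>"
    proof -
      obtain v where v: "outputs a (body u T) v" "v \<le> (1 + 1/10) * vol n (body u T)"
        using s by (auto simp: success_def)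
      have "vol n (body u T) \<le> 1.1 * Wt q" using near by linarith
      then have "v < 0.7 * Wt p" using v(2) W by simp
      then show ?thesis using V[OF v(1) T] by (auto simp: E_def)
    qed
    then show "of_bool (run a (body u T) k [] \<in> E) \<le>
      (of_bool (\<not> success (1/10) n a (body u T)) + of_bool (Wt q / 10 < \<bar>vol n (body u T) - Wt q\<bar>) :: real)"
      by auto
  qed
  also have "\<dots> \<le> 3 / n + 400 * \<epsilon>"
    unfolding bern_add by (intro add_mono a bern_far_le q u)
  finally have 2: "bern q J (\<lambda>T. of_bool (run a (body u T) k [] \<in> E)) \<le> 3 / n + 400 * \<epsilon>" .
  have "\<theta>\<^sup>2 \<le> 1" using th by (intro power_le_one) auto
  then have "(1 - \<theta>\<^sup>2) ^ k \<le> affinity p q J (\<lambda>T. run a (cut_body base (viol u) ({} \<union> T)) k [] \<in> E)"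
    using affinity_step[OF th] p q finite_J by (intro affinity_run_ge) (auto simp: p_def q_def)
  also have "\<dots> \<le> 2 * sqrt (3 / n + 400 * \<epsilon>)"
    using 1 2 p q finite_J by (intro affinity_le) auto
  finally show ?thesis .
qed

end

text \<open>By \<open>gtail_scale_ge\<close> it suffices that the weight at \<open>2 * z\<close> is
  at least \<open>5 / 8\<close> and that \<open>gtail (2 * z)\<close> is at most a quarter of
  \<open>gtail z\<close>: \<open>5 / 8 * 3 / 4\<close> exceeds \<open>1 / 4\<close>.\<close>

lemma gtail_shell:
  assumes z: "0 < z" "2 \<le> z\<^sup>2" and m: "128 * z\<^sup>2 \<le> 3 * m" "2 \<le> m"
  shows "gtail z / 4 \<le> gtail (z * (m / (m - 1)))"
proof -
  define a where "a = m / (m - 1)"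
  have a: "1 \<le> a" using m by (simp add: a_def)
  have "a\<^sup>2 - 1 = (2 * m - 1) / (m - 1)\<^sup>2"
    using m by (simp add: a_def power_divide field_simps) (simp add: power2_eq_square algebra_simps)
  also have "\<dots> \<le> (2 * m) / (m / 2)\<^sup>2"
    using m by (intro frac_le power_mono) auto
  also have "\<dots> = 8 / m" using m by (simp add: power2_eq_square)
  finally have "(a\<^sup>2 - 1) * (2 * z\<^sup>2) \<le> 8 / m * (2 * z\<^sup>2)" by (intro mult_right_mono) auto
  \<comment> \<open>This is where \<open>128 * z\<^sup>2 \<le> 3 * m\<close> enters: the left side
    is \<open>16 * z\<^sup>2 / m\<close>.\<close>
  also have "\<dots> \<le> 3 / 8" using m by (simp add: field_simps)
  finally have "1 - 3 / 8 \<le> 1 - (a\<^sup>2 - 1) * (2 * z)\<^sup>2 / 2" by (simp add: power_mult_distrib mult_ac)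
  also have "\<dots> \<le> exp (- ((a\<^sup>2 - 1) * (2 * z)\<^sup>2 / 2))"
    using exp_ge_add_one_self[of "- ((a\<^sup>2 - 1) * (2 * z)\<^sup>2 / 2)"] by simp
  finally have e1: "5 / 8 \<le> exp (- ((a\<^sup>2 - 1) * (2 * z)\<^sup>2 / 2))" by simp
  have "(2::real) ^ 3 \<le> exp 1 ^ 3" using exp_ge_add_one_self[of 1] by (intro power_mono) auto
  then have "8 \<le> exp (3 :: real)" by (simp flip: exp_of_nat_mult)
  then have "exp (-3) \<le> (1 / 8 :: real)" by (simp add: exp_minus field_simps)
  moreover have "exp (- ((2\<^sup>2 - 1) * z\<^sup>2 / 2)) \<le> exp (-3 :: real)" using z by simp
  ultimately have "exp (- ((2\<^sup>2 - 1) * z\<^sup>2 / 2)) \<le> 1 / 8" by linarith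
  then have "2 * exp (- ((2\<^sup>2 - 1) * z\<^sup>2 / 2)) * gtail z \<le> 2 * (1 / 8) * gtail z"
    by (intro mult_right_mono mult_left_mono gtail_nonneg) auto
  then have "gtail (2 * z) \<le> gtail z / 4"
    using gtail_scale_le[of 2 z] z by simp
  then have "5 / 8 * (3 / 4 * gtail z) \<le> exp (- ((a\<^sup>2 - 1) * (2 * z)\<^sup>2 / 2)) * (gtail z - gtail (2 * z))"
    using e1 gtail_nonneg[of z] by (intro mult_mono) auto
  also have "\<dots> \<le> gtail (a * z)" using a z by (intro gtail_scale_ge) auto
  finally show ?thesis using gtail_nonneg[of z] by (simp add: a_def mult.commute)
qed

text \<open>The coordinates are cut into blocks of length \<open>d\<close>, the last one absorbing the remainder.\<close>

lemma blocks_partition: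
  fixes n d :: nat
  assumes d: "0 < d" "d \<le> n" and I: "\<And>b. I b = {i. i < n \<and> min (i div d) (n div d - 1) = b}"
  shows "(\<Union>b<n div d. I b) = {..<n}" "disjoint_family_on I {..<n div d}"
    and "b < n div d \<Longrightarrow> d \<le> card (I b)"
proof -
  have pos: "0 < n div d" using d by (simp add: div_greater_zero_iff)
  show "(\<Union>b<n div d. I b) = {..<n}"
  proof (intro equalityI subsetI)
    fix i assume "i \<in> {..<n}"
    then have "i \<in> I (min (i div d) (n div d - 1))" by (simp add: I)
    moreover have "min (i div d) (n div d - 1) < n div d" using pos by linarith
    ultimately show "i \<in> (\<Union>b<n div d. I b)" by blast
  qed (auto simp: I)
  show "disjoint_family_on I {..<n div d}" by (auto simp: disjoint_family_on_def I)
  assume b: "b < n div d"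
  have "{b * d..<b * d + d} \<subseteq> I b"
  proof
    fix i assume i: "i \<in> {b * d..<b * d + d}"
    then have "i div d = b" using d by (intro div_nat_eqI) (auto simp: mult.commute)
    moreover have "b * d + d \<le> n"
    proof -
      have "b * d + d = (b + 1) * d" by simp
      also have "\<dots> \<le> n div d * d" using b by (intro mult_le_mono1) simp
      also have "\<dots> \<le> n" by (rule div_times_less_eq_dividend)
      finally show ?thesis .
    qed
    ultimately show "i \<in> I b" using i b by (auto simp: I)
  qed
  moreover have "finite (I b)" by (simp add: I)
  ultimately have "card {b * d..<b * d + d} \<le> card (I b)" by (intro card_mono)
  then show "d \<le> card (I b)" by simp
qed

text \<open>All parameters are chosen here. The conditions on \<open>n\<close> ensure at least 1024
  blocks and hence \<open>\<theta> \<le> 1/2\<close>, the bound \<open>n * \<eta> \<le> 1\<close>,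
  and that \<open>ln n\<close> dominates the constant \<open>ln (4 * K)\<close>.\<close>

lemma lower_bound_large:
  fixes n k :: nat
  defines "K \<equiv> 3 + 12000 * exp 8 :: real"
  assumes n: "3 \<le> n" "2048 * 257 * ln n \<le> real n" "10 * exp 8 \<le> real n" "2 * ln (4 * K) \<le> ln n"
    and M: "prob_space M"
    and succ: "\<And>K. K \<in> inputs 9 n \<Longrightarrow> 1 - 1 / real n \<le> measure M {a \<in> space M. success (1/10) n a K}"
    and k: "complexity 9 n M \<le> enat k"
  shows "real n ^ 2 / (8 * (1024 * 257)\<^sup>2 * ln n) \<le> real k"
proof -
  define L where "L = ln (real n)"
  have npos: "0 < real n" using n by simp
  have "exp 1 \<le> (3::real)" using e_less_272 by simp
  also have "\<dots> \<le> real n" using n by simp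
  finally have L1: "1 \<le> L" using npos by (simp add: L_def ln_ge_iff)
  have expL: "exp (c * L) = real n ^ c" for c :: nat
    using npos by (simp add: L_def exp_of_nat_mult)
  \<comment> \<open>Dimension \<open>256 * L\<close> makes \<open>sqrt (63 / 64) ^ d\<close> at most
    \<open>1 / n ^ 2\<close>, because \<open>sqrt (63 / 64) \<le> exp (- 1 / 128)\<close>. It also
    meets \<open>gtail_shell\<close> with \<open>z\<^sup>2 = 6 * L\<close>, as
    \<open>128 * 6 = 3 * 256\<close>.\<close>
  define d where "d = nat \<lceil>256 * L\<rceil>"
  have d: "256 * L \<le> real d" "real d \<le> 257 * L"
    using L1 by (auto simp: d_def of_nat_nat) linarith+
  have d2: "2 \<le> d" "256 \<le> d" using d(1) L1 by auto
  have dn: "2048 * real d \<le> real n" using d n(2) by (simp add: L_def)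
  define Bl where "Bl = n div d"
  have "real (n div d * d) + real (n mod d) = real n"
    by (simp only: of_nat_add[symmetric] div_mult_mod_eq)
  moreover have "real (n mod d) \<le> real d" using d2 by (simp add: less_imp_le)
  ultimately have "real n - real d \<le> real Bl * real d" by (simp add: Bl_def)
  then have Bl_d: "real n / 2 \<le> real Bl * real d" using dn by linarith
  then have "1024 * real d \<le> real Bl * real d" using dn by linarith
  then have Bl: "1024 \<le> real Bl" using d2 by (simp add: mult_le_cancel_right)
  have Bl_n: "real Bl \<le> real n" by (simp add: Bl_def)
  define I where "I b = {i. i < n \<and> min (i div d) (n div d - 1) = b}" for b
  have "d \<le> n" using dn by linarith
  then have part: "(\<Union>b<Bl. I b) = {..<n}" "disjoint_family_on I {..<Bl}"
    "\<And>b. b < Bl \<Longrightarrow> d \<le> card (I b)"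
    using blocks_partition[of d n I] d2 by (auto simp: I_def Bl_def)
  \<comment> \<open>The factor 6 makes \<open>7 / 18 * z\<^sup>2 = 7 / 3 * L\<close> exceed
    \<open>2 * L\<close>, so the first term of \<open>err\<close> is of order
    \<open>1 / n ^ 2\<close>.\<close>
  define z where "z = sqrt (6 * L)"
  have z2: "z\<^sup>2 = 6 * L" and z1: "1 \<le> z" using L1 by (auto simp: z_def)
  define Q where "Q = gtail z"
  have Q: "0 < Q" "Q \<le> 1" using gtail_pos[of z] gtail_le_1 z1 by (auto simp: Q_def)
  define N where "N = nat \<lceil>1 / Q\<rceil>"
  have N: "1 / Q \<le> real N" "real N \<le> 1 / Q + 1"
    using Q by (auto simp: N_def of_nat_nat)
  have NQ: "1 \<le> real N * Q" "real N * Q \<le> 2"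
    using mult_right_mono[OF N(1), of Q] mult_right_mono[OF N(2), of Q] Q by (auto simp: algebra_simps)
  have N1: "1 \<le> real N" using N(1) Q by (smt (verit) le_divide_eq_1_pos)
  have N_le: "real N \<le> 18 * real n ^ 6"
  proof -
    \<comment> \<open>A crude bound on the exponent; the radius \<open>9 * n ^ 8\<close> leaves room
      for the resulting \<open>n ^ 6\<close>.\<close>
    have "(z + 1)\<^sup>2 / 2 \<le> z\<^sup>2 + 1" using sum_squares_bound[of z 1] by (simp add: power2_sum)
    then have "exp (- (z\<^sup>2 + 1)) / 3 \<le> exp (- ((z + 1)\<^sup>2 / 2)) / 3" by simp
    also have "\<dots> \<le> Q" unfolding Q_def using z1 by (intro gtail_ge) auto
    finally have "1 / Q \<le> 1 / (exp (- (z\<^sup>2 + 1)) / 3)" using Q by (intro divide_left_mono) auto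
    also have "\<dots> = 3 * exp (z\<^sup>2) * exp 1"
    proof -
      have "1 / (exp (- w) / 3) = 3 * exp w" for w :: real by (simp add: exp_minus field_simps)
      then show ?thesis by (simp only: exp_add mult.assoc)
    qed
    also have "\<dots> \<le> 3 * exp (z\<^sup>2) * 3" using \<open>exp 1 \<le> 3\<close> by (intro mult_left_mono) auto
    also have "exp (z\<^sup>2) = real n ^ 6" using expL[of 6] by (simp add: z2)
    finally have "1 / Q \<le> 9 * real n ^ 6" by simp
    moreover have "1 \<le> 1 / Q" using Q by simp
    ultimately show ?thesis using N(2) by linarith
  qed
  \<comment> \<open>The offset equals the bound on the lengths of the normals in
    \<open>exists_directions\<close>, so that the unit ball survives; the radius \<open>r\<close> is
    then dictated by \<open>h = z * r\<close>.\<close>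
  define h where "h = sqrt (4 * (real (Bl * N) * real n))"
  define r where "r = h / z"
  have h2: "h\<^sup>2 = 4 * (real Bl * real N * real n)" by (simp add: h_def)
  have h_pos: "0 < h" using Bl N1 npos by (simp add: h_def)
  have z_le_h: "z \<le> h"
  proof (rule power2_le_imp_le)
    have "ln (real n) \<le> real n - 1" using npos by (rule ln_le_minus_one)
    then have "6 * L \<le> 1024 * real n" by (simp add: L_def)
    also have "\<dots> \<le> real Bl * real N * real n"
      using Bl N1 mult_mono[of 1024 "real Bl" 1 "real N"] by (intro mult_right_mono) auto
    also have "\<dots> \<le> h\<^sup>2" by (simp add: h2)
    finally show "z\<^sup>2 \<le> h\<^sup>2" by (simp add: z2)
  qed (use h_pos in auto)
  have r: "1 \<le> r" "r \<le> h" "h = z * r" using z_le_h z1 h_pos by (auto simp: r_def field_simps)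
  have "real Bl * r\<^sup>2 \<le> real n * h\<^sup>2" using r Bl_n by (intro mult_mono power_mono) auto
  also have "\<dots> \<le> real n * (4 * (real n * (18 * real n ^ 6) * real n))"
    unfolding h2 using Bl_n N_le npos by (intro mult_left_mono mult_mono) auto
  also have "\<dots> = 72 * real n ^ 9" by (simp add: eval_nat_numeral)
  also have "\<dots> \<le> 81 * real n ^ 16" using n(1) by (intro mult_mono power_increasing) auto
  also have "\<dots> = (9 * real n ^ 8)\<^sup>2" by (simp add: power_mult_distrib flip: power_mult)
  finally have R: "real Bl * r\<^sup>2 \<le> (9 * real n ^ 8)\<^sup>2" .
  have block: "block (I b) {..<n} r z h Q N" if b: "b < Bl" for b
  proof
    have "real d \<le> real (card (I b))" using part(3)[OF b] by simp
    then have "128 * z\<^sup>2 \<le> 3 * real (card (I b))" using d by (simp add: z2)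
    moreover show "2 \<le> card (I b)" using part(3)[OF b] d2 by simp
    ultimately show "Q / 4 \<le> gtail (z * (real (card (I b)) / (real (card (I b)) - 1)))"
      unfolding Q_def using z1 z2 L1 by (intro gtail_shell) auto
    show "I b \<subseteq> {..<n}" by (auto simp: I_def)
  qed (use r z1 NQ in \<open>auto simp: Q_def\<close>)
  interpret polytope n Bl N I r z h Q
    by (rule polytope.intro[OF part(1,2) block])
  \<comment> \<open>\<open>10\<close> bounds \<open>4 * (4 / 3 + 1)\<close> in \<open>err\<close>;
    \<open>\<epsilon>\<close> is \<open>n * \<eta>\<close> times 3, an upper bound for
    \<open>exp 1\<close>.\<close>
  define \<eta> where "\<eta> = 10 * exp 8 / (real n)\<^sup>2"
  define \<epsilon> where "\<epsilon> = 30 * exp 8 / real n"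
  have err: "block.err (I b) z \<le> \<eta>" if b: "b < Bl" for b
  proof -
    have "exp (- (7 / 18 * z\<^sup>2)) \<le> exp (- (real 2 * L))" using L1 by (simp add: z2)
    also have "\<dots> = 1 / (real n)\<^sup>2" using expL[of 2] by (simp add: exp_minus field_simps)
    finally have 1: "exp (- (7 / 18 * z\<^sup>2)) \<le> 1 / (real n)\<^sup>2" .
    have "sqrt (63 / 64) \<le> exp (- 1 / 128 :: real)"
    proof (rule real_le_lsqrt)
      show "63 / 64 \<le> (exp (- 1 / 128 :: real))\<^sup>2"
        using exp_ge_add_one_self[of "- 1 / 64"] by (simp add: power2_eq_square flip: exp_add)
    qed auto
    then have "sqrt (63 / 64) ^ card (I b) \<le> exp (- 1 / 128 :: real) ^ card (I b)" by (intro power_mono) auto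
    also have "\<dots> = exp (- (real (card (I b)) / 128))" by (simp flip: exp_of_nat_mult)
    also have "\<dots> \<le> exp (- (real 2 * L))"
      using part(3)[OF b] d(1) by simp
    also have "\<dots> = 1 / (real n)\<^sup>2" using expL[of 2] by (simp add: exp_minus field_simps)
    finally have 2: "sqrt (63 / 64) ^ card (I b) \<le> 1 / (real n)\<^sup>2" .
    have "block.err (I b) z \<le> 4 * exp 8 * (4 / 3 * (1 / (real n)\<^sup>2) + 1 / (real n)\<^sup>2)"
      unfolding block.err_def[OF block[OF b]] by (intro mult_left_mono add_mono 1 2) auto
    also have "\<dots> \<le> \<eta>" using npos by (simp add: \<eta>_def field_simps)
    finally show ?thesis .
  qed
  have eps: "(1 + \<eta>) ^ Bl \<le> 1 + \<epsilon>" "0 < \<epsilon>"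
  proof -
    show "0 < \<epsilon>" using npos by (simp add: \<epsilon>_def)
    have eta: "0 \<le> \<eta>" by (simp add: \<eta>_def)
    have "(1 + \<eta>) ^ Bl \<le> exp \<eta> ^ Bl" using eta by (intro power_mono) auto
    also have "\<dots> = exp (real Bl * \<eta>)" by (simp add: exp_of_nat_mult)
    also have "\<dots> \<le> exp (real n * \<eta>)" using Bl_n eta by (simp add: mult_right_mono)
    also have "real n * \<eta> = 10 * exp 8 / real n" using npos by (simp add: \<eta>_def power2_eq_square)
    also have "exp (10 * exp 8 / real n) \<le> 1 + 10 * exp 8 / real n * exp 1"
      using n npos by (intro exp_le_linear) auto
    also have "\<dots> \<le> 1 + 10 * exp 8 / real n * 3"
      using \<open>exp 1 \<le> 3\<close> npos by (intro add_left_mono mult_left_mono) auto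
    finally show "(1 + \<eta>) ^ Bl \<le> 1 + \<epsilon>" by (simp add: \<epsilon>_def)
  qed
  \<comment> \<open>By \<open>W_decrease\<close> each block then loses a fraction
    \<open>\<theta> / 512 = 1 / Bl\<close>, and \<open>(1 - 1 / Bl) ^ Bl\<close> is at most
    \<open>1/2\<close>.\<close>
  define \<theta> where "\<theta> = 512 / real Bl"
  have th: "0 < \<theta>" "\<theta> \<le> 1/2" using Bl by (auto simp: \<theta>_def)
  have gap: "2 * Wt ((1 + \<theta>) / 4) \<le> Wt (1/4)"
  proof -
    have "Wt ((1 + \<theta>) / 4) \<le> (\<Prod>b<Bl. (1 - \<theta> / 512) * block.W (I b) r h N (1/4))"
      unfolding Wt_def using th block.W_pos[OF block] block.W_decrease[OF block]
      by (intro prod_mono) (auto intro: less_imp_le)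
    also have "\<dots> = (1 - 1 / real Bl) ^ Bl * Wt (1/4)"
      by (simp add: prod.distrib Wt_def \<theta>_def)
    also have "\<dots> \<le> 1/2 * Wt (1/4)"
    proof (rule mult_right_mono)
      have "(1 - 1 / real Bl) ^ Bl \<le> exp (- (1 / real Bl)) ^ Bl"
        using Bl exp_ge_add_one_self[of "- (1 / real Bl)"] by (intro power_mono) auto
      also have "\<dots> = exp (-1)" using Bl by (simp flip: exp_of_nat_mult)
      also have "\<dots> \<le> 1/2" using exp_minus_le_half[of 1] by simp
      finally show "(1 - 1 / real Bl) ^ Bl \<le> 1/2" .
      show "0 \<le> Wt (1/4)" using Wt_pos[of "1/4"] by simp
    qed
    finally show ?thesis by simp
  qed
  have cardJ: "card J = Bl * N" by (simp add: J_def)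
  have pos: "0 < card J" using Bl N1 by (simp add: cardJ)
  have hJ: "sqrt (4 * (card J * n)) \<le> h" by (simp add: cardJ h_def)
  have n1: "1 < n" using n by simp
  have "(1 - \<theta>\<^sup>2) ^ k \<le> 2 * sqrt (3 / n + 400 * \<epsilon>)"
    using affinity_lower_bound[OF M n1 _ _ th(2) gap err eps pos hJ r(1) R succ k] th by simp
  also have "\<dots> = sqrt (4 * K / real n)"
  proof -
    have "2 * sqrt t = sqrt (4 * t)" for t by (simp add: real_sqrt_mult)
    moreover have "4 * (3 / n + 400 * \<epsilon>) = 4 * K / real n"
      using npos by (simp add: K_def \<epsilon>_def field_simps)
    ultimately show ?thesis by (simp only:)
  qed
  finally have up: "(1 - \<theta>\<^sup>2) ^ k \<le> sqrt (4 * K / real n)" .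
  have th2: "\<theta>\<^sup>2 \<le> 1/2" using power_mono[OF th(2), of 2] th by (simp add: power2_eq_square)
  have "exp (- (2 * \<theta>\<^sup>2 * real k)) = exp (- (2 * \<theta>\<^sup>2)) ^ k"
    by (simp add: mult_ac flip: exp_of_nat_mult)
  also have "\<dots> \<le> (1 - \<theta>\<^sup>2) ^ k" using th2 by (intro power_mono one_minus_ge_exp) auto
  also note up
  finally have le: "exp (- (2 * \<theta>\<^sup>2 * real k)) \<le> sqrt (4 * K / real n)" .
  have Kpos: "0 < 4 * K" unfolding K_def by (intro mult_pos_pos add_pos_pos) auto
  have "- (2 * \<theta>\<^sup>2 * real k) \<le> ln (sqrt (4 * K / real n))"
    using le Kpos npos by (subst ln_ge_iff) auto
  also have "\<dots> = (ln (4 * K) - L) / 2"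
    using Kpos npos by (simp add: ln_sqrt ln_div L_def)
  \<comment> \<open>The constant satisfies \<open>ln (4 * K) \<le> L / 2\<close>.\<close>
  also have "\<dots> \<le> - (L / 4)" using n(4) by (simp add: L_def)
  finally have "L \<le> 8 * (\<theta>\<^sup>2 * real k)" by simp
  \<comment> \<open>The blocks cover at least half of the coordinates before the remainder is
    counted, \<open>Bl * d \<ge> n / 2\<close>, and \<open>257 * L\<close> bounds \<open>d\<close>
    after rounding up because \<open>L \<ge> 1\<close>.\<close>
  moreover have "\<theta> \<le> 1024 * 257 * L / real n"
  proof -
    have "512 * (real n / 2) \<le> 512 * (real Bl * real d)" using Bl_d by simp
    also have "\<dots> \<le> 512 * (real Bl * (257 * L))" using d by (intro mult_left_mono) auto
    finally show ?thesis using Bl npos by (simp add: \<theta>_def field_simps)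
  qed
  then have "\<theta>\<^sup>2 \<le> (1024 * 257 * L / real n)\<^sup>2" using th by (intro power_mono) auto
  then have "8 * (\<theta>\<^sup>2 * real k) \<le> 8 * ((1024 * 257 * L / real n)\<^sup>2 * real k)"
    by (intro mult_left_mono mult_right_mono) auto
  ultimately have "L \<le> 8 * ((1024 * 257 * L / real n)\<^sup>2 * real k)" by linarith
  then have "L * (real n)\<^sup>2 \<le> L * (8 * (1024 * 257)\<^sup>2 * L * real k)"
    using npos by (simp add: power_divide power_mult_distrib field_simps) (simp add: power2_eq_square algebra_simps)
  then have "(real n)\<^sup>2 \<le> 8 * (1024 * 257)\<^sup>2 * L * real k"
    using L1 by (subst (asm) mult_le_cancel_left_pos) auto
  then show ?thesis using L1 by (simp add: L_def field_simps)
qed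

theorem theorem4:
  "\<exists>c C c' :: real. c > 0 \<and> C > 0 \<and> c' > 0 \<and>
     (\<forall>n :: nat. n > 12 \<longrightarrow>
       (\<forall>M :: algorithm measure.
          randomized_algorithm n M \<longrightarrow>
          (\<forall>K \<in> inputs C n.
             measure M {a \<in> space M. \<exists>V. outputs a K V \<and>
                (1 - c) * vol n K \<le> V \<and> V \<le> (1 + c) * vol n K} \<ge> 1 - 1 / real n) \<longrightarrow>
          ereal (c' * (real n)\<^sup>2 / ln (real n)) \<le> ereal_of_enat (complexity C n M)))"
proof -
  define K where "K = (3 + 12000 * exp 8 :: real)"
  have "((\<lambda>x::real. ln x / x) \<longlongrightarrow> 0) at_top" by (rule ln_x_over_x_tendsto_0)
  then have "\<forall>\<^sub>F x in at_top. ln x / x < 1 / (2048 * 257 :: real)"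
    by (rule order_tendstoD) simp
  moreover have "\<forall>\<^sub>F x in at_top. max 1 (max (10 * exp 8) (exp (2 * ln (4 * K)))) \<le> (x :: real)"
    by (rule eventually_ge_at_top)
  ultimately have "\<forall>\<^sub>F x :: real in at_top. 2048 * 257 * ln x \<le> x \<and> 10 * exp 8 \<le> x \<and> 2 * ln (4 * K) \<le> ln x"
  proof eventually_elim
    case (elim x)
    then have "0 < x" by linarith
    then show ?case using elim by (auto simp: field_simps ln_ge_iff)
  qed
  then have "\<forall>\<^sub>F n :: nat in sequentially. 2048 * 257 * ln (real n) \<le> real n \<and> 10 * exp 8 \<le> real n \<and>
      2 * ln (4 * K) \<le> ln (real n)"
    by (rule eventually_compose_filterlim[OF _ filterlim_real_sequentially])
  then obtain n0 :: nat where n0: "\<And>n. n \<ge> n0 \<Longrightarrow> 2048 * 257 * ln (real n) \<le> real n \<and> 10 * exp 8 \<le> real n \<and>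
      2 * ln (4 * K) \<le> ln (real n)"
    unfolding eventually_sequentially by blast
  \<comment> \<open>The second entry keeps the claimed bound at most 1 for \<open>n < n0\<close>,
    where \<open>complexity_nonzero\<close> suffices.\<close>
  define c' where "c' = min (1 / (8 * (1024 * 257)\<^sup>2)) (1 / (real n0 + 1)\<^sup>2)"
  have c': "0 < c'" "c' \<le> 1 / (8 * (1024 * 257)\<^sup>2)" "c' \<le> 1 / (real n0 + 1)\<^sup>2" by (auto simp: c'_def)
  have main: "ereal (c' * (real n)\<^sup>2 / ln (real n)) \<le> ereal_of_enat (complexity 9 n M)"
    if n: "12 < n" and M: "prob_space M"
      and succ: "\<And>K. K \<in> inputs 9 n \<Longrightarrow> 1 - 1 / real n \<le> measure M {a \<in> space M. success (1/10) n a K}"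
    for n :: nat and M
  proof (cases "complexity 9 n M")
    case (enat k)
    have "exp 1 \<le> (3::real)" using e_less_272 by simp
    then have "exp 1 \<le> real n" using n by linarith
    then have L1: "1 \<le> ln (real n)" using n by (simp add: ln_ge_iff)
    have "c' * (real n)\<^sup>2 / ln (real n) \<le> real k"
    proof (cases "n0 \<le> n")
      case True
      have "c' * (real n)\<^sup>2 / ln (real n) \<le> 1 / (8 * (1024 * 257)\<^sup>2) * (real n)\<^sup>2 / ln (real n)"
        using c' L1 by (intro divide_right_mono mult_right_mono) auto
      also have "\<dots> = real n ^ 2 / (8 * (1024 * 257)\<^sup>2 * ln n)" by simp
      also have "\<dots> \<le> real k"
        using n n0[OF True] enat by (intro lower_bound_large[OF _ _ _ _ M succ]) (auto simp: K_def)
      finally show ?thesis .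
    next
      case False
      have "complexity 9 n M \<noteq> 0"
        by (rule complexity_nonzero[of M n 9 "1/10"]) (use n M succ in auto)
      then have "1 \<le> real k" using enat by (cases k) (auto simp: zero_enat_def)
      have "c' * (real n)\<^sup>2 / ln (real n) \<le> c' * (real n)\<^sup>2 / 1"
        using c' L1 by (intro divide_left_mono) auto
      also have "\<dots> \<le> 1 / (real n0 + 1)\<^sup>2 * (real n0 + 1)\<^sup>2"
        unfolding div_by_1 using c' False by (intro mult_mono power_mono) auto
      also have "\<dots> = 1" by (simp add: add_nonneg_eq_0_iff)
      finally show ?thesis using \<open>1 \<le> real k\<close> by linarith
    qed
    then show ?thesis using enat by simp
  qed simp
  show ?thesis
    by (rule exI[of _ "1/10"], rule exI[of _ 9], rule exI[of _ c'])
      (use main c'(1) in \<open>auto simp: randomized_algorithm_def success_def\<close>)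
qed

end
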